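(* Let $G=(V,E)$ be an undirected graph with $m$ edges, $n$ vertices indexed $1,\ldots,n$, and non-negative edge weights $w$, and let $s\in V$. A lex-shortest path tree of $G$ with source $s$ can be computed in $O((m+n)\log n)$ time.
   Context: For two paths $P,P'$ between the same pair of vertices, $P$ is lex-shorter than $P'$ if one of the following holds: (1) $w(P)<w(P')$; (2) $w(P)=w(P')$ and $P$ has fewer edges than $P'$; (3) $w(P)=w(P')$, $P$ and $P'$ have the same number of edges, and the smallest index of a vertex in $V_P\setminus V_{P'}$ is smaller than the smallest index of a vertex in $V_{P'}\setminus V_P$ (here $w(P)$ is the sum of edge weights and $V_P$ the vertex set of $P$). A lex-shortest path between two vertices is a path that is minimal with respect to this order among all paths between them; a lex-shortest path tree with source $s$ is a tree rooted at $s$ spanning the vertices reachable from $s$ in which, for each such vertex $v$, the tree path from $s$ to $v$ is the lex-shortest $s$–$v$ path. *)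

theory Defs
  imports Complex_Main
begin

section \<open>Weighted graphs and paths\<close>

text \<open>
  Graphs are simple and undirected: an edge is a two-element set of vertices. The vertices are
  identified with their indices \<open>1, \<dots>, n\<close>.
\<close>

definition weighted_graph :: "nat \<Rightarrow> nat set set \<Rightarrow> (nat set \<Rightarrow> real) \<Rightarrow> bool" where
  "weighted_graph n E w \<longleftrightarrow>
     (\<forall>e\<in>E. \<exists>u\<in>{1..n}. \<exists>v\<in>{1..n}. u \<noteq> v \<and> e = {u, v}) \<and> (\<forall>e\<in>E. 0 \<le> w e)"

text \<open>A path is given by the list of its vertices, which are pairwise distinct.\<close>

definition path_between :: "nat set \<Rightarrow> nat set set \<Rightarrow> nat \<Rightarrow> nat \<Rightarrow> nat list \<Rightarrow> bool" where
  "path_between V E u v p \<longleftrightarrow>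
     p \<noteq> [] \<and> hd p = u \<and> last p = v \<and> distinct p \<and> set p \<subseteq> V \<and>
     (\<forall>i. Suc i < length p \<longrightarrow> {p ! i, p ! Suc i} \<in> E)"

definition num_edges :: "nat list \<Rightarrow> nat" where
  "num_edges p = length p - 1"

definition path_weight :: "(nat set \<Rightarrow> real) \<Rightarrow> nat list \<Rightarrow> real" where
  "path_weight w p = (\<Sum>i<num_edges p. w {p ! i, p ! Suc i})"

definition reachable :: "nat set \<Rightarrow> nat set set \<Rightarrow> nat \<Rightarrow> nat set" where
  "reachable V E s = {v. \<exists>p. path_between V E s v p}"

section \<open>Lex-shortest paths and lex-shortest path trees\<close>

text \<open>
  In the third clause both differences are required to be nonempty, so that the minima exist.
  For paths with the same number of edges one difference is empty iff the other one is; two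
  paths with the same vertex set, weight and number of edges are thus incomparable.
\<close>

definition lex_shorter :: "(nat set \<Rightarrow> real) \<Rightarrow> nat list \<Rightarrow> nat list \<Rightarrow> bool" where
  "lex_shorter w p q \<longleftrightarrow>
     path_weight w p < path_weight w q \<or>
     path_weight w p = path_weight w q \<and> num_edges p < num_edges q \<or>
     path_weight w p = path_weight w q \<and> num_edges p = num_edges q \<and>
       set p - set q \<noteq> {} \<and> set q - set p \<noteq> {} \<and> Min (set p - set q) < Min (set q - set p)"

definition lex_shortest ::
    "nat set \<Rightarrow> nat set set \<Rightarrow> (nat set \<Rightarrow> real) \<Rightarrow> nat \<Rightarrow> nat \<Rightarrow> nat list \<Rightarrow> bool" where
  "lex_shortest V E w u v p \<longleftrightarrow>
     path_between V E u v p \<and> \<not> (\<exists>q. path_between V E u v q \<and> lex_shorter w q p)"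

definition is_cycle :: "nat set set \<Rightarrow> nat list \<Rightarrow> bool" where
  "is_cycle T p \<longleftrightarrow>
     3 \<le> length p \<and> distinct p \<and> (\<forall>i. Suc i < length p \<longrightarrow> {p ! i, p ! Suc i} \<in> T) \<and>
     {last p, hd p} \<in> T"

definition is_tree :: "nat set \<Rightarrow> nat set set \<Rightarrow> bool" where
  "is_tree R T \<longleftrightarrow>
     R \<noteq> {} \<and> (\<forall>e\<in>T. \<exists>u\<in>R. \<exists>v\<in>R. u \<noteq> v \<and> e = {u, v}) \<and>
     (\<forall>u\<in>R. \<forall>v\<in>R. \<exists>p. path_between R T u v p) \<and> (\<forall>p. \<not> is_cycle T p)"

text \<open>A lex-shortest path tree is given by its edge set \<open>T\<close>; its root is \<open>s\<close>.\<close>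

definition lex_shortest_path_tree ::
    "nat set \<Rightarrow> nat set set \<Rightarrow> (nat set \<Rightarrow> real) \<Rightarrow> nat \<Rightarrow> nat set set \<Rightarrow> bool" where
  "lex_shortest_path_tree V E w s T \<longleftrightarrow>
     T \<subseteq> E \<and> is_tree (reachable V E s) T \<and>
     (\<forall>v\<in>reachable V E s. \<forall>p. path_between (reachable V E s) T s v p \<longrightarrow> lex_shortest V E w s v p)"

section \<open>The machine model\<close>

text \<open>
  A word RAM, programmed in a structured language. Memory consists of finitely many (per program)
  named arrays of words and of reals; a scalar variable is cell \<open>0\<close> of an array. Words have
  \<open>b\<close> bits and word arithmetic wraps around (except that subtraction truncates at \<open>0\<close>).
  Reals are held exactly, but can only be copied, added and compared. In particular there is no
  conversion between reals and words. As usual for word RAMs, \<open>b\<close> is at least a constant times the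
  logarithm of the input size; a program is expected to work for every such \<open>b\<close>.
\<close>

record store =
  words :: "string \<Rightarrow> nat \<Rightarrow> nat"
  reals :: "string \<Rightarrow> nat \<Rightarrow> real"

datatype wexp =
    Const nat
  | Cell string wexp
  | Plus wexp wexp
  | Minus wexp wexp
  | Times wexp wexp
  | Div wexp wexp

datatype rexp =
    RZero
  | RCell string wexp
  | RPlus rexp rexp

datatype test =
    WLess wexp wexp
  | RLess rexp rexp
  | TNot test
  | TAnd test test

datatype com =
    Skip
  | Store string wexp wexp
  | RStore string wexp rexp
  | Seq com com
  | Cond test com com
  | While test com

primrec wval :: "nat \<Rightarrow> wexp \<Rightarrow> store \<Rightarrow> nat" where
  "wval b (Const c) \<sigma> = c mod 2 ^ b"
| "wval b (Cell a i) \<sigma> = words \<sigma> a (wval b i \<sigma>)"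
| "wval b (Plus x y) \<sigma> = (wval b x \<sigma> + wval b y \<sigma>) mod 2 ^ b"
| "wval b (Minus x y) \<sigma> = wval b x \<sigma> - wval b y \<sigma>"
| "wval b (Times x y) \<sigma> = (wval b x \<sigma> * wval b y \<sigma>) mod 2 ^ b"
| "wval b (Div x y) \<sigma> = wval b x \<sigma> div wval b y \<sigma>"

primrec rval :: "nat \<Rightarrow> rexp \<Rightarrow> store \<Rightarrow> real" where
  "rval b RZero \<sigma> = 0"
| "rval b (RCell a i) \<sigma> = reals \<sigma> a (wval b i \<sigma>)"
| "rval b (RPlus x y) \<sigma> = rval b x \<sigma> + rval b y \<sigma>"

primrec tval :: "nat \<Rightarrow> test \<Rightarrow> store \<Rightarrow> bool" where
  "tval b (WLess x y) \<sigma> \<longleftrightarrow> wval b x \<sigma> < wval b y \<sigma>"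
| "tval b (RLess x y) \<sigma> \<longleftrightarrow> rval b x \<sigma> < rval b y \<sigma>"
| "tval b (TNot c) \<sigma> \<longleftrightarrow> \<not> tval b c \<sigma>"
| "tval b (TAnd c d) \<sigma> \<longleftrightarrow> tval b c \<sigma> \<and> tval b d \<sigma>"

text \<open>Unit cost for every constant, memory access, arithmetic operation and comparison.\<close>

primrec wcost :: "wexp \<Rightarrow> nat" where
  "wcost (Const c) = 1"
| "wcost (Cell a i) = 1 + wcost i"
| "wcost (Plus x y) = 1 + wcost x + wcost y"
| "wcost (Minus x y) = 1 + wcost x + wcost y"
| "wcost (Times x y) = 1 + wcost x + wcost y"
| "wcost (Div x y) = 1 + wcost x + wcost y"

primrec rcost :: "rexp \<Rightarrow> nat" where
  "rcost RZero = 1"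
| "rcost (RCell a i) = 1 + wcost i"
| "rcost (RPlus x y) = 1 + rcost x + rcost y"

primrec tcost :: "test \<Rightarrow> nat" where
  "tcost (WLess x y) = 1 + wcost x + wcost y"
| "tcost (RLess x y) = 1 + rcost x + rcost y"
| "tcost (TNot c) = 1 + tcost c"
| "tcost (TAnd c d) = 1 + tcost c + tcost d"

definition set_word :: "string \<Rightarrow> nat \<Rightarrow> nat \<Rightarrow> store \<Rightarrow> store" where
  "set_word a i x \<sigma> = \<sigma>\<lparr>words := (words \<sigma>)(a := (words \<sigma> a)(i := x))\<rparr>"

definition set_real :: "string \<Rightarrow> nat \<Rightarrow> real \<Rightarrow> store \<Rightarrow> store" where
  "set_real a i x \<sigma> = \<sigma>\<lparr>reals := (reals \<sigma>)(a := (reals \<sigma> a)(i := x))\<rparr>"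

text \<open>
  \<open>exec b c \<sigma> t \<sigma>'\<close>: on a machine with \<open>b\<close>-bit words, \<open>c\<close> started in \<open>\<sigma>\<close> halts in \<open>\<sigma>'\<close>
  after \<open>t\<close> steps.
\<close>

inductive exec :: "nat \<Rightarrow> com \<Rightarrow> store \<Rightarrow> nat \<Rightarrow> store \<Rightarrow> bool" for b :: nat where
  Skip: "exec b Skip \<sigma> 1 \<sigma>"
| Store: "exec b (Store a i x) \<sigma> (1 + wcost i + wcost x) (set_word a (wval b i \<sigma>) (wval b x \<sigma>) \<sigma>)"
| RStore: "exec b (RStore a i x) \<sigma> (1 + wcost i + rcost x) (set_real a (wval b i \<sigma>) (rval b x \<sigma>) \<sigma>)"
| Seq: "exec b c \<sigma> t \<sigma>' \<Longrightarrow> exec b d \<sigma>' t' \<sigma>'' \<Longrightarrow> exec b (Seq c d) \<sigma> (t + t') \<sigma>''"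
| CondTrue: "tval b g \<sigma> \<Longrightarrow> exec b c \<sigma> t \<sigma>' \<Longrightarrow> exec b (Cond g c d) \<sigma> (1 + tcost g + t) \<sigma>'"
| CondFalse: "\<not> tval b g \<sigma> \<Longrightarrow> exec b d \<sigma> t \<sigma>' \<Longrightarrow> exec b (Cond g c d) \<sigma> (1 + tcost g + t) \<sigma>'"
| WhileFalse: "\<not> tval b g \<sigma> \<Longrightarrow> exec b (While g c) \<sigma> (1 + tcost g) \<sigma>"
| WhileTrue: "tval b g \<sigma> \<Longrightarrow> exec b c \<sigma> t \<sigma>' \<Longrightarrow> exec b (While g c) \<sigma>' t' \<sigma>'' \<Longrightarrow>
    exec b (While g c) \<sigma> (1 + tcost g + t + t') \<sigma>''"

section \<open>Input and output\<close>

text \<open>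
  The input graph is an edge list: every edge occurs exactly once, in any order and in
  either orientation.
\<close>

definition edge_list :: "nat set set \<Rightarrow> (nat \<times> nat) list \<Rightarrow> bool" where
  "edge_list E es \<longleftrightarrow>
     distinct (map (\<lambda>(u, v). {u, v}) es) \<and> set (map (\<lambda>(u, v). {u, v}) es) = E"

definition input_store ::
    "nat \<Rightarrow> nat \<Rightarrow> (nat \<times> nat) list \<Rightarrow> (nat set \<Rightarrow> real) \<Rightarrow> store" where
  "input_store n s es w =
     \<lparr>words = (\<lambda>a i.
        if a = ''n'' \<and> i = 0 then n
        else if a = ''m'' \<and> i = 0 then length es
        else if a = ''s'' \<and> i = 0 then s
        else if a = ''u'' \<and> i < length es then fst (es ! i)
        else if a = ''v'' \<and> i < length es then snd (es ! i)
        else 0),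
      reals = (\<lambda>a i.
        if a = ''w'' \<and> i < length es then w {fst (es ! i), snd (es ! i)} else 0)\<rparr>"

text \<open>
  The output is an array of parent pointers: for every tree vertex other than the root, its
  predecessor on the tree path from \<open>s\<close>; for the root and all vertices outside the tree, \<open>0\<close>
  (which is not the index of a vertex).
\<close>

definition parent_array :: "nat \<Rightarrow> nat set \<Rightarrow> nat set set \<Rightarrow> nat \<Rightarrow> (nat \<Rightarrow> nat) \<Rightarrow> bool" where
  "parent_array n R T s par \<longleftrightarrow>
     (\<forall>v\<in>{1..n}.
        if v \<in> R - {s}
        then \<exists>p. path_between R T s v p \<and> par v = p ! (length p - 2)
        else par v = 0)"

end

theory Submission imports Defs begin

text \<open>
  For paths of equal length, condition (3) compares the sums of \<open>(1/2) ^ v\<close> over the vertices \<open>v\<close> of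
  the paths, so lex-shortness is a linear order on triples of numbers. Prefixes of lex-shortest paths
  are lex-shortest, hence these paths are unique and form a tree.

  Dijkstra's algorithm with keys (weight, number of edges) finds the tree, provided that of two offers
  with the same key the lex-shorter one is kept. The offers \<open>P\<^sub>x v\<close> and \<open>P\<^sub>y v\<close> end at vertices \<open>x\<close> and \<open>y\<close> of
  equal depth in the tree built so far, and \<open>P\<^sub>x\<close> and \<open>P\<^sub>y\<close> differ exactly below the lowest common
  ancestor. The least vertices below it are found in \<open>O(log n)\<close> steps by binary lifting, where each
  jump of length \<open>2 ^ j\<close> is stored with the least vertex on it. The priority queue is a tournament tree
  whose leaves are the vertices.
\<close>

section \<open>Lex-shortest paths\<close>

text \<open>Clause (3) compares vertex sets only, so distinct paths with equal weight and equal
  vertex set are incomparable. Uniqueness is therefore not a consequence of the order alone; it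
  needs an induction along prefixes. The codes are a proof device: a small index outweighs all
  larger ones together, so the lex-shorter set has the larger code, and appending a vertex to two
  paths shifts both codes equally. The program cannot compute with them, since words are short and
  reals cannot be made from words. Clause (2) rescues Dijkstra's algorithm when weights may be 0:
  the pair (weight, number of edges) grows strictly along every path and is a sound queue key.
  Clause (3) never decides between different vertices, only between offers to the same vertex. Such
  offers tie in the number of edges, which is why the tree paths to be compared have equal depth.
  The time bound is amortised: each unsettled vertex holds in advance the cost of settling it and of
  relaxing all its arcs.\<close>

definition set_code :: "nat set \<Rightarrow> real" where
  "set_code A = (\<Sum>v\<in>A. (1/2) ^ v)"

lemma set_code_insert: "finite A \<Longrightarrow> v \<notin> A \<Longrightarrow> set_code (insert v A) = (1/2) ^ v + set_code A"
  by (simp add: set_code_def)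

text \<open>A geometric series: the powers of 1/2 beyond \<open>(1/2) ^ a\<close> reach the sum
  \<open>(1/2) ^ a\<close> only in the limit, so a finite set of larger indices stays strictly below
  it.\<close>

lemma set_code_tail: "finite A \<Longrightarrow> (\<And>v. v \<in> A \<Longrightarrow> a < v) \<Longrightarrow> set_code A < (1/2) ^ a"
proof -
  assume A: "finite A" "\<And>v. v \<in> A \<Longrightarrow> a < v"
  have tail: "(\<Sum>v\<in>{a<..a + k}. (1/2::real) ^ v) = (1/2) ^ a - (1/2) ^ (a + k)" for k
  proof (induction k)
    case (Suc k)
    have "{a<..a + Suc k} = insert (a + Suc k) {a<..a + k}" by auto
    then show ?case using Suc by simp
  qed simp
  have sub: "A \<subseteq> {a<..a + Max A}"
    using A by (auto simp: less_imp_le_nat intro!: trans_le_add2 Max_ge)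
  have "set_code A \<le> (\<Sum>v\<in>{a<..a + Max A}. (1/2) ^ v)"
    unfolding set_code_def by (rule sum_mono2) (use sub in auto)
  also have "\<dots> < (1/2) ^ a" by (simp add: tail)
  finally show ?thesis .
qed

text \<open>Common vertices cancel, and the least vertex of \<open>A - B\<close> alone outweighs the
  whole of \<open>B - A\<close>.\<close>

lemma set_code_less:
  assumes "finite A" "finite B" "A - B \<noteq> {}" "Min (A - B) < Min (B - A)"
  shows "set_code B < set_code A"
proof -
  let ?a = "Min (A - B)"
  have split: "set_code X = set_code (X - Y) + set_code (X \<inter> Y)" if "finite X" for X Y
    using sum.Int_Diff[OF that, of "\<lambda>v. (1/2::real) ^ v" Y] by (simp add: set_code_def)
  have "set_code (B - A) < (1/2) ^ ?a"
  proof (rule set_code_tail)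
    show "?a < v" if "v \<in> B - A" for v
      using Min_le[of "B - A" v] that assms by (simp add: less_le_trans)
  qed (use assms in simp)
  also have "\<dots> = set_code {?a}" by (simp add: set_code_def)
  also have "\<dots> \<le> set_code (A - B)"
    unfolding set_code_def by (rule sum_mono2) (use assms Min_in[of "A - B"] in auto)
  finally show ?thesis
    using split[of A B] split[of B A] assms by (simp add: Int_commute)
qed

text \<open>Equal cardinalities make the two differences both empty or both nonempty, so comparing
  minima is a total order up to equality of sets.\<close>

lemma set_code_less_iff:
  assumes "finite A" "finite B" "card A = card B"
  shows "set_code B < set_code A \<longleftrightarrow> A - B \<noteq> {} \<and> B - A \<noteq> {} \<and> Min (A - B) < Min (B - A)"
    and "set_code A = set_code B \<longleftrightarrow> A = B"
proof -
  consider "A = B" | "A - B \<noteq> {}" "B - A \<noteq> {}"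
    using assms by (metis Diff_eq_empty_iff card_subset_eq)
  then have "(set_code B < set_code A \<longleftrightarrow> A - B \<noteq> {} \<and> B - A \<noteq> {} \<and> Min (A - B) < Min (B - A)) \<and>
    (set_code A = set_code B \<longleftrightarrow> A = B)"
  proof cases
    case 2
    then have "Min (A - B) \<in> A - B" "Min (B - A) \<in> B - A" using assms by (simp_all del: Diff_iff)
    then have "Min (A - B) \<noteq> Min (B - A)" by force
    then show ?thesis
      using set_code_less[of A B] set_code_less[of B A] assms 2 by fastforce
  qed simp
  then show "set_code B < set_code A \<longleftrightarrow> A - B \<noteq> {} \<and> B - A \<noteq> {} \<and> Min (A - B) < Min (B - A)"
    and "set_code A = set_code B \<longleftrightarrow> A = B" by auto
qed

text \<open>Asymmetry, transitivity and comparability become arithmetic on triples. The paths change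
  sides in the last component because small indices have large codes.\<close>

lemma lex_shorter_iff:
  assumes "distinct p" "distinct q" "p \<noteq> []" "q \<noteq> []"
  shows "lex_shorter w p q \<longleftrightarrow> path_weight w p < path_weight w q \<or>
    path_weight w p = path_weight w q \<and> (num_edges p < num_edges q \<or>
      num_edges p = num_edges q \<and> set_code (set q) < set_code (set p))"
proof -
  have "card (set p) = card (set q)" if "num_edges p = num_edges q"
    using that assms by (cases p; cases q) (auto simp: num_edges_def distinct_card[symmetric])
  then show ?thesis
    using set_code_less_iff[of "set p" "set q"] by (auto simp: lex_shorter_def)
qed

section \<open>Prefixes, extensions and weights of paths\<close>

lemma path_between_take:
  assumes "path_between V E u v p" "i < length p"
  shows "path_between V E u (p ! i) (take (Suc i) p)"
  using assms by (auto simp: path_between_def last_conv_nth hd_take dest: in_set_takeD)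

lemma path_between_snoc:
  assumes "path_between V E u x p" "{x, v} \<in> E" "v \<in> V" "v \<notin> set p"
  shows "path_between V E u v (p @ [v])"
proof -
  have "{(p @ [v]) ! i, (p @ [v]) ! Suc i} \<in> E" if "Suc i < length (p @ [v])" for i
  proof (cases "Suc i < length p")
    case False
    then have "i = length p - 1" using that assms by (auto simp: path_between_def)
    then have "(p @ [v]) ! i = x" "(p @ [v]) ! Suc i = v"
      using assms by (auto simp: path_between_def nth_append last_conv_nth)
    then show ?thesis using assms by simp
  qed (use assms in \<open>auto simp: path_between_def nth_append\<close>)
  then show ?thesis using assms by (auto simp: path_between_def)
qed

lemma path_between_snocD:
  assumes "path_between V E u v (p @ [v])" "p \<noteq> []"
  shows "path_between V E u (last p) p" "{last p, v} \<in> E" "v \<notin> set p"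
proof -
  show "path_between V E u (last p) p"
    using path_between_take[OF assms(1), of "length p - 1"] assms(2)
    by (auto simp: last_conv_nth nth_append)
  show "{last p, v} \<in> E"
  proof -
    have "{(p @ [v]) ! (length p - 1), (p @ [v]) ! Suc (length p - 1)} \<in> E"
      using assms(1) unfolding path_between_def by (metis One_nat_def Suc_pred assms(2) length_append_singleton length_greater_0_conv lessI)
    then show ?thesis using assms(2) by (simp add: nth_append last_conv_nth)
  qed
  show "v \<notin> set p" using assms by (simp add: path_between_def)
qed

lemma num_edges_snoc: "p \<noteq> [] \<Longrightarrow> num_edges (p @ [v]) = Suc (num_edges p)"
  by (simp add: num_edges_def)

lemma num_edges_take: "i < length p \<Longrightarrow> num_edges (take (Suc i) p) = i"
  by (simp add: num_edges_def)

lemma path_weight_snoc: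
  assumes "p \<noteq> []"
  shows "path_weight w (p @ [v]) = path_weight w p + w {last p, v}"
proof -
  have "(\<Sum>i<num_edges p. w {(p @ [v]) ! i, (p @ [v]) ! Suc i}) = (\<Sum>i<num_edges p. w {p ! i, p ! Suc i})"
    by (rule sum.cong) (auto simp: num_edges_def nth_append)
  moreover have "(p @ [v]) ! num_edges p = last p" "(p @ [v]) ! Suc (num_edges p) = v"
    using assms by (simp_all add: num_edges_def nth_append last_conv_nth)
  ultimately show ?thesis
    using assms by (simp add: path_weight_def num_edges_snoc)
qed

lemma path_weight_single: "path_weight w [v] = 0"
  by (simp add: path_weight_def num_edges_def)

lemma path_weight_take_le:
  assumes "path_between V E u v p" "\<forall>e\<in>E. 0 \<le> w e" "i < length p"
  shows "path_weight w (take (Suc i) p) \<le> path_weight w p"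
proof -
  have "path_weight w (take (Suc i) p) = (\<Sum>j<i. w {p ! j, p ! Suc j})"
    using assms(3) by (auto simp: path_weight_def num_edges_take intro!: sum.cong)
  also have "\<dots> \<le> path_weight w p"
    unfolding path_weight_def using assms
    by (intro sum_mono2) (auto simp: num_edges_def path_between_def)
  finally show ?thesis .
qed

section \<open>Existence and uniqueness of lex-shortest paths from the source\<close>

locale sourced_graph =
  fixes n :: nat and E :: "nat set set" and w :: "nat set \<Rightarrow> real" and s :: nat
  assumes graph: "weighted_graph n E w" and source: "s \<in> {1..n}"
begin

definition V :: "nat set" where "V = {1..n}"

abbreviation R :: "nat set" where "R \<equiv> reachable V E s"
abbreviation shortest :: "nat \<Rightarrow> nat list \<Rightarrow> bool" where "shortest v p \<equiv> lex_shortest V E w s v p"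
abbreviation path :: "nat \<Rightarrow> nat list \<Rightarrow> bool" where "path v p \<equiv> path_between V E s v p"

lemma finite_V [simp]: "finite V" and card_V [simp]: "card V = n" and source_V: "s \<in> V"
  using source by (simp_all add: V_def)

lemma weight_nonneg: "\<forall>e\<in>E. 0 \<le> w e"
  using graph by (simp add: weighted_graph_def)

lemma edgeD: "{u, v} \<in> E \<Longrightarrow> u \<in> V \<and> v \<in> V \<and> u \<noteq> v"
  using graph by (force simp: weighted_graph_def V_def doubleton_eq_iff)

lemma path_lex_iff:
  "path u p \<Longrightarrow> path v q \<Longrightarrow> lex_shorter w p q \<longleftrightarrow> path_weight w p < path_weight w q \<or>
    path_weight w p = path_weight w q \<and> (num_edges p < num_edges q \<or>
      num_edges p = num_edges q \<and> set_code (set q) < set_code (set p))"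
  by (rule lex_shorter_iff) (auto simp: path_between_def)

lemma shortest_path: "shortest v p \<Longrightarrow> path v p"
  by (simp add: lex_shortest_def)

lemma finite_paths: "finite {p. path v p}"
proof (rule finite_subset)
  show "finite {p. set p \<subseteq> V \<and> length p \<le> card V}" by (rule finite_lists_length_le) simp
  show "{p. path v p} \<subseteq> {p. set p \<subseteq> V \<and> length p \<le> card V}"
    using card_mono[OF finite_V] by (force simp: path_between_def distinct_card[symmetric] simp del: card_V)
qed

text \<open>Paths have distinct vertices, so there are only finitely many, and a transitive
  asymmetric relation has a minimal element on a finite nonempty set.\<close>

lemma shortest_exists:
  assumes "v \<in> R"
  obtains p where "shortest v p"
proof -
  have "\<exists>p\<in>{p. path v p}. \<forall>q\<in>{p. path v p}. q \<noteq> p \<longrightarrow> \<not> lex_shorter w q p"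
  proof (rule Finite_Set.bex_min_element)
    show "{p. path v p} \<noteq> {}" using assms by (auto simp: reachable_def)
    show "asymp_on {p. path v p} (lex_shorter w)"
      by (rule asymp_onI) (auto simp: path_lex_iff)
    show "transp_on {p. path v p} (lex_shorter w)"
      by (rule transp_onI) (auto simp: path_lex_iff)
  qed (rule finite_paths)
  then obtain p where p: "path v p" "\<And>q. path v q \<Longrightarrow> q \<noteq> p \<Longrightarrow> \<not> lex_shorter w q p" by auto
  moreover have "\<not> lex_shorter w p p" by (simp add: lex_shorter_def)
  ultimately show ?thesis using that by (auto simp: lex_shortest_def)
qed

lemma shortest_le:
  assumes "shortest v p" "path v q"
  shows "path_weight w p < path_weight w q \<or>
    path_weight w p = path_weight w q \<and> (num_edges p < num_edges q \<or>
      num_edges p = num_edges q \<and> set_code (set q) \<le> set_code (set p))"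
proof -
  have "\<not> lex_shorter w q p" using assms by (auto simp: lex_shortest_def)
  then show ?thesis using path_lex_iff[OF assms(2) shortest_path[OF assms(1)]] by fastforce
qed

text \<open>Each component grows by the same amount on both sides: the weight of the last edge, one
  edge, and \<open>(1/2) ^ v\<close>. The last needs \<open>v\<close> to be new on both
  paths.\<close>

lemma lex_shorter_snoc_iff:
  assumes "path x p" "path x q" "v \<notin> set p" "v \<notin> set q"
  shows "lex_shorter w (p @ [v]) (q @ [v]) \<longleftrightarrow> lex_shorter w p q"
proof -
  have "p \<noteq> []" "q \<noteq> []" "last p = x" "last q = x" using assms by (auto simp: path_between_def)
  moreover have "distinct p" "distinct q" using assms by (auto simp: path_between_def)
  ultimately show ?thesis using assms
    by (simp add: lex_shorter_iff path_weight_snoc num_edges_snoc set_code_insert)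
qed

text \<open>Exchange argument: a lex-shorter path \<open>q\<close> to the penultimate vertex could
  be extended by \<open>v\<close>, or cut at \<open>v\<close> if it already visits
  \<open>v\<close>.\<close>

lemma shortest_butlast:
  assumes sh: "shortest v (p @ [v])" and ne: "p \<noteq> []"
  shows "shortest (last p) p"
proof -
  let ?x = "last p"
  have pv: "path v (p @ [v])" using sh by (rule shortest_path)
  note p = path_between_snocD[OF pv ne]
  have False if q: "path ?x q" "lex_shorter w q p" for q
  proof (cases "v \<in> set q")
    case False
    then have "path v (q @ [v])"
      by (intro path_between_snoc[OF q(1) p(2)]) (use pv in \<open>auto simp: path_between_def\<close>)
    moreover have "lex_shorter w (q @ [v]) (p @ [v])"
      using lex_shorter_snoc_iff[OF q(1) p(1) False p(3)] q by simp
    ultimately show ?thesis using sh by (auto simp: lex_shortest_def)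
  next
    \<comment> \<open>The prefix of \<open>q\<close> ending in \<open>v\<close> weighs no more than
      \<open>q\<close> and has fewer edges, while \<open>p @ [v]\<close> has one edge more than
      \<open>p\<close>. So the prefix wins by weight or, at equal weight, by edges, even if some
      edges have weight 0.\<close>
    case True
    then obtain i where i: "i < length q" "q ! i = v" by (auto simp: in_set_conv_nth)
    have r: "path v (take (Suc i) q)" using path_between_take[OF q(1) i(1)] i by simp
    have "v \<noteq> ?x" using p ne by auto
    then have "i \<noteq> length q - 1" using i q by (auto simp: path_between_def last_conv_nth)
    then have "i < num_edges q" using i by (simp add: num_edges_def)
    moreover have "path_weight w (take (Suc i) q) \<le> path_weight w q"
      by (rule path_weight_take_le[OF q(1) weight_nonneg i(1)])
    moreover have "path_weight w p \<le> path_weight w (p @ [v])"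
      using p weight_nonneg by (simp add: path_weight_snoc[OF ne])
    ultimately show ?thesis
      using q(2) shortest_le[OF sh r] num_edges_take[OF i(1)]
        path_lex_iff[OF q(1) p(1)] num_edges_snoc[OF ne, of v] by linarith
  qed
  then show ?thesis using p(1) by (auto simp: lex_shortest_def)
qed

lemma shortest_take: "shortest v p \<Longrightarrow> i < length p \<Longrightarrow> shortest (p ! i) (take (Suc i) p)"
proof (induction p arbitrary: v rule: rev_induct)
  case (snoc a p)
  have a: "a = v" using shortest_path[OF snoc.prems(1)] by (simp add: path_between_def)
  show ?case
  proof (cases "i = length p")
    case False
    then have "p \<noteq> []" "i < length p" using snoc.prems by auto
    then show ?thesis
      using snoc.IH[OF shortest_butlast] snoc.prems a by (simp add: nth_append)
  qed (use snoc.prems a in simp)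
qed simp

lemma shortest_same:
  assumes "shortest v p" "shortest v q"
  shows "path_weight w p = path_weight w q" "num_edges p = num_edges q" "set p = set q" "length p = length q"
proof -
  note pq = shortest_path[OF assms(1)] shortest_path[OF assms(2)]
  show eq: "path_weight w p = path_weight w q" "num_edges p = num_edges q"
    using shortest_le[OF assms(1) pq(2)] shortest_le[OF assms(2) pq(1)] by auto
  have "set_code (set p) = set_code (set q)"
    using shortest_le[OF assms(1) pq(2)] shortest_le[OF assms(2) pq(1)] by auto
  moreover have "length p > 0" "length q > 0" using pq by (auto simp: path_between_def)
  then show "length p = length q" using eq unfolding num_edges_def by linarith
  moreover have "distinct p" "distinct q" using pq by (auto simp: path_between_def)
  ultimately show "set p = set q"
    using set_code_less_iff(2)[of "set p" "set q"] by (simp add: distinct_card)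
qed

text \<open>Two lex-shortest paths have the same vertices, so \<open>last p\<close> lies on
  \<open>q'\<close>. The prefix of \<open>q'\<close> ending there is lex-shortest and hence as long
  as \<open>p\<close>, so it is all of \<open>q'\<close>. The penultimate vertices thus agree and
  the induction applies.\<close>

lemma shortest_unique: "shortest v p \<Longrightarrow> shortest v q \<Longrightarrow> p = q"
proof (induction p arbitrary: v q rule: rev_induct)
  case Nil
  then show ?case using shortest_same(4)[OF Nil] by simp
next
  case (snoc a p)
  note same = shortest_same[OF snoc.prems]
  have paths: "path v (p @ [a])" "path v q" using snoc.prems by (auto intro: shortest_path)
  then have a: "a = v" by (simp add: path_between_def)
  obtain q' where q': "q = q' @ [v]"
    using paths by (cases q rule: rev_cases) (auto simp: path_between_def)
  have len: "length p = length q'" using same q' by simp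
  show ?case
  proof (cases "p = []")
    case False
    then have ne: "p \<noteq> []" "q' \<noteq> []" using len by auto
    have p: "shortest (last p) p" using shortest_butlast snoc.prems a ne by blast
    have q: "shortest (last q') q'" using shortest_butlast snoc.prems q' ne by blast
    have "set p = set q'"
    proof -
      have "distinct (p @ [v])" "distinct (q' @ [v])"
        using paths a q' by (auto simp: path_between_def)
      then show ?thesis using same(3) a q' by auto
    qed
    then have "last p \<in> set q'" using ne by (metis last_in_set)
    then obtain i where i: "i < length q'" "q' ! i = last p" by (metis in_set_conv_nth)
    have "shortest (last p) (take (Suc i) q')" using shortest_take[OF q i(1)] i by simp
    then have "length p = Suc i" using shortest_same(4)[OF p] i by simp
    then have "last p = last q'" using i len ne by (simp add: last_conv_nth)
    then show ?thesis using snoc.IH[OF p] q a q' by simp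
  qed (use len q' a in simp)
qed

section \<open>The lex-shortest path, depth and predecessor of a vertex\<close>

definition sp :: "nat \<Rightarrow> nat list" where
  "sp v = (SOME p. shortest v p)"

definition depth :: "nat \<Rightarrow> nat" where
  "depth v = num_edges (sp v)"

lemma sp_shortest: "v \<in> R \<Longrightarrow> shortest v (sp v)"
  unfolding sp_def by (metis shortest_exists someI)

lemma sp_path: "v \<in> R \<Longrightarrow> path v (sp v)"
  by (simp add: sp_shortest shortest_path)

lemma sp_eqI: "shortest v p \<Longrightarrow> sp v = p"
  using shortest_unique sp_def someI by metis

lemma shortest_reachable: "shortest v p \<Longrightarrow> v \<in> R"
  by (auto simp: lex_shortest_def reachable_def)

lemma sp_nonempty: "v \<in> R \<Longrightarrow> sp v \<noteq> []"
  and sp_last: "v \<in> R \<Longrightarrow> last (sp v) = v"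
  and sp_hd: "v \<in> R \<Longrightarrow> hd (sp v) = s"
  and sp_distinct: "v \<in> R \<Longrightarrow> distinct (sp v)"
  using sp_path by (auto simp: path_between_def)

lemma length_sp: "v \<in> R \<Longrightarrow> length (sp v) = Suc (depth v)"
  using sp_nonempty by (auto simp: depth_def num_edges_def)

lemma sp_nth_depth: "v \<in> R \<Longrightarrow> sp v ! depth v = v"
  using sp_last sp_nonempty length_sp by (metis diff_Suc_1 last_conv_nth)

lemma sp_nth_0: "v \<in> R \<Longrightarrow> sp v ! 0 = s"
  using sp_hd sp_nonempty by (metis hd_conv_nth)

lemma reachable_subset: "R \<subseteq> V"
  by (auto simp: reachable_def path_between_def)

text \<open>The ancestor of \<open>v\<close> at depth \<open>i\<close> is simply
  \<open>sp v ! i\<close>; all later reasoning on ancestors is phrased with positions, without a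
  separate ancestor relation.\<close>

lemma sp_prefix:
  assumes "v \<in> R" "i \<le> depth v"
  shows "sp v ! i \<in> R" "sp (sp v ! i) = take (Suc i) (sp v)" "depth (sp v ! i) = i"
proof -
  have i: "i < length (sp v)" using assms by (simp add: length_sp)
  have sh: "shortest (sp v ! i) (take (Suc i) (sp v))"
    by (rule shortest_take[OF sp_shortest[OF assms(1)] i])
  show "sp v ! i \<in> R" by (rule shortest_reachable[OF sh])
  show eq: "sp (sp v ! i) = take (Suc i) (sp v)" by (rule sp_eqI[OF sh])
  show "depth (sp v ! i) = i" using i by (simp add: depth_def eq num_edges_take)
qed

lemma sp_source: "s \<in> R" "sp s = [s]" "depth s = 0"
proof -
  have path: "path s [s]" using source_V by (simp add: path_between_def)
  then show "s \<in> R" by (auto simp: reachable_def)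
  then have "sp s ! 0 = sp s ! depth s" using sp_nth_0 sp_nth_depth by simp
  then show "depth s = 0"
    using sp_distinct[OF \<open>s \<in> R\<close>] length_sp[OF \<open>s \<in> R\<close>] by (metis nth_eq_iff_index_eq lessI zero_less_Suc)
  then show "sp s = [s]"
    using length_sp[OF \<open>s \<in> R\<close>] sp_nth_0[OF \<open>s \<in> R\<close>]
    by (metis One_nat_def length_0_conv length_Suc_conv nth_Cons_0)
qed

lemma depth_pos: "v \<in> R \<Longrightarrow> v \<noteq> s \<Longrightarrow> 0 < depth v"
  using sp_nth_0 sp_nth_depth by (metis gr0I)

text \<open>Truncated subtraction gives \<open>pred s = s\<close>.\<close>

definition pred :: "nat \<Rightarrow> nat" where
  "pred v = sp v ! (depth v - 1)"

lemma sp_pred: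
  assumes "v \<in> R" "v \<noteq> s"
  shows "pred v \<in> R" "sp v = sp (pred v) @ [v]" "depth v = Suc (depth (pred v))" "{pred v, v} \<in> E"
    "v \<notin> set (sp (pred v))"
proof -
  have pos: "0 < depth v" using assms by (rule depth_pos)
  show R: "pred v \<in> R" using sp_prefix assms by (simp add: pred_def)
  show d: "depth v = Suc (depth (pred v))" using sp_prefix(3)[OF assms(1), of "depth v - 1"] pos by (simp add: pred_def)
  have "sp (pred v) = take (depth v) (sp v)"
    using sp_prefix(2)[OF assms(1), of "depth v - 1"] pos by (simp add: pred_def)
  then show sp: "sp v = sp (pred v) @ [v]"
    using sp_nth_depth[OF assms(1)] length_sp[OF assms(1)]
    by (metis lessI order_refl take_Suc_conv_app_nth take_all)
  have "path v (sp (pred v) @ [v])" using sp_path[OF assms(1)] sp by simp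
  note path_between_snocD[OF this sp_nonempty[OF R]]
  then show "{pred v, v} \<in> E" "v \<notin> set (sp (pred v))" using sp_last[OF R] by simp_all
qed

lemma depth_less: "v \<in> R \<Longrightarrow> depth v < n"
proof -
  assume v: "v \<in> R"
  have "card (set (sp v)) \<le> card V"
    by (rule card_mono) (use sp_path[OF v] in \<open>auto simp: path_between_def\<close>)
  then show ?thesis using distinct_card[OF sp_distinct[OF v]] length_sp[OF v] by simp
qed

end

section \<open>The tree of lex-shortest paths and the search for it\<close>

text \<open>A walk is kept simple as it grows: when the next vertex has been visited before, the
  path is cut back to it.\<close>

lemma distinct_path_of_rtrancl:
  assumes "(u, v) \<in> {(x, y). {x, y} \<in> T}\<^sup>*" "u \<in> A" "\<forall>e\<in>T. e \<subseteq> A"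
  shows "\<exists>p. path_between A T u v p"
  using assms(1)
proof (induction rule: rtrancl_induct)
  case base
  have "path_between A T u u [u]" using assms(2) by (simp add: path_between_def)
  then show ?case ..
next
  case (step x y)
  then obtain p where p: "path_between A T u x p" by blast
  show ?case
  proof (cases "y \<in> set p")
    case True
    then obtain i where "i < length p" "p ! i = y" by (auto simp: in_set_conv_nth)
    then show ?thesis using path_between_take[OF p] by blast
  next
    case False
    then show ?thesis using path_between_snoc[OF p] step(2) assms(3) by blast
  qed
qed

context sourced_graph
begin

definition sp_tree :: "nat set set" where
  "sp_tree = {{pred v, v} |v. v \<in> R - {s}}"

text \<open>Depth orients a tree edge: the deeper end has the other end as its predecessor.\<close>

lemma sp_treeD:
  assumes "{x, y} \<in> sp_tree"
  shows "x \<in> R \<and> y \<in> R \<and> x \<noteq> y \<and> (y \<noteq> s \<and> x = pred y \<and> depth y = Suc (depth x) \<or>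
    x \<noteq> s \<and> y = pred x \<and> depth x = Suc (depth y))"
proof -
  obtain v where "v \<in> R" "v \<noteq> s" "{x, y} = {pred v, v}"
    using assms by (auto simp: sp_tree_def)
  then show ?thesis using sp_pred[of v] by (auto simp: doubleton_eq_iff)
qed

lemma sp_tree_subset: "sp_tree \<subseteq> E"
  using sp_pred(4) by (auto simp: sp_tree_def)

lemma sp_tree_edges: "e \<in> sp_tree \<Longrightarrow> \<exists>u\<in>R. \<exists>v\<in>R. u \<noteq> v \<and> e = {u, v}"
  unfolding sp_tree_def using sp_pred(1,4) edgeD by blast

lemma sp_path_tree:
  assumes "v \<in> R"
  shows "path_between R sp_tree s v (sp v)"
proof -
  have "{sp v ! i, sp v ! Suc i} \<in> sp_tree" if "Suc i < length (sp v)" for i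
  proof -
    let ?x = "sp v ! Suc i"
    have i: "Suc i \<le> depth v" using that assms by (simp add: length_sp)
    note x = sp_prefix[OF assms i]
    have "?x \<noteq> s" using x(3) sp_source by auto
    moreover have "pred ?x = sp v ! i" by (simp add: pred_def x)
    moreover have "{pred ?x, ?x} \<in> sp_tree" if "?x \<noteq> s" using x(1) that unfolding sp_tree_def by blast
    ultimately show ?thesis by simp
  qed
  moreover have "set (sp v) \<subseteq> R"
    using sp_prefix(1)[OF assms] length_sp[OF assms] by (auto simp: in_set_conv_nth less_Suc_eq_le)
  ultimately show ?thesis
    using sp_nonempty sp_last sp_hd sp_distinct assms by (simp add: path_between_def)
qed

text \<open>A tree path from the source can never go towards the source, since it would have to return
  to the vertex it has just left.\<close>

lemma tree_path_unique:
  assumes p: "path_between R sp_tree s v p"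
  shows "p = sp v"
proof -
  have "i < length p \<Longrightarrow> sp (p ! i) = take (Suc i) p" for i
  proof (induction i)
    case 0
    then show ?case using p sp_source by (auto simp: path_between_def take_Suc hd_conv_nth)
  next
    case (Suc i)
    then have edge: "{p ! i, p ! Suc i} \<in> sp_tree" using p by (simp add: path_between_def)
    have IH: "sp (p ! i) = take (Suc i) p" using Suc by simp
    show ?case
      using sp_treeD[OF edge]
    proof (elim conjE disjE)
      assume "p ! Suc i \<in> R" "p ! Suc i \<noteq> s" "p ! i = pred (p ! Suc i)"
      then show ?thesis using sp_pred(2)[of "p ! Suc i"] IH Suc.prems by (simp add: take_Suc_conv_app_nth)
    next
      assume *: "p ! i \<in> R" "p ! i \<noteq> s" "p ! Suc i = pred (p ! i)"
      have "depth (p ! i) = i" using IH Suc.prems by (simp add: depth_def num_edges_take)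
      then have "p ! Suc i = p ! (i - 1)" using * IH by (simp add: pred_def)
      then show ?thesis using p Suc.prems by (auto simp: path_between_def nth_eq_iff_index_eq)
    qed
  qed
  from this[of "length p - 1"] show ?thesis
    using p by (auto simp: path_between_def last_conv_nth)
qed

text \<open>A vertex of maximal depth on a cycle would have two different predecessors.\<close>

lemma sp_tree_acyclic: "\<not> is_cycle sp_tree p"
proof
  assume cyc: "is_cycle sp_tree p"
  let ?l = "length p"
  have l: "3 \<le> ?l" and dist: "distinct p" using cyc by (auto simp: is_cycle_def)
  define nxt where "nxt i = (if Suc i = ?l then 0 else Suc i)" for i
  define prv where "prv i = (if i = 0 then ?l - 1 else i - 1)" for i
  have edge: "{p ! i, p ! nxt i} \<in> sp_tree" if "i < ?l" for i
  proof (cases "Suc i = ?l")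
    case True
    then have "p ! i = last p" "p ! 0 = hd p"
      using l True by (metis diff_Suc_1 last_conv_nth list.size(3) not_numeral_le_zero,
        metis hd_conv_nth list.size(3) not_numeral_le_zero)
    then show ?thesis using cyc True by (simp add: is_cycle_def nxt_def)
  qed (use cyc that in \<open>simp add: is_cycle_def nxt_def\<close>)
  let ?D = "(\<lambda>i. depth (p ! i)) ` {..<?l}"
  have "Max ?D \<in> ?D" using l by (intro Max_in) (auto simp: lessThan_empty_iff)
  then obtain i where i: "i < ?l" "depth (p ! i) = Max ?D" by auto
  have max: "depth (p ! j) \<le> depth (p ! i)" if "j < ?l" for j
    unfolding i(2) using that by (intro Max_ge) auto
  \<comment> \<open>Length at least 3 makes the two neighbours different positions of the
    cycle.\<close>
  have bounds: "nxt i < ?l" "prv i < ?l" "nxt (prv i) = i" "nxt i \<noteq> prv i"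
    using i l by (auto simp: nxt_def prv_def)
  have "p ! nxt i = pred (p ! i)"
    using sp_treeD[OF edge[OF i(1)]] max[OF bounds(1)] by auto
  moreover have "p ! prv i = pred (p ! i)"
    using sp_treeD[OF edge[OF bounds(2)]] max[OF bounds(2)] bounds(3) by auto
  ultimately show False using dist bounds by (metis nth_eq_iff_index_eq)
qed

lemma sp_tree_connected:
  assumes "u \<in> R" "v \<in> R"
  shows "\<exists>p. path_between R sp_tree u v p"
proof (rule distinct_path_of_rtrancl)
  let ?r = "{(x, y). {x, y} \<in> sp_tree}"
  have "(s, x) \<in> ?r\<^sup>*" if "x \<in> R" for x
    using that
  proof (induction "depth x" arbitrary: x)
    case 0
    then show ?case using depth_pos by fastforce
  next
    case (Suc d)
    then have ne: "x \<noteq> s" using sp_source by auto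
    then have "(s, pred x) \<in> ?r\<^sup>*" using Suc sp_pred by simp
    moreover have "(pred x, x) \<in> ?r" using Suc.prems ne by (auto simp: sp_tree_def)
    ultimately show ?case by (rule rtrancl_into_rtrancl)
  qed
  moreover have "sym (?r\<^sup>*)" by (intro sym_rtrancl symI) (simp add: insert_commute)
  ultimately show "(u, v) \<in> ?r\<^sup>*" using assms by (meson rtrancl_trans symD)
  show "\<forall>e\<in>sp_tree. e \<subseteq> R" using sp_tree_edges by fastforce
qed (rule assms)

theorem sp_tree_lex_shortest_path_tree: "lex_shortest_path_tree V E w s sp_tree"
proof -
  have "is_tree R sp_tree"
    using sp_source(1) sp_tree_edges sp_tree_connected sp_tree_acyclic by (auto simp: is_tree_def)
  then show ?thesis
    using sp_tree_subset tree_path_unique sp_shortest by (auto simp: lex_shortest_path_tree_def)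
qed

lemma parent_array_sp_tree:
  assumes "\<And>v. v \<in> V \<Longrightarrow> par v = (if v \<in> R - {s} then pred v else 0)"
  shows "parent_array n R sp_tree s par"
proof -
  have "\<exists>p. path_between R sp_tree s v p \<and> pred v = p ! (length p - 2)" if "v \<in> R" for v
    using sp_path_tree[OF that] by (auto simp: pred_def length_sp that)
  then show ?thesis using assms unfolding parent_array_def V_def by auto
qed

text \<open>State of the search: \<open>F\<close> is the set of settled vertices and \<open>A\<close> the set of edges
  \<open>(x, v)\<close>, directed away from a settled vertex \<open>x\<close>, along which \<open>v\<close> has been offered the path
  to \<open>x\<close> extended by \<open>v\<close>. The best offer received by an unsettled vertex is recorded in
  \<open>d\<close>, \<open>h\<close> and \<open>p\<close>, and \<open>act\<close> tells whether there is one.\<close>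

definition settled :: "nat \<Rightarrow> (nat \<Rightarrow> real) \<Rightarrow> (nat \<Rightarrow> nat) \<Rightarrow> (nat \<Rightarrow> nat) \<Rightarrow> bool" where
  "settled v d h p \<longleftrightarrow> v \<in> R \<and> d v = path_weight w (sp v) \<and> h v = depth v \<and>
     p v = (if v = s then s else pred v)"

definition offer :: "nat \<Rightarrow> nat \<Rightarrow> nat list" where
  "offer x v = sp x @ [v]"

text \<open>An active vertex stores its own number, so that the winner of the queue names itself.
  The source is exempt from the last clause: before it is settled it is already its own
  parent.\<close>

definition offered ::
    "(nat \<times> nat) set \<Rightarrow> nat \<Rightarrow> (nat \<Rightarrow> real) \<Rightarrow> (nat \<Rightarrow> nat) \<Rightarrow> (nat \<Rightarrow> nat) \<Rightarrow> (nat \<Rightarrow> nat) \<Rightarrow> bool" where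
  "offered A v d h p act \<longleftrightarrow>
     (if \<exists>x. (x, v) \<in> A
      then act v = v \<and> (p v, v) \<in> A \<and> d v = path_weight w (offer (p v) v) \<and>
        h v = num_edges (offer (p v) v) \<and>
        (\<forall>x. (x, v) \<in> A \<longrightarrow> \<not> lex_shorter w (offer x v) (offer (p v) v))
      else act v = 0 \<and> (v \<noteq> s \<longrightarrow> p v = 0))"

text \<open>Closure of \<open>F\<close> under ancestors has two uses: an unsettled vertex cannot lie
  on a path that is extended to it, and all ancestors of a settled vertex have finished jump
  tables.\<close>

definition search ::
    "nat set \<Rightarrow> (nat \<times> nat) set \<Rightarrow> (nat \<Rightarrow> real) \<Rightarrow> (nat \<Rightarrow> nat) \<Rightarrow> (nat \<Rightarrow> nat) \<Rightarrow> (nat \<Rightarrow> nat) \<Rightarrow> bool" where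
  "search F A d h p act \<longleftrightarrow>
     F \<subseteq> R \<and> (\<forall>x\<in>F. set (sp x) \<subseteq> F) \<and> A \<subseteq> {(x, v). x \<in> F \<and> {x, v} \<in> E} \<and>
     (\<forall>v\<in>F. settled v d h p \<and> act v = 0) \<and> (\<forall>v\<in>V - F. offered A v d h p act)"

section \<open>Completeness of the search and correctness of settling\<close>

definition edges_from :: "nat set \<Rightarrow> (nat \<times> nat) set" where
  "edges_from F = {(x, v). x \<in> F \<and> {x, v} \<in> E}"

lemma search_offered: "search F A d h p act \<Longrightarrow> v \<in> V - F \<Longrightarrow> offered A v d h p act"
  by (simp add: search_def)

lemma offeredD:
  assumes "offered A v d h p act" "(x, v) \<in> A"
  shows "act v = v" "(p v, v) \<in> A" "d v = path_weight w (offer (p v) v)"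
    "h v = num_edges (offer (p v) v)" "\<not> lex_shorter w (offer x v) (offer (p v) v)"
  using assms by (auto simp: offered_def split: if_splits)

lemma offered_active: "offered A v d h p act \<Longrightarrow> act v \<noteq> 0 \<Longrightarrow> \<exists>x. (x, v) \<in> A"
  by (auto simp: offered_def split: if_splits)

lemma offer_path:
  assumes "search F A d h p act" "x \<in> F" "v \<notin> F" "{x, v} \<in> E"
  shows "path v (offer x v)" "v \<notin> set (sp x)"
proof -
  show notin: "v \<notin> set (sp x)" using assms by (auto simp: search_def)
  have "x \<in> R" using assms by (auto simp: search_def)
  then show "path v (offer x v)"
    unfolding offer_def using path_between_snoc[OF sp_path] assms(4) edgeD notin by blast
qed

lemma offer_weight: "x \<in> R \<Longrightarrow> path_weight w (offer x v) = path_weight w (sp x) + w {x, v}"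
  and offer_num_edges: "x \<in> R \<Longrightarrow> num_edges (offer x v) = Suc (depth x)"
  by (simp_all add: offer_def path_weight_snoc sp_nonempty sp_last num_edges_snoc depth_def)

text \<open>The shortest path to an unsettled vertex leaves the settled set along some edge \<open>(x, y)\<close>.\<close>

lemma frontier_edge:
  assumes "search F A d h p act" "s \<in> F" "v \<in> R" "v \<notin> F"
  obtains x y where "x \<in> F" "y \<in> R" "y \<notin> F" "{x, y} \<in> E" "sp y = offer x y" "y = v \<or> depth y < depth v"
    "path_weight w (sp y) \<le> path_weight w (sp v)"
proof -
  \<comment> \<open>The first position outside \<open>F\<close>: it exists because \<open>v\<close>
    is outside, and it is not 0 because the source is settled.\<close>
  define i where "i = (LEAST i. sp v ! i \<notin> F)"
  have v: "sp v ! depth v \<notin> F" using assms by (simp add: sp_nth_depth)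
  have out: "sp v ! i \<notin> F" unfolding i_def using v by (rule LeastI)
  have le: "i \<le> depth v" unfolding i_def using v by (rule Least_le)
  have "i \<noteq> 0" using out assms by (metis sp_nth_0)
  then have "i - 1 < (LEAST i. sp v ! i \<notin> F)" by (simp add: i_def)
  then have inF: "sp v ! (i - 1) \<in> F" using not_less_Least by blast
  let ?y = "sp v ! i"
  note y = sp_prefix[OF assms(3) le]
  have ne: "?y \<noteq> s" using out assms by metis
  have "pred ?y = sp v ! (i - 1)" using \<open>i \<noteq> 0\<close> by (simp add: pred_def y)
  then have x: "pred ?y \<in> F" using inF by simp
  show ?thesis
  proof (rule that[OF x])
    show "?y = v \<or> depth ?y < depth v" using le y(3) sp_nth_depth[OF assms(3)] by (cases "i = depth v") auto
    show "path_weight w (sp ?y) \<le> path_weight w (sp v)"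
      unfolding y(2) by (rule path_weight_take_le[OF sp_path[OF assms(3)] weight_nonneg])
        (use le length_sp[OF assms(3)] in simp)
  qed (use y out ne sp_pred[of ?y] in \<open>auto simp: offer_def\<close>)
qed

text \<open>If a reachable vertex were missing, the outer end of a frontier edge would hold an offer
  and be active.\<close>

lemma search_complete:
  assumes "search F (edges_from F) d h p act" "s \<in> F" "\<forall>v\<in>V - F. act v = 0"
  shows "F = R"
proof (rule ccontr)
  assume "F \<noteq> R"
  then obtain v where "v \<in> R" "v \<notin> F" using assms by (auto simp: search_def)
  from frontier_edge[OF assms(1,2) this] obtain x y where xy: "x \<in> F" "y \<in> R" "y \<notin> F" "{x, y} \<in> E" .
  then have "y \<in> V - F" using reachable_subset by auto
  moreover have "(x, y) \<in> edges_from F" using xy by (simp add: edges_from_def)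
  ultimately have "act y = y" using offeredD(1) search_offered[OF assms(1)] by blast
  moreover have "y \<noteq> 0" using xy reachable_subset by (auto simp: V_def)
  ultimately show False using assms(3) \<open>y \<in> V - F\<close> by auto
qed

text \<open>Let \<open>y\<close> be the first unsettled vertex on the lex-shortest path to
  \<open>v\<close>. Unless \<open>y = v\<close>, its key is strictly below that of \<open>v\<close>,
  against minimality. So the lex-shortest path to \<open>v\<close> is itself among the offers, and
  the recorded offer, beaten by none, equals it. Only the key is minimised over vertices; clause (3)
  enters through the choice among offers to \<open>v\<close>.\<close>

lemma search_settle:
  assumes inv: "search F (edges_from F) d h p act" and s: "s \<in> F"
    and v: "v \<in> V - F" "act v \<noteq> 0"
    and min: "\<And>y. y \<in> V - F \<Longrightarrow> act y \<noteq> 0 \<Longrightarrow> d v < d y \<or> d v = d y \<and> h v \<le> h y"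
  shows "settled v d h p" "p v \<in> F"
proof -
  let ?u = "p v"
  have F: "F \<subseteq> R" using inv by (simp add: search_def)
  have off: "offered (edges_from F) v d h p act" using search_offered[OF inv v(1)] .
  obtain z where "(z, v) \<in> edges_from F" using offered_active[OF off v(2)] ..
  note cand = offeredD(2-4)[OF off this] and best = offeredD(5)[OF off]
  then have cand: "?u \<in> F" "{?u, v} \<in> E" "d v = path_weight w (offer ?u v)" "h v = num_edges (offer ?u v)"
    by (auto simp: edges_from_def)
  have path: "path v (offer ?u v)" "v \<notin> set (sp ?u)" using offer_path[OF inv] cand v by auto
  then have vR: "v \<in> R" by (auto simp: reachable_def)
  show "?u \<in> F" by (rule cand)
  obtain x y where xy: "x \<in> F" "y \<in> R" "y \<notin> F" "{x, y} \<in> E" "sp y = offer x y"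
    "y = v \<or> depth y < depth v" "path_weight w (sp y) \<le> path_weight w (sp v)"
    using frontier_edge[OF inv s vR] v by blast
  have yV: "y \<in> V - F" using xy reachable_subset by auto
  have exy: "(x, y) \<in> edges_from F" using xy by (simp add: edges_from_def)
  have y0: "y \<noteq> 0" using yV by (auto simp: V_def)
  note offy = offeredD[OF search_offered[OF inv yV] exy]
  have py: "path y (offer (p y) y)" using offer_path[OF inv, of "p y" y] offy yV by (auto simp: edges_from_def)
  have "path y (offer x y)" using xy sp_path by metis
  \<comment> \<open>\<open>sp y\<close> is one of the offers to \<open>y\<close>, so the recorded
    key is at most the key of \<open>sp y\<close>.\<close>
  then have le_y: "d y < path_weight w (sp y) \<or> d y = path_weight w (sp y) \<and> h y \<le> depth y"
    using path_lex_iff[of y "offer x y" y "offer (p y) y"] py offy xy(5) unfolding depth_def by auto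
  have le_v: "path_weight w (sp v) < d v \<or> path_weight w (sp v) = d v \<and> depth v \<le> h v"
    using shortest_le[OF sp_shortest[OF vR] path(1)] cand by (auto simp: depth_def)
  \<comment> \<open>Otherwise \<open>y\<close> would have no larger weight and, by its smaller
    depth, fewer edges.\<close>
  have "y = v"
    using min[OF yV] offy(1) y0 xy(6,7) le_y le_v by linarith
  then have spv: "sp v = offer x v" using xy by simp
  have "\<not> lex_shorter w (sp v) (offer ?u v)" using best exy \<open>y = v\<close> spv by simp
  then have "\<not> lex_shorter w q (offer ?u v)" if "path v q" for q
    using shortest_le[OF sp_shortest[OF vR] that] path_lex_iff[OF that path(1)]
      path_lex_iff[OF sp_path[OF vR] path(1)] by fastforce
  then have "shortest v (offer ?u v)" using path(1) by (auto simp: lex_shortest_def)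
  then have "sp v = offer ?u v" by (rule sp_eqI)
  moreover have "v \<noteq> s" using s v by auto
  ultimately have "?u = pred v"
    using sp_pred[OF vR] sp_last cand(1) F by (metis offer_def append1_eq_conv subsetD)
  then show "settled v d h p"
    using cand \<open>sp v = offer ?u v\<close> vR \<open>v \<noteq> s\<close> by (simp add: settled_def depth_def)
qed

text \<open>The settled set grows while the edge set stays \<open>edges_from F\<close>: the offers
  made by \<open>v\<close> are still outstanding.\<close>

lemma search_insert:
  assumes "search F (edges_from F) d h p act" "settled v d h p" "v \<in> V - F" "v \<noteq> s \<Longrightarrow> p v \<in> F"
  shows "search (insert v F) (edges_from F) d h p (act(v := 0))"
proof -
  have "set (sp v) \<subseteq> insert v F"
  proof (cases "v = s")
    case False
    then have "pred v \<in> F" "v \<in> R" using assms by (auto simp: settled_def)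
    then have "set (sp (pred v)) \<subseteq> F" "set (sp v) = insert v (set (sp (pred v)))"
      using sp_pred(2)[of v] False assms(1) by (simp_all add: search_def)
    then show ?thesis by auto
  qed (simp add: sp_source)
  then have "\<forall>x\<in>insert v F. set (sp x) \<subseteq> insert v F" using assms(1) unfolding search_def by blast
  moreover have "offered A x d h p (act(v := 0)) = offered A x d h p act" if "x \<noteq> v" for A x
    using that by (simp add: offered_def)
  then have "\<forall>x\<in>V - insert v F. offered (edges_from F) x d h p (act(v := 0))"
    using search_offered[OF assms(1)] by auto
  moreover have "edges_from F \<subseteq> {(x, y). x \<in> insert v F \<and> {x, y} \<in> E}" by (auto simp: edges_from_def)
  moreover have "insert v F \<subseteq> R" "\<forall>x\<in>insert v F. settled x d h p \<and> (act(v := 0)) x = 0"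
    using assms(1,2) by (auto simp: search_def settled_def[of v])
  ultimately show ?thesis by (simp add: search_def)
qed

section \<open>Effect of a single offer on the search state\<close>

lemma search_offer_settled:
  assumes "search F A d h p act" "x \<in> F" "{x, v} \<in> E" "v \<in> F"
  shows "search F (insert (x, v) A) d h p act"
proof -
  have "offered (insert (x, v) A) y d h p act = offered A y d h p act" if "y \<in> V - F" for y
  proof -
    have "y \<noteq> v" using that assms by auto
    then show ?thesis by (simp add: offered_def)
  qed
  then show ?thesis using assms by (auto simp: search_def)
qed

lemma offered_other: "y \<noteq> v \<Longrightarrow> offered (insert (x, v) A) y (d(v := d')) (h(v := h')) (p(v := p')) (act(v := a')) = offered A y d h p act"
  by (auto simp: offered_def)

text \<open>No older offer beats the recorded one, and the new one beats the recorded one, so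
  transitivity suffices; if nothing is recorded, there are no older offers. A tie won by the new
  offer is included.\<close>

lemma search_offer_better:
  assumes inv: "search F A d h p act" and x: "x \<in> F" "{x, v} \<in> E" "v \<notin> F"
    and better: "act v \<noteq> 0 \<Longrightarrow> lex_shorter w (offer x v) (offer (p v) v)"
  shows "search F (insert (x, v) A) (d(v := d x + w {x, v})) (h(v := Suc (h x))) (p(v := x)) (act(v := v))"
proof -
  have vV: "v \<in> V - F" using edgeD x by blast
  have xR: "x \<in> R" "d x = path_weight w (sp x)" "h x = depth x"
    using inv x by (auto simp: search_def settled_def)
  have off: "offered A v d h p act" using inv vV by (auto simp: search_def)
  have v0: "v \<noteq> 0" using vV by (simp add: V_def)
  have sub: "A \<subseteq> {(x, v). x \<in> F \<and> {x, v} \<in> E}" using inv by (simp add: search_def)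
  have "\<not> lex_shorter w (offer y v) (offer x v)" if "(y, v) \<in> A" for y
  proof -
    have *: "act v \<noteq> 0" "\<not> lex_shorter w (offer y v) (offer (p v) v)" "(p v, v) \<in> A"
      using that off v0 by (auto simp: offered_def split: if_splits)
    then have "path v (offer y v)" "path v (offer (p v) v)" "path v (offer x v)"
      using offer_path(1)[OF inv] x sub that by blast+
    then show ?thesis using better[OF *(1)] *(2) by (auto simp: path_lex_iff)
  qed
  moreover have "\<not> lex_shorter w (offer x v) (offer x v)" by (simp add: lex_shorter_def)
  ultimately have "offered (insert (x, v) A) v (d(v := d x + w {x, v})) (h(v := Suc (h x))) (p(v := x)) (act(v := v))"
    using xR by (auto simp: offered_def offer_weight offer_num_edges)
  note offv = this
  have set_eq: "settled y (d(v := d')) (h(v := h')) (p(v := p')) = settled y d h p" if "y \<in> F" for y d' h' p'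
  proof -
    have "y \<noteq> v" using that x by auto
    then show ?thesis by (simp add: settled_def)
  qed
  have "offered (insert (x, v) A) y (d(v := d x + w {x, v})) (h(v := Suc (h x))) (p(v := x)) (act(v := v))"
    if "y \<in> V - F" "y \<noteq> v" for y
    using that inv by (simp add: offered_other search_def)
  then have "offered (insert (x, v) A) y (d(v := d x + w {x, v})) (h(v := Suc (h x))) (p(v := x)) (act(v := v))"
    if "y \<in> V - F" for y
    using that offv by (cases "y = v") simp_all
  moreover have "settled y (d(v := d')) (h(v := h')) (p(v := p'))" if "y \<in> F" for y d' h' p'
    using that set_eq inv by (auto simp: search_def)
  ultimately show ?thesis using inv x by (auto simp: search_def)
qed

lemma search_offer_worse:
  assumes inv: "search F A d h p act" and x: "x \<in> F" "{x, v} \<in> E" "v \<notin> F" "act v \<noteq> 0"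
    and worse: "\<not> lex_shorter w (offer x v) (offer (p v) v)"
  shows "search F (insert (x, v) A) d h p act"
proof -
  have vV: "v \<in> V - F" using edgeD x by blast
  have "offered A v d h p act" using inv vV by (auto simp: search_def)
  then have "offered (insert (x, v) A) v d h p act"
    using x(4) worse by (auto simp: offered_def split: if_splits)
  moreover have "offered (insert (x, v) A) y d h p act = offered A y d h p act" if "y \<noteq> v" for y
    using that by (simp add: offered_def)
  ultimately have "offered (insert (x, v) A) y d h p act" if "y \<in> V - F" for y
    using inv that by (metis search_def)
  then show ?thesis using inv x by (auto simp: search_def)
qed

lemma search_active:
  assumes "search F A d h p act" "v \<in> V - F" "act v \<noteq> 0"
  shows "act v = v" "p v \<in> F" "{p v, v} \<in> E" "d v = path_weight w (offer (p v) v)" "h v = num_edges (offer (p v) v)"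
proof -
  have off: "offered A v d h p act" by (rule search_offered[OF assms(1,2)])
  obtain x where "(x, v) \<in> A" using offered_active[OF off assms(3)] ..
  note offeredD[OF off this]
  then show "act v = v" "p v \<in> F" "{p v, v} \<in> E" "d v = path_weight w (offer (p v) v)" "h v = num_edges (offer (p v) v)"
    using assms(1) by (auto simp: search_def)
qed

text \<open>The end \<open>v\<close> belongs to both offers and cancels, so the tie-break concerns
  the tree paths of two settled vertices, for which jump tables exist.\<close>

lemma offer_lex_shorter_iff:
  assumes inv: "search F A d h p act" and x: "x \<in> F" "{x, v} \<in> E" "v \<notin> F" "act v \<noteq> 0"
  shows "lex_shorter w (offer x v) (offer (p v) v) \<longleftrightarrow>
    d x + w {x, v} < d v \<or> d x + w {x, v} = d v \<and> (Suc (h x) < h v \<or> Suc (h x) = h v \<and>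
      set (sp x) - set (sp (p v)) \<noteq> {} \<and> set (sp (p v)) - set (sp x) \<noteq> {} \<and>
      Min (set (sp x) - set (sp (p v))) < Min (set (sp (p v)) - set (sp x)))"
proof -
  have vV: "v \<in> V - F" using edgeD x by blast
  note act = search_active[OF inv vV x(4)]
  have notin: "v \<notin> set (sp x)" "v \<notin> set (sp (p v))"
    using offer_path(2)[OF inv] x act by auto
  have R: "x \<in> R" "p v \<in> R" using inv x act by (auto simp: search_def)
  have "set (offer x v) - set (offer (p v) v) = set (sp x) - set (sp (p v))"
    "set (offer (p v) v) - set (offer x v) = set (sp (p v)) - set (sp x)"
    using notin by (auto simp: offer_def)
  moreover have "path_weight w (offer x v) = d x + w {x, v}" "num_edges (offer x v) = Suc (h x)"
    using inv x R by (auto simp: search_def settled_def offer_weight offer_num_edges)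
  ultimately show ?thesis using act by (auto simp: lex_shorter_def)
qed

end

section \<open>Running programs\<close>

definition runs :: "nat \<Rightarrow> com \<Rightarrow> store \<Rightarrow> nat \<Rightarrow> (store \<Rightarrow> bool) \<Rightarrow> bool" where
  "runs b c \<sigma> T Q \<longleftrightarrow> (\<exists>t \<sigma>'. exec b c \<sigma> t \<sigma>' \<and> t \<le> T \<and> Q \<sigma>')"

lemma runs_weaken:
  assumes "runs b c \<sigma> T Q" "T \<le> T'" "\<And>\<sigma>'. Q \<sigma>' \<Longrightarrow> Q' \<sigma>'"
  shows "runs b c \<sigma> T' Q'"
  using assms unfolding runs_def by (meson order_trans)

lemma runs_Seq:
  assumes "runs b c \<sigma> T P" "\<And>\<sigma>'. P \<sigma>' \<Longrightarrow> runs b d \<sigma>' T' Q"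
  shows "runs b (Seq c d) \<sigma> (T + T') Q"
  using assms unfolding runs_def by (meson add_mono exec.Seq)

lemma runs_Cond:
  assumes "tval b g \<sigma> \<Longrightarrow> runs b c \<sigma> T Q" "\<not> tval b g \<sigma> \<Longrightarrow> runs b d \<sigma> T Q"
  shows "runs b (Cond g c d) \<sigma> (1 + tcost g + T) Q"
  using assms unfolding runs_def by (cases "tval b g \<sigma>") (meson add_left_mono exec.CondTrue exec.CondFalse)+

text \<open>\<open>k\<close> is a potential measured in steps, not a number of rounds: each round
  may have its own cost \<open>T\<close>, paid by the drop of the potential. This permits amortised
  bounds, such as charging each vertex for its own degree.\<close>

lemma runs_While:
  assumes "I k \<sigma>"
    and "\<And>k \<sigma>. I k \<sigma> \<Longrightarrow> tval b g \<sigma> \<Longrightarrow>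
      \<exists>T. runs b c \<sigma> T (\<lambda>\<sigma>'. \<exists>k'. I k' \<sigma>' \<and> k' + T + 1 + tcost g \<le> k)"
  shows "runs b (While g c) \<sigma> (k + 1 + tcost g) (\<lambda>\<sigma>'. (\<exists>k'. I k' \<sigma>') \<and> \<not> tval b g \<sigma>')"
  using assms(1)
proof (induction k arbitrary: \<sigma> rule: less_induct)
  case (less k)
  show ?case
  proof (cases "tval b g \<sigma>")
    case False
    have "exec b (While g c) \<sigma> (1 + tcost g) \<sigma>" using False by (rule exec.WhileFalse)
    then show ?thesis unfolding runs_def using less.prems False by force
  next
    case True
    obtain T where "runs b c \<sigma> T (\<lambda>\<sigma>'. \<exists>k'. I k' \<sigma>' \<and> k' + T + 1 + tcost g \<le> k)"
      using assms(2)[OF less.prems True] ..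
    then obtain t \<sigma>' k' where c: "exec b c \<sigma> t \<sigma>'" "t \<le> T" "I k' \<sigma>'" "k' + T + 1 + tcost g \<le> k"
      by (auto simp: runs_def)
    then have "runs b (While g c) \<sigma>' (k' + 1 + tcost g) (\<lambda>\<sigma>'. (\<exists>k'. I k' \<sigma>') \<and> \<not> tval b g \<sigma>')"
      by (intro less.IH) auto
    then obtain t' \<sigma>'' where "exec b (While g c) \<sigma>' t' \<sigma>''" "t' \<le> k' + 1 + tcost g"
      "\<exists>k'. I k' \<sigma>''" "\<not> tval b g \<sigma>''" by (auto simp: runs_def)
    moreover from this have "exec b (While g c) \<sigma> (1 + tcost g + t + t') \<sigma>''"
      using exec.WhileTrue[OF True c(1)] by simp
    ultimately show ?thesis unfolding runs_def using c(2,4)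
      by (intro exI[of _ "1 + tcost g + t + t'"] exI[of _ \<sigma>'']) auto
  qed
qed

text \<open>The special case of rounds with a common cost bound, the potential being the number of
  rounds left times that bound plus the test.\<close>

lemma runs_While_count:
  assumes "I k \<sigma>"
    and "\<And>k \<sigma>. I k \<sigma> \<Longrightarrow> tval b g \<sigma> \<Longrightarrow> 0 < k \<and> runs b c \<sigma> T (\<lambda>\<sigma>'. I (k - 1) \<sigma>')"
  shows "runs b (While g c) \<sigma> (k * (T + 1 + tcost g) + 1 + tcost g) (\<lambda>\<sigma>'. (\<exists>k'. I k' \<sigma>') \<and> \<not> tval b g \<sigma>')"
proof -
  let ?S = "T + 1 + tcost g"
  have "runs b (While g c) \<sigma> (k * ?S + 1 + tcost g)
    (\<lambda>\<sigma>'. (\<exists>k'. \<exists>j. k' = j * ?S \<and> I j \<sigma>') \<and> \<not> tval b g \<sigma>')"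
  proof (rule runs_While[where I = "\<lambda>k' \<sigma>. \<exists>j. k' = j * ?S \<and> I j \<sigma>"])
    fix k \<sigma> assume "\<exists>j. k = j * ?S \<and> I j \<sigma>" and g: "tval b g \<sigma>"
    then obtain j where j: "k = j * ?S" "I j \<sigma>" by blast
    note step = assms(2)[OF j(2) g]
    have "(j - 1) * ?S + T + 1 + tcost g \<le> k" using step j(1) by (cases j) auto
    then have "runs b c \<sigma> T (\<lambda>\<sigma>'. \<exists>k'. (\<exists>j. k' = j * ?S \<and> I j \<sigma>') \<and> k' + T + 1 + tcost g \<le> k)"
      using step by (blast intro: runs_weaken[OF _ order_refl])
    then show "\<exists>T. runs b c \<sigma> T (\<lambda>\<sigma>'. \<exists>k'. (\<exists>j. k' = j * ?S \<and> I j \<sigma>') \<and> k' + T + 1 + tcost g \<le> k)" ..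
  qed (use assms(1) in blast)
  then show ?thesis by (rule runs_weaken) auto
qed

text \<open>Loop-free code is executed symbolically; \<open>wp\<close> is not meaningful for loops.\<close>

primrec wp :: "nat \<Rightarrow> com \<Rightarrow> (store \<Rightarrow> bool) \<Rightarrow> store \<Rightarrow> bool" where
  "wp b Skip Q \<sigma> \<longleftrightarrow> Q \<sigma>"
| "wp b (Store a i x) Q \<sigma> \<longleftrightarrow> Q (set_word a (wval b i \<sigma>) (wval b x \<sigma>) \<sigma>)"
| "wp b (RStore a i x) Q \<sigma> \<longleftrightarrow> Q (set_real a (wval b i \<sigma>) (rval b x \<sigma>) \<sigma>)"
| "wp b (Seq c d) Q \<sigma> \<longleftrightarrow> wp b c (wp b d Q) \<sigma>"
| "wp b (Cond g c d) Q \<sigma> \<longleftrightarrow> (if tval b g \<sigma> then wp b c Q \<sigma> else wp b d Q \<sigma>)"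
| "wp b (While g c) Q \<sigma> \<longleftrightarrow> False"

lemma wp_mono: "wp b c Q \<sigma> \<Longrightarrow> (\<And>\<sigma>'. Q \<sigma>' \<Longrightarrow> Q' \<sigma>') \<Longrightarrow> wp b c Q' \<sigma>"
  by (induction c arbitrary: Q Q' \<sigma>) (auto split: if_splits)

text \<open>Adding the costs of both branches gives a bound independent of the store. The value for
  loops is a dummy, as \<open>wp\<close> is false for them.\<close>

primrec ccost :: "com \<Rightarrow> nat" where
  "ccost Skip = 1"
| "ccost (Store a i x) = 1 + wcost i + wcost x"
| "ccost (RStore a i x) = 1 + wcost i + rcost x"
| "ccost (Seq c d) = ccost c + ccost d"
| "ccost (Cond g c d) = 1 + tcost g + (ccost c + ccost d)"
| "ccost (While g c) = 0"

lemma runs_wp: "wp b c Q \<sigma> \<Longrightarrow> runs b c \<sigma> (ccost c) Q"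
proof (induction c arbitrary: Q \<sigma>)
  case Skip
  then show ?case using exec.Skip by (auto simp: runs_def)
next
  case (Store a i x)
  then show ?case using exec.Store by (fastforce simp: runs_def)
next
  case (RStore a i x)
  then show ?case using exec.RStore by (fastforce simp: runs_def)
next
  case (Seq c d)
  have "runs b c \<sigma> (ccost c) (wp b d Q)" using Seq by simp
  then have "runs b (Seq c d) \<sigma> (ccost c + ccost d) Q" using Seq.IH(2) by (rule runs_Seq)
  then show ?case by simp
next
  case (Cond g c d)
  then show ?case
    unfolding ccost.simps
    by (intro runs_Cond) (auto intro: runs_weaken[where Q = Q and T = "ccost c"] runs_weaken[where Q = Q and T = "ccost d"])
qed simp

section \<open>Arrays that a program leaves unchanged\<close>

primrec written_words :: "com \<Rightarrow> string set" where
  "written_words Skip = {}"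
| "written_words (Store a i x) = {a}"
| "written_words (RStore a i x) = {}"
| "written_words (Seq c d) = written_words c \<union> written_words d"
| "written_words (Cond g c d) = written_words c \<union> written_words d"
| "written_words (While g c) = written_words c"

primrec written_reals :: "com \<Rightarrow> string set" where
  "written_reals Skip = {}"
| "written_reals (Store a i x) = {}"
| "written_reals (RStore a i x) = {a}"
| "written_reals (Seq c d) = written_reals c \<union> written_reals d"
| "written_reals (Cond g c d) = written_reals c \<union> written_reals d"
| "written_reals (While g c) = written_reals c"

lemma words_set_word [simp]:
  "words (set_word a i x \<sigma>) c = (if c = a then (words \<sigma> a)(i := x) else words \<sigma> c)"
  by (simp add: set_word_def)

lemma reals_set_word [simp]: "reals (set_word a i x \<sigma>) = reals \<sigma>"
  by (simp add: set_word_def)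

lemma reals_set_real [simp]:
  "reals (set_real a i x \<sigma>) c = (if c = a then (reals \<sigma> a)(i := x) else reals \<sigma> c)"
  by (simp add: set_real_def)

lemma words_set_real [simp]: "words (set_real a i x \<sigma>) = words \<sigma>"
  by (simp add: set_real_def)

definition frame :: "com \<Rightarrow> store \<Rightarrow> store \<Rightarrow> bool" where
  "frame c \<sigma> \<sigma>' \<longleftrightarrow> (\<forall>a. a \<notin> written_words c \<longrightarrow> words \<sigma>' a = words \<sigma> a) \<and>
     (\<forall>a. a \<notin> written_reals c \<longrightarrow> reals \<sigma>' a = reals \<sigma> a)"

lemma exec_frame: "exec b c \<sigma> t \<sigma>' \<Longrightarrow> frame c \<sigma> \<sigma>'"
  by (induction rule: exec.induct) (simp_all add: frame_def)

lemma runs_frame: "runs b c \<sigma> T Q \<Longrightarrow> runs b c \<sigma> T (\<lambda>\<sigma>'. Q \<sigma>' \<and> frame c \<sigma> \<sigma>')"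
  using exec_frame unfolding runs_def by blast

lemma frame_words: "frame c \<sigma> \<sigma>' \<Longrightarrow> a \<notin> written_words c \<Longrightarrow> words \<sigma>' a = words \<sigma> a"
  and frame_reals: "frame c \<sigma> \<sigma>' \<Longrightarrow> a \<notin> written_reals c \<Longrightarrow> reals \<sigma>' a = reals \<sigma> a"
  by (simp_all add: frame_def)

text \<open>Naming the number of words keeps simplification from rewriting comparisons with \<open>2 ^ b\<close>.\<close>

definition cap :: "nat \<Rightarrow> nat" where
  "cap b = 2 ^ b"

text \<open>As conditional simplification rules these replace the defining equations with
  \<open>mod\<close>, so every evaluation of a constant, sum or product has to establish the absence
  of overflow.\<close>

lemma wval_Const: "c < cap b \<Longrightarrow> wval b (Const c) \<sigma> = c"
  and wval_Plus: "wval b x \<sigma> + wval b y \<sigma> < cap b \<Longrightarrow> wval b (Plus x y) \<sigma> = wval b x \<sigma> + wval b y \<sigma>"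
  and wval_Times: "wval b x \<sigma> * wval b y \<sigma> < cap b \<Longrightarrow> wval b (Times x y) \<sigma> = wval b x \<sigma> * wval b y \<sigma>"
  by (simp_all add: cap_def)

lemma cap_pos [simp]: "0 < cap b"
  by (simp add: cap_def)

declare wval.simps(1,3,5) [simp del]
declare wval_Const [simp] wval_Plus [simp] wval_Times [simp]

abbreviation var :: "string \<Rightarrow> wexp" where
  "var a \<equiv> Cell a (Const 0)"

abbreviation assign :: "string \<Rightarrow> wexp \<Rightarrow> com" (infix "::=" 62) where
  "a ::= x \<equiv> Store a (Const 0) x"

notation Seq (infixr ";;" 60)

abbreviation TOr :: "test \<Rightarrow> test \<Rightarrow> test" where
  "TOr g h \<equiv> TNot (TAnd (TNot g) (TNot h))"

abbreviation WNeq :: "wexp \<Rightarrow> wexp \<Rightarrow> test" where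
  "WNeq x y \<equiv> TOr (WLess x y) (WLess y x)"

section \<open>The tournament tree\<close>

type_synonym entry = "(nat \<times> real \<times> nat) option"

text \<open>\<open>None\<close> acts as an infinite key. The vertex number is carried along but not
  compared, so ties between vertices remain.\<close>

fun beats :: "entry \<Rightarrow> entry \<Rightarrow> bool" where
  "beats None k \<longleftrightarrow> False"
| "beats (Some _) None \<longleftrightarrow> True"
| "beats (Some (v, d, h)) (Some (v', d', h')) \<longleftrightarrow> d < d' \<or> d = d' \<and> h < h'"

lemma beats_irrefl: "\<not> beats k k"
  by (cases k) auto

lemma beats_asym: "beats k k' \<Longrightarrow> \<not> beats k' k"
  by (cases "(k, k')" rule: beats.cases) auto

text \<open>Not being beaten is a total preorder, hence it composes along the path from a leaf to
  the root.\<close>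

lemma not_beats_trans: "\<not> beats k3 k2 \<Longrightarrow> \<not> beats k2 k1 \<Longrightarrow> \<not> beats k3 k1"
  by (cases k1; cases k2; cases k3) auto

text \<open>Heap numbering with children \<open>2 * i\<close> and \<open>2 * i + 1\<close>; the left
  child wins ties. In a tournament the nodes from \<open>N\<close> to \<open>2 * N - 1\<close> are
  the leaves, and \<open>N\<close> need not be a power of two.\<close>

definition winner :: "(nat \<Rightarrow> entry) \<Rightarrow> nat \<Rightarrow> bool" where
  "winner k i \<longleftrightarrow> k i = (if beats (k (2 * i + 1)) (k (2 * i)) then k (2 * i + 1) else k (2 * i))"

definition tournament :: "nat \<Rightarrow> (nat \<Rightarrow> entry) \<Rightarrow> bool" where
  "tournament N k \<longleftrightarrow> (\<forall>i\<in>{1..<N}. winner k i)"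

lemma tournament_root_best:
  assumes "tournament N k"
  shows "1 \<le> j \<Longrightarrow> j < 2 * N \<Longrightarrow> \<not> beats (k j) (k 1)"
proof (induction j rule: less_induct)
  case (less j)
  show ?case
  proof (cases "j = 1")
    case False
    let ?i = "j div 2"
    have i: "1 \<le> ?i" "?i < N" using less.prems False by auto
    then have "winner k ?i" using assms by (auto simp: tournament_def)
    moreover have "j = 2 * ?i \<or> j = 2 * ?i + 1" by linarith
    ultimately have "\<not> beats (k j) (k ?i)"
      unfolding winner_def using beats_irrefl beats_asym by metis
    moreover have "\<not> beats (k ?i) (k 1)" using less.IH[of ?i] less.prems i by simp
    ultimately show ?thesis by (rule not_beats_trans)
  qed (simp add: beats_irrefl)
qed

text \<open>Descending to the child whose entry was copied increases the node number and ends in a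
  leaf; so the root, already known to be unbeaten, is an actual leaf entry.\<close>

lemma tournament_leaf:
  assumes "tournament N k"
  shows "1 \<le> j \<Longrightarrow> j < 2 * N \<Longrightarrow> \<exists>l\<in>{N..<2 * N}. k l = k j"
proof (induction "2 * N - j" arbitrary: j rule: less_induct)
  case less
  show ?case
  proof (cases "N \<le> j")
    case False
    then have "winner k j" using assms less.prems by (auto simp: tournament_def)
    then have "k j = k (2 * j) \<or> k j = k (2 * j + 1)" by (auto simp: winner_def)
    then show ?thesis using less.hyps[of "2 * j"] less.hyps[of "2 * j + 1"] less.prems False by auto
  qed (use less.prems in auto)
qed

section \<open>The tournament tree in memory\<close>

definition entry :: "store \<Rightarrow> nat \<Rightarrow> entry" where
  "entry \<sigma> i = (if words \<sigma> ''tv'' i = 0 then None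
     else Some (words \<sigma> ''tv'' i, reals \<sigma> ''td'' i, words \<sigma> ''th'' i))"

text \<open>Reals can only be tested by \<open><\<close>, so equal distances show as the failure of
  both strict comparisons.\<close>

definition beats_test :: "wexp \<Rightarrow> wexp \<Rightarrow> test" where
  "beats_test i j = TAnd (WLess (Const 0) (Cell ''tv'' i))
     (TOr (TNot (WLess (Const 0) (Cell ''tv'' j)))
       (TOr (RLess (RCell ''td'' i) (RCell ''td'' j))
         (TAnd (TNot (RLess (RCell ''td'' j) (RCell ''td'' i))) (WLess (Cell ''th'' i) (Cell ''th'' j)))))"

lemma tval_beats_test:
  "tval b (beats_test i j) \<sigma> \<longleftrightarrow> beats (entry \<sigma> (wval b i \<sigma>)) (entry \<sigma> (wval b j \<sigma>))"
  by (auto simp: beats_test_def entry_def)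

definition repair_step :: com where
  "repair_step =
     ''l'' ::= Times (Const 2) (var ''c'') ;;
     Cond (beats_test (Plus (var ''l'') (Const 1)) (var ''l''))
       (''l'' ::= Plus (var ''l'') (Const 1)) Skip ;;
     Store ''tv'' (var ''c'') (Cell ''tv'' (var ''l'')) ;;
     RStore ''td'' (var ''c'') (RCell ''td'' (var ''l'')) ;;
     Store ''th'' (var ''c'') (Cell ''th'' (var ''l'')) ;;
     ''c'' ::= Div (var ''c'') (Const 2)"

definition repair :: com where
  "repair = While (WLess (Const 0) (var ''c'')) repair_step"

definition same_above :: "nat \<Rightarrow> store \<Rightarrow> store \<Rightarrow> bool" where
  "same_above N \<sigma> \<sigma>' \<longleftrightarrow> (\<forall>i\<ge>N. words \<sigma>' ''tv'' i = words \<sigma> ''tv'' i \<and>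
     reals \<sigma>' ''td'' i = reals \<sigma> ''td'' i \<and> words \<sigma>' ''th'' i = words \<sigma> ''th'' i)"

definition repair_cost :: "nat \<Rightarrow> nat" where
  "repair_cost K = Suc K * (ccost repair_step + 10)"

text \<open>Recomputing node \<open>c\<close> corrects it and can disturb only its parent. From
  \<open>c = 1\<close> the exemption moves to 0, which is no node, so it disappears.\<close>

lemma repair_step_wp:
  assumes "0 < words \<sigma> ''c'' 0" "words \<sigma> ''c'' 0 < N" "2 * N \<le> cap b"
    and "\<forall>i\<in>{1..<N}. i \<noteq> words \<sigma> ''c'' 0 \<longrightarrow> winner (entry \<sigma>) i"
  shows "wp b repair_step (\<lambda>\<sigma>'. words \<sigma>' ''c'' 0 = words \<sigma> ''c'' 0 div 2 \<and>
    (\<forall>i\<in>{1..<N}. i \<noteq> words \<sigma> ''c'' 0 div 2 \<longrightarrow> winner (entry \<sigma>') i) \<and> same_above N \<sigma> \<sigma>') \<sigma>"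
proof -
  let ?c = "words \<sigma> ''c'' 0"
  define l where "l = (if beats (entry \<sigma> (2 * ?c + 1)) (entry \<sigma> (2 * ?c)) then 2 * ?c + 1 else 2 * ?c)"
  define k where "k = (entry \<sigma>)(?c := entry \<sigma> l)"
  have "winner k i" if "i \<in> {1..<N}" "i \<noteq> ?c div 2" for i
  proof (cases "i = ?c")
    case True
    then show ?thesis using assms(1) by (simp add: winner_def k_def l_def)
  next
    case False
    then have "2 * i \<noteq> ?c" "2 * i + 1 \<noteq> ?c" using that by auto
    then show ?thesis using False that assms(4) by (auto simp: winner_def k_def)
  qed
  moreover have "entry \<sigma>' = k"
    if "words \<sigma>' ''tv'' = (words \<sigma> ''tv'')(?c := words \<sigma> ''tv'' l)"
      "words \<sigma>' ''th'' = (words \<sigma> ''th'')(?c := words \<sigma> ''th'' l)"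
      "reals \<sigma>' ''td'' = (reals \<sigma> ''td'')(?c := reals \<sigma> ''td'' l)" for \<sigma>'
    using that by (auto simp: k_def entry_def fun_eq_iff)
  moreover have "wp b repair_step (\<lambda>\<sigma>'. words \<sigma>' ''c'' 0 = ?c div 2 \<and>
      words \<sigma>' ''tv'' = (words \<sigma> ''tv'')(?c := words \<sigma> ''tv'' l) \<and>
      words \<sigma>' ''th'' = (words \<sigma> ''th'')(?c := words \<sigma> ''th'' l) \<and>
      reals \<sigma>' ''td'' = (reals \<sigma> ''td'')(?c := reals \<sigma> ''td'' l)) \<sigma>"
    using assms(1-3) by (simp add: repair_step_def tval_beats_test entry_def l_def)
  ultimately show ?thesis
    using assms(2) by (elim wp_mono) (auto simp: same_above_def)
qed

text \<open>The bound \<open>2 ^ K\<close> on the current node halves in each round, so at most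
  \<open>K\<close> nodes are recomputed.\<close>

lemma repair:
  assumes "words \<sigma> ''c'' 0 < N" "2 * N \<le> cap b" "words \<sigma> ''c'' 0 < 2 ^ K"
    and "\<forall>i\<in>{1..<N}. i \<noteq> words \<sigma> ''c'' 0 \<longrightarrow> winner (entry \<sigma>) i"
  shows "runs b repair \<sigma> (repair_cost K) (\<lambda>\<sigma>'. tournament N (entry \<sigma>') \<and> same_above N \<sigma> \<sigma>')"
proof -
  let ?I = "\<lambda>k \<tau>. words \<tau> ''c'' 0 < N \<and> words \<tau> ''c'' 0 < 2 ^ k \<and>
    (\<forall>i\<in>{1..<N}. i \<noteq> words \<tau> ''c'' 0 \<longrightarrow> winner (entry \<tau>) i) \<and> same_above N \<sigma> \<tau>"
  let ?g = "WLess (Const 0) (var ''c'')"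
  have "runs b repair \<sigma> (K * (ccost repair_step + 1 + tcost ?g) + 1 + tcost ?g)
    (\<lambda>\<sigma>'. (\<exists>k'. ?I k' \<sigma>') \<and> \<not> tval b ?g \<sigma>')"
    unfolding repair_def
  proof (rule runs_While_count[where I = ?I])
    show "?I K \<sigma>" using assms by (simp add: same_above_def)
    fix k \<tau> assume I: "?I k \<tau>" and g: "tval b ?g \<tau>"
    have k: "0 < k" using I g by (cases k) auto
    have "words \<tau> ''c'' 0 div 2 < 2 ^ (k - 1)" using I k by (cases k) auto
    moreover have "runs b repair_step \<tau> (ccost repair_step) (\<lambda>\<sigma>'. words \<sigma>' ''c'' 0 = words \<tau> ''c'' 0 div 2 \<and>
        (\<forall>i\<in>{1..<N}. i \<noteq> words \<tau> ''c'' 0 div 2 \<longrightarrow> winner (entry \<sigma>') i) \<and> same_above N \<tau> \<sigma>')"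
      using I g assms(2) by (intro runs_wp repair_step_wp) auto
    ultimately have "runs b repair_step \<tau> (ccost repair_step) (?I (k - 1))"
      using I by (elim runs_weaken) (auto simp: same_above_def)
    then show "0 < k \<and> runs b repair_step \<tau> (ccost repair_step) (?I (k - 1))" using k by blast
  qed
  then show ?thesis
  proof (rule runs_weaken)
    show "K * (ccost repair_step + 1 + tcost ?g) + 1 + tcost ?g \<le> repair_cost K"
      by (simp add: repair_cost_def algebra_simps)
  qed (auto simp: tournament_def)
qed

section \<open>Jump tables\<close>

text \<open>Two-dimensional tables are stored row by row in one array with row length
  \<open>N\<close>; addressing is injective.\<close>

lemma row_col_eq: "x < N \<Longrightarrow> y < N \<Longrightarrow> i * N + x = j * N + y \<longleftrightarrow> i = j \<and> x = (y::nat)"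
  by (metis add.commute add_left_cancel div_mult_self3 div_less bot_nat_0.not_eq_extremum
      less_nat_zero_code add_0)

lemma row_col_less: "x < N \<Longrightarrow> i < k \<Longrightarrow> i * N + x < k * (N::nat)"
  by (metis Suc_leI add.commute add_less_cancel_right less_le_trans mult_Suc mult_le_mono1)

context sourced_graph
begin

text \<open>A common vertex at the same depth forces a common prefix, since that prefix is the
  lex-shortest path to it. Agreement is thus downward closed, which allows binary search for the
  point of divergence.\<close>

lemma agree_below:
  assumes "p \<in> R" "q \<in> R" "i \<le> depth p" "i \<le> depth q" "sp p ! i = sp q ! i" "k \<le> i"
  shows "sp p ! k = sp q ! k"
proof -
  have "take (Suc i) (sp p) = take (Suc i) (sp q)" using sp_prefix(2) assms by metis
  then show ?thesis using assms(6) by (metis le_imp_less_Suc nth_take)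
qed

text \<open>The ancestors at distance \<open>2 ^ j\<close>, and the least vertex strictly below them on the path.
  Natural subtraction makes the former the source if there are too few ancestors.\<close>

definition jump_ok :: "(nat \<Rightarrow> nat) \<Rightarrow> (nat \<Rightarrow> nat) \<Rightarrow> nat \<Rightarrow> nat \<Rightarrow> bool" where
  "jump_ok up mn j v \<longleftrightarrow> up (j * Suc n + v) = sp v ! (depth v - 2 ^ j) \<and>
     (2 ^ j \<le> depth v \<longrightarrow> mn (j * Suc n + v) = Min ((!) (sp v) ` {depth v - 2 ^ j<..depth v}))"

lemma jump_ok_update:
  "j * Suc n + v \<noteq> i \<Longrightarrow> jump_ok (up(i := a)) (mn(i := c)) j v = jump_ok up mn j v"
  by (simp add: jump_ok_def)

text \<open>Row 0 is the parent array, provided that the source is its own parent.\<close>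

lemma jump_ok_0:
  assumes "v \<in> R" "up v = (if v = s then s else pred v)" "mn v = v"
  shows "jump_ok up mn 0 v"
proof -
  have "{depth v - 1<..depth v} = {depth v}" if "0 < depth v" using that by auto
  then show ?thesis using assms sp_source sp_nth_depth by (auto simp: jump_ok_def pred_def)
qed

text \<open>A long jump is two jumps of half the length over adjacent intervals of positions.
  Truncation lets both halves stop at the source when there are too few ancestors.\<close>

lemma jump_ok_Suc:
  assumes v: "v \<in> R" and j: "jump_ok up mn j v" "jump_ok up mn j (up (j * Suc n + v))"
    and new: "up (Suc j * Suc n + v) = up (j * Suc n + up (j * Suc n + v))"
      "mn (Suc j * Suc n + v) = min (mn (j * Suc n + v)) (mn (j * Suc n + up (j * Suc n + v)))"
  shows "jump_ok up mn (Suc j) v"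
proof -
  let ?d = "depth v - 2 ^ j"
  define u where "u = sp v ! ?d"
  have up: "up (j * Suc n + v) = u" using j by (simp add: jump_ok_def u_def)
  have u: "u \<in> R" "sp u = take (Suc ?d) (sp v)" "depth u = ?d"
    using sp_prefix[OF v, of ?d] by (auto simp: u_def)
  have "sp u ! (?d - 2 ^ j) = sp v ! (depth v - 2 ^ Suc j)" by (simp add: u mult_2)
  then have "up (Suc j * Suc n + v) = sp v ! (depth v - 2 ^ Suc j)"
    using j(2) new(1) up u by (simp add: jump_ok_def)
  moreover have "mn (Suc j * Suc n + v) = Min ((!) (sp v) ` {depth v - 2 ^ Suc j<..depth v})"
    if le: "2 ^ Suc j \<le> depth v"
  proof -
    have 1: "mn (j * Suc n + v) = Min ((!) (sp v) ` {?d<..depth v})"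
      using le j(1) by (simp add: jump_ok_def)
    have "(!) (sp u) ` {?d - 2 ^ j<..?d} = (!) (sp v) ` {?d - 2 ^ j<..?d}"
      unfolding u(2) by (rule image_cong) auto
    then have 2: "mn (j * Suc n + u) = Min ((!) (sp v) ` {?d - 2 ^ j<..?d})"
      using le j(2) up u by (simp add: jump_ok_def)
    have split: "{depth v - 2 ^ Suc j<..depth v} = {?d<..depth v} \<union> {?d - 2 ^ j<..?d}"
      using le by auto
    obtain P where P: "(2::nat) ^ j = P" "0 < P" by simp
    then have "{?d<..depth v} \<noteq> {}" "{?d - 2 ^ j<..?d} \<noteq> {}" using le by auto
    then show ?thesis unfolding new(2) up 1 2 split image_Un by (subst Min_Un) auto
  qed
  ultimately show ?thesis by (simp add: jump_ok_def)
qed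

definition jumps :: "nat \<Rightarrow> nat set \<Rightarrow> (nat \<Rightarrow> nat) \<Rightarrow> (nat \<Rightarrow> nat) \<Rightarrow> bool" where
  "jumps K F up mn \<longleftrightarrow> (\<forall>v\<in>F. \<forall>j<K. jump_ok up mn j v)"

text \<open>During the descent of a pair of vertices from \<open>p\<close> and \<open>q\<close> towards the source, \<open>t\<close> is their
  current depth: they have not met yet, and their ancestors at distance \<open>2 ^ j\<close> coincide.\<close>

definition diverge :: "nat \<Rightarrow> nat \<Rightarrow> nat \<Rightarrow> nat \<Rightarrow> bool" where
  "diverge p q j t \<longleftrightarrow> t \<le> depth p \<and> (p \<noteq> q \<longrightarrow> sp p ! t \<noteq> sp q ! t) \<and>
     (\<forall>i. i + 2 ^ j \<le> t \<longrightarrow> sp p ! i = sp q ! i)"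

text \<open>\<open>Suc n\<close> exceeds every vertex and serves as the minimum of an empty
  interval; the machine has it at hand in the variable \<open>N\<close>.\<close>

definition least_after :: "nat \<Rightarrow> nat \<Rightarrow> nat" where
  "least_after p t = Min (insert (Suc n) ((!) (sp p) ` {t<..depth p}))"

lemma least_after_depth: "least_after p (depth p) = Suc n"
  by (simp add: least_after_def)

lemma min_least_after:
  assumes "t' < t" "t \<le> depth p"
  shows "min (Min ((!) (sp p) ` {t'<..t})) (least_after p t) = least_after p t'"
proof -
  have "insert (Suc n) ((!) (sp p) ` {t'<..depth p}) =
    (!) (sp p) ` {t'<..t} \<union> insert (Suc n) ((!) (sp p) ` {t<..depth p})"
    using assms by force
  moreover have "Min \<dots> = min (Min ((!) (sp p) ` {t'<..t})) (least_after p t)"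
    unfolding least_after_def by (rule Min_Un) (use assms in auto)
  ultimately show ?thesis by (simp add: least_after_def)
qed

text \<open>Depths are below \<open>2 ^ K\<close>, so no position satisfies the premise of the
  agreement condition.\<close>

lemma diverge_start:
  assumes "p \<in> R" "q \<in> R" "depth p = depth q" "n < 2 ^ K"
  shows "diverge p q K (depth p)"
  using assms sp_nth_depth depth_less[of p] unfolding diverge_def by force

text \<open>If the ancestors at distance \<open>2 ^ j\<close> agree, so do all earlier ones, and the
  pair stays. If they differ, the jump was not truncated, since both paths start in the source, and
  the pair moves up.\<close>

lemma diverge_step:
  assumes "p \<in> R" "q \<in> R" "depth p = depth q" "diverge p q (Suc j) t"
  shows "if sp p ! (t - 2 ^ j) = sp q ! (t - 2 ^ j) then diverge p q j t
    else 2 ^ j \<le> t \<and> diverge p q j (t - 2 ^ j)"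
proof (cases "sp p ! (t - 2 ^ j) = sp q ! (t - 2 ^ j)")
  case True
  then have "sp p ! i = sp q ! i" if "i + 2 ^ j \<le> t" for i
    using agree_below[OF assms(1,2) _ _ True, of i] that assms(3,4) by (auto simp: diverge_def)
  then show ?thesis using True assms(4) by (simp add: diverge_def)
next
  case False
  then have "2 ^ j \<le> t" using assms(1,2) sp_nth_0 by (metis diff_is_0_eq' nat_le_linear)
  then show ?thesis using False assms(4) by (auto simp: diverge_def)
qed

text \<open>For \<open>j = 0\<close> the paths agree before position \<open>t\<close> and differ at
  \<open>t\<close>. They differ from there on because a shared vertex has the same position, its
  depth, on both paths, and would force agreement at \<open>t\<close>.\<close>

lemma diverge_end:
  assumes p: "p \<in> R" and q: "q \<in> R" and d: "depth p = depth q" and t: "diverge p q 0 t" and ne: "p \<noteq> q"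
  shows "set (sp p) - set (sp q) = (!) (sp p) ` {t..depth p}"
proof -
  have set: "set (sp v) = (!) (sp v) ` {..depth v}" if "v \<in> R" for v
    using length_sp[OF that] by (auto simp: set_conv_nth image_def less_Suc_eq_le)
  have "sp p ! i \<notin> set (sp q)" if i: "t \<le> i" "i \<le> depth p" for i
  proof
    assume "sp p ! i \<in> set (sp q)"
    then obtain k where k: "k \<le> depth q" "sp p ! i = sp q ! k" by (auto simp: set[OF q])
    then have "i = k" using sp_prefix(3)[OF p i(2)] sp_prefix(3)[OF q k(1)] by simp
    then have "sp p ! t = sp q ! t" using agree_below[OF p q i(2) _ _ i(1)] k by simp
    then show False using t ne by (simp add: diverge_def)
  qed
  moreover have "sp p ! i \<in> set (sp q)" if "i < t" for i
    using that t d length_sp[OF q] by (auto simp: diverge_def Suc_le_eq)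
  ultimately have "sp p ! i \<in> set (sp q) \<longleftrightarrow> i < t" if "i \<le> depth p" for i
    using that not_less by blast
  then show ?thesis unfolding set[OF p] by (auto simp: not_less)
qed

lemma diverge_sym: "depth p = depth q \<Longrightarrow> diverge p q j t = diverge q p j t"
  by (auto simp: diverge_def eq_commute)

text \<open>The accumulated minima cover only the positions strictly below \<open>t\<close>, so the
  vertices at \<open>t\<close> are added at the end.\<close>

lemma diverge_compare:
  assumes p: "p \<in> R" and q: "q \<in> R" and d: "depth p = depth q" and t: "diverge p q 0 t"
  shows "min (sp p ! t) (least_after p t) < min (sp q ! t) (least_after q t) \<longleftrightarrow>
    set (sp p) - set (sp q) \<noteq> {} \<and> set (sp q) - set (sp p) \<noteq> {} \<and>
    Min (set (sp p) - set (sp q)) < Min (set (sp q) - set (sp p))"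
proof (cases "p = q")
  case False
  have le: "t \<le> depth p" using t by (simp add: diverge_def)
  have least: "min (sp v ! t) (least_after v t) = Min ((!) (sp v) ` {t..depth v})"
    if v: "v \<in> R" and le: "t \<le> depth v" for v
  proof -
    have "sp v ! t \<in> set (sp v)" using le length_sp[OF v] by simp
    \<comment> \<open>The sentinel \<open>Suc n\<close> is larger and never survives the
      minimum.\<close>
    then have n: "sp v ! t \<le> n" using sp_path[OF v] by (auto simp: path_between_def V_def)
    have split: "{t..depth v} = insert t {t<..depth v}" using le by auto
    show ?thesis
    proof (cases "{t<..depth v} = {}")
      case True
      then have "least_after v t = Suc n" unfolding least_after_def True by simp
      then show ?thesis using n unfolding split True by simp
    next
      case False
      then have "least_after v t = min (Suc n) (Min ((!) (sp v) ` {t<..depth v}))"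
        "Min ((!) (sp v) ` {t..depth v}) = min (sp v ! t) (Min ((!) (sp v) ` {t<..depth v}))"
        unfolding split least_after_def image_insert by (intro Min_insert; simp)+
      moreover have "min (sp v ! t) (Suc n) = sp v ! t" using n by simp
      ultimately show ?thesis by (metis min.assoc)
    qed
  qed
  have t': "diverge q p 0 t" using t d diverge_sym by simp
  show ?thesis
    using le d by (simp add: least p q diverge_end[OF p q d t False] diverge_end[OF q p d[symmetric] t' False[symmetric]])
qed simp

end

section \<open>Building the jump table of a newly settled vertex\<close>

definition jump_step :: com where
  "jump_step =
     ''l'' ::= Plus (var ''i'') (var ''x'') ;;
     ''z'' ::= Plus (var ''i'') (Cell ''up'' (var ''l'')) ;;
     ''e'' ::= Plus (var ''l'') (var ''N'') ;;
     Store ''up'' (var ''e'') (Cell ''up'' (var ''z'')) ;;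
     Cond (WLess (Cell ''mn'' (var ''z'')) (Cell ''mn'' (var ''l'')))
       (Store ''mn'' (var ''e'') (Cell ''mn'' (var ''z'')))
       (Store ''mn'' (var ''e'') (Cell ''mn'' (var ''l''))) ;;
     ''i'' ::= Plus (var ''i'') (var ''N'') ;;
     ''j'' ::= Plus (var ''j'') (Const 1)"

definition jump_start :: com where
  "jump_start =
     Store ''up'' (var ''x'') (Cell ''parent'' (var ''x'')) ;;
     Store ''mn'' (var ''x'') (var ''x'') ;;
     ''i'' ::= Const 0 ;;
     ''j'' ::= Const 1"

definition jump_build :: com where
  "jump_build = jump_start ;; While (WLess (var ''j'') (var ''K'')) jump_step"

definition jump_cost :: "nat \<Rightarrow> nat" where
  "jump_cost K = ccost jump_start + K * (ccost jump_step + 6) + 6"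

lemma jump_step_wp:
  assumes "words \<sigma> ''i'' 0 = i" "words \<sigma> ''x'' 0 = x" "words \<sigma> ''N'' 0 = N" "words \<sigma> ''j'' 0 = j"
    and "words \<sigma> ''up'' (i + x) = z" "i + x + N < cap b" "i + z < cap b" "Suc j < cap b"
    "i + z \<noteq> i + x + N" "N \<noteq> 0"
  shows "wp b jump_step (\<lambda>\<sigma>'. words \<sigma>' ''i'' 0 = i + N \<and> words \<sigma>' ''j'' 0 = Suc j \<and>
    words \<sigma>' ''up'' = (words \<sigma> ''up'')(i + x + N := words \<sigma> ''up'' (i + z)) \<and>
    words \<sigma>' ''mn'' = (words \<sigma> ''mn'')(i + x + N := min (words \<sigma> ''mn'' (i + x)) (words \<sigma> ''mn'' (i + z)))) \<sigma>"
  using assms unfolding jump_step_def by (simp add: min_def)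

context sourced_graph
begin

text \<open>A new row of \<open>x\<close> is computed from the previous row at \<open>x\<close> and
  at its jump target. The target lies on \<open>sp x\<close>, so it is settled or \<open>x\<close>
  itself, and its previous row is available. Only the column of \<open>x\<close> is written, so the
  tables of settled vertices survive.\<close>

lemma jump_build:
  assumes x: "x \<in> R" "x \<notin> F" "F \<subseteq> R" "set (sp x) \<subseteq> insert x F"
    and vars: "words \<sigma> ''x'' 0 = x" "words \<sigma> ''N'' 0 = Suc n" "words \<sigma> ''K'' 0 = K"
    and parent: "words \<sigma> ''parent'' x = (if x = s then s else pred x)"
    and jumps: "jumps K F (words \<sigma> ''up'') (words \<sigma> ''mn'')"
    and cap: "Suc (Suc K) * Suc n < cap b"
  shows "runs b jump_build \<sigma> (jump_cost K) (\<lambda>\<sigma>'. jumps K (insert x F) (words \<sigma>' ''up'') (words \<sigma>' ''mn''))"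
proof -
  let ?N = "Suc n"
  have n: "y < ?N" if "y \<in> R" for y using that reachable_subset by (auto simp: V_def)
  \<comment> \<open>Row \<open>j\<close> is filled next, and the machine variable \<open>i\<close>
    is the offset of the row before it.\<close>
  define I where "I k \<tau> \<longleftrightarrow> (\<exists>j\<ge>1. k = K - j \<and> words \<tau> ''j'' 0 = j \<and> words \<tau> ''i'' 0 = (j - 1) * ?N \<and>
    words \<tau> ''x'' 0 = x \<and> words \<tau> ''N'' 0 = ?N \<and> words \<tau> ''K'' 0 = K \<and>
    jumps K F (words \<tau> ''up'') (words \<tau> ''mn'') \<and> (\<forall>l<j. jump_ok (words \<tau> ''up'') (words \<tau> ''mn'') l x))" for k and \<tau> :: store
  let ?g = "WLess (var ''j'') (var ''K'')"
  have small: "1 < cap b" "x < cap b" using cap n[OF x(1)] by simp_all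
  have start: "wp b jump_start (I (K - 1)) \<sigma>"
  proof -
    have "jumps K F ((words \<sigma> ''up'')(x := a)) ((words \<sigma> ''mn'')(x := c))" for a c
    proof -
      have "j * ?N + y \<noteq> x" if "y \<in> F" for j y
        using row_col_eq[of y ?N x j 0] n x that by auto
      then show ?thesis using jumps by (simp add: jumps_def jump_ok_update del: mult_Suc_right)
    qed
    moreover have "jump_ok ((words \<sigma> ''up'')(x := words \<sigma> ''parent'' x)) ((words \<sigma> ''mn'')(x := x)) 0 x"
      by (rule jump_ok_0) (use x parent in auto)
    ultimately show ?thesis
      using vars small unfolding jump_start_def I_def by simp
  qed
  have step: "0 < k \<and> runs b jump_step \<tau> (ccost jump_step) (I (k - 1))" if "I k \<tau>" "tval b ?g \<tau>" for k \<tau>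
  proof -
    obtain j' where j': "k = K - Suc j'" "words \<tau> ''j'' 0 = Suc j'" "words \<tau> ''i'' 0 = j' * ?N"
      "words \<tau> ''x'' 0 = x" "words \<tau> ''N'' 0 = ?N" "words \<tau> ''K'' 0 = K"
      and jumpsF: "jumps K F (words \<tau> ''up'') (words \<tau> ''mn'')"
      and jumpsx: "\<forall>l<Suc j'. jump_ok (words \<tau> ''up'') (words \<tau> ''mn'') l x"
      using \<open>I k \<tau>\<close> unfolding I_def by (metis One_nat_def Suc_le_D diff_Suc_1)
    have lt: "Suc j' < K" using that j' by simp
    define z where "z = words \<tau> ''up'' (j' * ?N + x)"
    have "z = sp x ! (depth x - 2 ^ j')" using jumpsx by (simp add: jump_ok_def z_def)
    moreover have "depth x - 2 ^ j' < length (sp x)" using length_sp[OF x(1)] by simp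
    ultimately have "z \<in> set (sp x)" by simp
    then have zF: "z \<in> insert x F" using x(4) by auto
    then have zR: "z \<in> R" using x by auto
    have okz: "jump_ok (words \<tau> ''up'') (words \<tau> ''mn'') j' z"
      using zF jumpsx jumpsF lt by (auto simp: jumps_def)
    have new: "j' * ?N + x + ?N = Suc j' * ?N + x" by simp
    have bound: "l * ?N + y < cap b" if "l < K" "y \<in> R" for l y
      using row_col_less[OF n[OF that(2)] that(1)] cap by simp
    have upd: "jump_ok ((words \<tau> ''up'')(Suc j' * ?N + x := a)) ((words \<tau> ''mn'')(Suc j' * ?N + x := c)) l y =
      jump_ok (words \<tau> ''up'') (words \<tau> ''mn'') l y" if "y \<in> insert x F" "y \<noteq> x \<or> l \<noteq> Suc j'" for a c l y
    proof (rule jump_ok_update)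
      have "y \<in> R" using that x by auto
      then show "l * ?N + y \<noteq> Suc j' * ?N + x"
        using row_col_eq[OF n n[OF x(1)], of y l "Suc j'"] that by blast
    qed
    have "K < cap b" using cap by simp
    have pre: "wp b jump_step (\<lambda>\<sigma>'. words \<sigma>' ''i'' 0 = j' * ?N + ?N \<and> words \<sigma>' ''j'' 0 = Suc (Suc j') \<and>
      words \<sigma>' ''up'' = (words \<tau> ''up'')(j' * ?N + x + ?N := words \<tau> ''up'' (j' * ?N + z)) \<and>
      words \<sigma>' ''mn'' = (words \<tau> ''mn'')(j' * ?N + x + ?N := min (words \<tau> ''mn'' (j' * ?N + x)) (words \<tau> ''mn'' (j' * ?N + z)))) \<tau>"
      by (rule jump_step_wp)
        (use j' z_def lt bound[of "Suc j'" x] bound[of j' z] x(1) zR n[OF x(1)] n[OF zR] \<open>K < cap b\<close> in auto)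
    have "runs b jump_step \<tau> (ccost jump_step) (I (K - Suc (Suc j')))"
    proof (rule runs_weaken[OF runs_frame[OF runs_wp[OF pre]] order_refl])
      fix \<sigma>'
      assume *: "(words \<sigma>' ''i'' 0 = j' * ?N + ?N \<and> words \<sigma>' ''j'' 0 = Suc (Suc j') \<and>
        words \<sigma>' ''up'' = (words \<tau> ''up'')(j' * ?N + x + ?N := words \<tau> ''up'' (j' * ?N + z)) \<and>
        words \<sigma>' ''mn'' = (words \<tau> ''mn'')(j' * ?N + x + ?N := min (words \<tau> ''mn'' (j' * ?N + x)) (words \<tau> ''mn'' (j' * ?N + z)))) \<and>
        frame jump_step \<tau> \<sigma>'"
      have same: "words \<sigma>' ''x'' = words \<tau> ''x''" "words \<sigma>' ''N'' = words \<tau> ''N''" "words \<sigma>' ''K'' = words \<tau> ''K''"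
        by (simp_all add: frame_words[OF conjunct2[OF *]] jump_step_def)
      have ups: "words \<sigma>' ''up'' = (words \<tau> ''up'')(Suc j' * ?N + x := words \<tau> ''up'' (j' * ?N + z))"
        "words \<sigma>' ''mn'' = (words \<tau> ''mn'')(Suc j' * ?N + x := min (words \<tau> ''mn'' (j' * ?N + x)) (words \<tau> ''mn'' (j' * ?N + z)))"
        using * unfolding new by blast+
      have old: "jump_ok (words \<sigma>' ''up'') (words \<sigma>' ''mn'') l y = jump_ok (words \<tau> ''up'') (words \<tau> ''mn'') l y"
        if "y \<in> insert x F" "y \<noteq> x \<or> l \<noteq> Suc j'" for l y unfolding ups using that by (rule upd)
      have "jumps K F (words \<sigma>' ''up'') (words \<sigma>' ''mn'')"
        using jumpsF old x(2) by (auto simp: jumps_def)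
      moreover have "jump_ok (words \<sigma>' ''up'') (words \<sigma>' ''mn'') (Suc j') x"
      proof (rule jump_ok_Suc[OF x(1)])
        have "j' * ?N + y \<noteq> Suc j' * ?N + x" if "y \<in> R" for y
          using row_col_eq[OF n[OF that] n[OF x(1)], of j' "Suc j'"] by simp
        then have at: "words \<sigma>' ''up'' (j' * ?N + y) = words \<tau> ''up'' (j' * ?N + y)"
          "words \<sigma>' ''mn'' (j' * ?N + y) = words \<tau> ''mn'' (j' * ?N + y)" if "y \<in> R" for y
          unfolding ups using that by simp_all
        have z': "words \<sigma>' ''up'' (j' * ?N + x) = z" using at x(1) z_def by simp
        show "jump_ok (words \<sigma>' ''up'') (words \<sigma>' ''mn'') j' x" using jumpsx old by simp
        show "jump_ok (words \<sigma>' ''up'') (words \<sigma>' ''mn'') j' (words \<sigma>' ''up'' (j' * ?N + x))"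
          unfolding z' using okz old zF by simp
        show "words \<sigma>' ''up'' (Suc j' * ?N + x) = words \<sigma>' ''up'' (j' * ?N + words \<sigma>' ''up'' (j' * ?N + x))"
          unfolding z' at(1)[OF zR] by (simp only: ups(1) fun_upd_same)
        show "words \<sigma>' ''mn'' (Suc j' * ?N + x) = min (words \<sigma>' ''mn'' (j' * ?N + x)) (words \<sigma>' ''mn'' (j' * ?N + words \<sigma>' ''up'' (j' * ?N + x)))"
          unfolding z' at(2)[OF zR] at(2)[OF x(1)] by (simp only: ups(2) fun_upd_same)
      qed
      then have "\<forall>l<Suc (Suc j'). jump_ok (words \<sigma>' ''up'') (words \<sigma>' ''mn'') l x"
        using jumpsx old by (auto simp: less_Suc_eq)
      ultimately show "I (K - Suc (Suc j')) \<sigma>'"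
        unfolding I_def using * same j' by (intro exI[of _ "Suc (Suc j')"]) simp
    qed
    then show ?thesis using j' lt by simp
  qed
  have "runs b jump_build \<sigma> (ccost jump_start + ((K - 1) * (ccost jump_step + 1 + tcost ?g) + 1 + tcost ?g))
    (\<lambda>\<sigma>'. (\<exists>k'. I k' \<sigma>') \<and> \<not> tval b ?g \<sigma>')"
    unfolding jump_build_def
    by (rule runs_Seq[OF runs_wp[OF start]], rule runs_While_count[where I = I]) (use step in auto)
  then show ?thesis
  proof (rule runs_weaken)
    fix \<sigma>' assume "(\<exists>k'. I k' \<sigma>') \<and> \<not> tval b ?g \<sigma>'"
    then show "jumps K (insert x F) (words \<sigma>' ''up'') (words \<sigma>' ''mn'')"
      unfolding I_def jumps_def by auto
  next
    have "(K - 1) * (ccost jump_step + 1 + tcost ?g) \<le> K * (ccost jump_step + 6)"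
      by (rule mult_le_mono) simp_all
    then show "ccost jump_start + ((K - 1) * (ccost jump_step + 1 + tcost ?g) + 1 + tcost ?g) \<le> jump_cost K"
      by (simp add: jump_cost_def)
  qed
qed

end

section \<open>Comparing two tree paths by binary lifting\<close>

definition query_move :: com where
  "query_move =
     Cond (WLess (Cell ''mn'' (Plus (var ''i'') (var ''p''))) (var ''e''))
       (''e'' ::= Cell ''mn'' (Plus (var ''i'') (var ''p''))) Skip ;;
     Cond (WLess (Cell ''mn'' (Plus (var ''i'') (var ''q''))) (var ''f''))
       (''f'' ::= Cell ''mn'' (Plus (var ''i'') (var ''q''))) Skip ;;
     ''p'' ::= Cell ''up'' (Plus (var ''i'') (var ''p'')) ;;
     ''q'' ::= Cell ''up'' (Plus (var ''i'') (var ''q''))"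

definition query_step :: com where
  "query_step =
     ''j'' ::= Minus (var ''j'') (Const 1) ;;
     ''i'' ::= Minus (var ''i'') (var ''N'') ;;
     Cond (WNeq (Cell ''up'' (Plus (var ''i'') (var ''p''))) (Cell ''up'' (Plus (var ''i'') (var ''q''))))
       query_move Skip"

definition query_start :: com where
  "query_start =
     ''e'' ::= var ''N'' ;; ''f'' ::= var ''N'' ;;
     ''j'' ::= var ''K'' ;; ''i'' ::= Times (var ''K'') (var ''N'')"

definition query_finish :: com where
  "query_finish =
     Cond (WLess (var ''p'') (var ''e'')) (''e'' ::= var ''p'') Skip ;;
     Cond (WLess (var ''q'') (var ''f'')) (''f'' ::= var ''q'') Skip"

definition query :: com where
  "query = query_start ;; While (WLess (Const 0) (var ''j'')) query_step ;; query_finish"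

definition query_cost :: "nat \<Rightarrow> nat" where
  "query_cost K = ccost query_start + (K * (ccost query_step + 5) + 5 + ccost query_finish)"

lemma query_step_wp:
  assumes "words \<sigma> ''p'' 0 = p" "words \<sigma> ''q'' 0 = q" "words \<sigma> ''e'' 0 = e" "words \<sigma> ''f'' 0 = f"
    "words \<sigma> ''j'' 0 = Suc j" "words \<sigma> ''i'' 0 = i + N" "words \<sigma> ''N'' 0 = N"
    and "i + p < cap b" "i + q < cap b" "1 < cap b"
  shows "wp b query_step (\<lambda>\<sigma>'. words \<sigma>' ''j'' 0 = j \<and> words \<sigma>' ''i'' 0 = i \<and>
    (if words \<sigma> ''up'' (i + p) = words \<sigma> ''up'' (i + q)
     then words \<sigma>' ''p'' 0 = p \<and> words \<sigma>' ''q'' 0 = q \<and> words \<sigma>' ''e'' 0 = e \<and> words \<sigma>' ''f'' 0 = f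
     else words \<sigma>' ''p'' 0 = words \<sigma> ''up'' (i + p) \<and> words \<sigma>' ''q'' 0 = words \<sigma> ''up'' (i + q) \<and>
       words \<sigma>' ''e'' 0 = min (words \<sigma> ''mn'' (i + p)) e \<and>
       words \<sigma>' ''f'' 0 = min (words \<sigma> ''mn'' (i + q)) f)) \<sigma>"
  using assms unfolding query_step_def query_move_def by (simp add: min_def)

context sourced_graph
begin

lemma query:
  assumes F: "F \<subseteq> R" "\<forall>y\<in>F. set (sp y) \<subseteq> F" and p: "p0 \<in> F" and q: "q0 \<in> F" and d: "depth p0 = depth q0"
    and vars: "words \<sigma> ''p'' 0 = p0" "words \<sigma> ''q'' 0 = q0" "words \<sigma> ''N'' 0 = Suc n" "words \<sigma> ''K'' 0 = K"
    and jumps: "jumps K F (words \<sigma> ''up'') (words \<sigma> ''mn'')"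
    and cap: "Suc (Suc K) * Suc n < cap b" and K: "n < 2 ^ K"
  shows "runs b query \<sigma> (query_cost K) (\<lambda>\<sigma>'. words \<sigma>' ''e'' 0 < words \<sigma>' ''f'' 0 \<longleftrightarrow>
    set (sp p0) - set (sp q0) \<noteq> {} \<and> set (sp q0) - set (sp p0) \<noteq> {} \<and>
    Min (set (sp p0) - set (sp q0)) < Min (set (sp q0) - set (sp p0)))"
proof -
  let ?N = "Suc n"
  have n: "y < ?N" if "y \<in> R" for y using that reachable_subset by (auto simp: V_def)
  have R: "p0 \<in> R" "q0 \<in> R" using F p q by auto
  \<comment> \<open>\<open>t\<close> is the depth that the pair has reached; \<open>e\<close> and
    \<open>f\<close> hold the least vertices passed strictly below it.\<close>
  define I where "I k \<tau> \<longleftrightarrow> (\<exists>t. words \<tau> ''j'' 0 = k \<and> words \<tau> ''i'' 0 = k * ?N \<and> k \<le> K \<and>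
    words \<tau> ''N'' 0 = ?N \<and> words \<tau> ''up'' = words \<sigma> ''up'' \<and> words \<tau> ''mn'' = words \<sigma> ''mn'' \<and>
    diverge p0 q0 k t \<and> words \<tau> ''p'' 0 = sp p0 ! t \<and> words \<tau> ''q'' 0 = sp q0 ! t \<and>
    words \<tau> ''e'' 0 = least_after p0 t \<and> words \<tau> ''f'' 0 = least_after q0 t)" for k and \<tau> :: store
  let ?g = "WLess (Const 0) (var ''j'')"
  have start: "wp b query_start (I K) \<sigma>"
  proof -
    obtain D where D: "depth p0 = D" "depth q0 = D" using d by simp
    then have "diverge p0 q0 K D" "sp p0 ! D = p0" "sp q0 ! D = q0" "least_after p0 D = ?N" "least_after q0 D = ?N"
      using diverge_start[OF R d K] sp_nth_depth[OF R(1)] sp_nth_depth[OF R(2)]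
        least_after_depth[of p0] least_after_depth[of q0] by simp_all
    moreover have "K * ?N < cap b" using cap by simp
    ultimately show ?thesis
      using vars unfolding query_start_def I_def
      by (simp del: mult_Suc_right, intro exI[of _ D], simp del: mult_Suc_right)
  qed
  have step: "0 < k \<and> runs b query_step \<tau> (ccost query_step) (I (k - 1))" if I: "I k \<tau>" and g: "tval b ?g \<tau>" for k \<tau>
  proof -
    obtain t where t: "words \<tau> ''j'' 0 = k" "words \<tau> ''i'' 0 = k * ?N" "k \<le> K"
      "words \<tau> ''N'' 0 = ?N" "words \<tau> ''up'' = words \<sigma> ''up''" "words \<tau> ''mn'' = words \<sigma> ''mn''"
      "diverge p0 q0 k t" "words \<tau> ''p'' 0 = sp p0 ! t" "words \<tau> ''q'' 0 = sp q0 ! t"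
      "words \<tau> ''e'' 0 = least_after p0 t" "words \<tau> ''f'' 0 = least_after q0 t"
      using I unfolding I_def by blast
    obtain j where k: "k = Suc j" using g t(1) by (cases k) auto
    have jK: "j < K" using k t(3) by simp
    have tle: "t \<le> depth p0" using t(7) by (simp add: diverge_def)
    let ?p = "sp p0 ! t" and ?q = "sp q0 ! t"
    have at: "?p \<in> R" "sp ?p = take (Suc t) (sp p0)" "depth ?p = t" "?q \<in> R" "sp ?q = take (Suc t) (sp q0)" "depth ?q = t"
      using sp_prefix[OF R(1) tle] sp_prefix[OF R(2), of t] tle d by auto
    have "?p \<in> set (sp p0)" "?q \<in> set (sp q0)" using tle d length_sp R by simp_all
    then have "?p \<in> F" "?q \<in> F" using F(2) p q by auto
    then have ok: "jump_ok (words \<sigma> ''up'') (words \<sigma> ''mn'') j ?p" "jump_ok (words \<sigma> ''up'') (words \<sigma> ''mn'') j ?q"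
      using jumps jK by (auto simp: jumps_def)
    have up: "words \<sigma> ''up'' (j * ?N + ?p) = sp p0 ! (t - 2 ^ j)" "words \<sigma> ''up'' (j * ?N + ?q) = sp q0 ! (t - 2 ^ j)"
      using ok at by (simp_all add: jump_ok_def)
    have mn: "words \<sigma> ''mn'' (j * ?N + ?p) = Min ((!) (sp p0) ` {t - 2 ^ j<..t})"
      "words \<sigma> ''mn'' (j * ?N + ?q) = Min ((!) (sp q0) ` {t - 2 ^ j<..t})" if "2 ^ j \<le> t"
    proof -
      have "(!) (sp ?p) ` {t - 2 ^ j<..t} = (!) (sp p0) ` {t - 2 ^ j<..t}"
        "(!) (sp ?q) ` {t - 2 ^ j<..t} = (!) (sp q0) ` {t - 2 ^ j<..t}"
        unfolding at by (rule image_cong; simp)+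
      then show "words \<sigma> ''mn'' (j * ?N + ?p) = Min ((!) (sp p0) ` {t - 2 ^ j<..t})"
        "words \<sigma> ''mn'' (j * ?N + ?q) = Min ((!) (sp q0) ` {t - 2 ^ j<..t})"
        using ok at that by (simp_all add: jump_ok_def)
    qed
    have bound: "j * ?N + y < cap b" if "y \<in> R" for y
      using row_col_less[OF n[OF that] jK] cap by simp
    have div: "if sp p0 ! (t - 2 ^ j) = sp q0 ! (t - 2 ^ j) then diverge p0 q0 j t
      else 2 ^ j \<le> t \<and> diverge p0 q0 j (t - 2 ^ j)"
      by (rule diverge_step[OF R d]) (use t k in simp)
    let ?Q = "\<lambda>\<sigma>'. words \<sigma>' ''j'' 0 = j \<and> words \<sigma>' ''i'' 0 = j * ?N \<and>
      (if words \<tau> ''up'' (j * ?N + ?p) = words \<tau> ''up'' (j * ?N + ?q)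
       then words \<sigma>' ''p'' 0 = ?p \<and> words \<sigma>' ''q'' 0 = ?q \<and> words \<sigma>' ''e'' 0 = least_after p0 t \<and>
         words \<sigma>' ''f'' 0 = least_after q0 t
       else words \<sigma>' ''p'' 0 = words \<tau> ''up'' (j * ?N + ?p) \<and> words \<sigma>' ''q'' 0 = words \<tau> ''up'' (j * ?N + ?q) \<and>
         words \<sigma>' ''e'' 0 = min (words \<tau> ''mn'' (j * ?N + ?p)) (least_after p0 t) \<and>
         words \<sigma>' ''f'' 0 = min (words \<tau> ''mn'' (j * ?N + ?q)) (least_after q0 t))"
    have pre: "wp b query_step ?Q \<tau>"
      by (rule query_step_wp) (use t k bound at cap in auto)
    have "runs b query_step \<tau> (ccost query_step) (I j)"
    proof (rule runs_weaken[OF runs_frame[OF runs_wp[OF pre]] order_refl])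
      fix \<sigma>' assume *: "?Q \<sigma>' \<and> frame query_step \<tau> \<sigma>'"
      have same: "words \<sigma>' ''up'' = words \<tau> ''up''" "words \<sigma>' ''mn'' = words \<tau> ''mn''" "words \<sigma>' ''N'' = words \<tau> ''N''"
        by (simp_all add: frame_words[OF conjunct2[OF *]] query_step_def query_move_def)
      show "I j \<sigma>'"
      proof (cases "sp p0 ! (t - 2 ^ j) = sp q0 ! (t - 2 ^ j)")
        case True
        then show ?thesis using * same t div jK up unfolding I_def by (intro exI[of _ t]) simp
      next
        case False
        then have le: "2 ^ j \<le> t" and dv: "diverge p0 q0 j (t - 2 ^ j)" using div by simp_all
        have lt: "t - 2 ^ j < t"
        proof -
          obtain P where "(2::nat) ^ j = P" "0 < P" by simp
          then show ?thesis using le by simp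
        qed
        show ?thesis
          using * same t False dv jK up mn[OF le] min_least_after[OF lt] tle d unfolding I_def
          by (intro exI[of _ "t - 2 ^ j"]) simp
      qed
    qed
    then show ?thesis using k by simp
  qed
  have loop: "runs b (While ?g query_step) \<tau> (K * (ccost query_step + 5) + 5) (\<lambda>\<sigma>'. I 0 \<sigma>')" if "I K \<tau>" for \<tau>
  proof (rule runs_weaken[OF runs_While_count[where I = I, OF that step]])
    fix \<sigma>' assume *: "(\<exists>k'. I k' \<sigma>') \<and> \<not> tval b ?g \<sigma>'"
    then obtain k' where "I k' \<sigma>'" by blast
    moreover from this have "k' = 0" using * by (auto simp: I_def)
    ultimately show "I 0 \<sigma>'" by simp
  qed (simp_all add: algebra_simps)
  have finish: "runs b query_finish \<tau> (ccost query_finish) (\<lambda>\<sigma>'. words \<sigma>' ''e'' 0 < words \<sigma>' ''f'' 0 \<longleftrightarrow>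
    set (sp p0) - set (sp q0) \<noteq> {} \<and> set (sp q0) - set (sp p0) \<noteq> {} \<and>
    Min (set (sp p0) - set (sp q0)) < Min (set (sp q0) - set (sp p0)))" if "I 0 \<tau>" for \<tau>
  proof -
    obtain t where t: "diverge p0 q0 0 t" "words \<tau> ''p'' 0 = sp p0 ! t" "words \<tau> ''q'' 0 = sp q0 ! t"
      "words \<tau> ''e'' 0 = least_after p0 t" "words \<tau> ''f'' 0 = least_after q0 t"
      using \<open>I 0 \<tau>\<close> unfolding I_def by blast
    have "wp b query_finish (\<lambda>\<sigma>'. words \<sigma>' ''e'' 0 = min (words \<tau> ''p'' 0) (words \<tau> ''e'' 0) \<and>
      words \<sigma>' ''f'' 0 = min (words \<tau> ''q'' 0) (words \<tau> ''f'' 0)) \<tau>"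
      by (simp add: query_finish_def min_def)
    then have "wp b query_finish (\<lambda>\<sigma>'. words \<sigma>' ''e'' 0 < words \<sigma>' ''f'' 0 \<longleftrightarrow>
      min (sp p0 ! t) (least_after p0 t) < min (sp q0 ! t) (least_after q0 t)) \<tau>"
      using t by (elim wp_mono) simp
    then show ?thesis unfolding diverge_compare[OF R d t(1)] by (rule runs_wp)
  qed
  show ?thesis unfolding query_def query_cost_def
    by (rule runs_Seq[OF runs_wp[OF start]], rule runs_Seq[OF loop finish])
qed

end

section \<open>Adjacency lists and relaxation\<close>

text \<open>A linked list with successor array \<open>nx\<close> and null pointer 0; the list
  argument exists only in the proof.\<close>

primrec chain :: "(nat \<Rightarrow> nat) \<Rightarrow> nat \<Rightarrow> nat list \<Rightarrow> bool" where
  "chain nx a [] \<longleftrightarrow> a = 0"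
| "chain nx a (c # l) \<longleftrightarrow> a = c \<and> c \<noteq> 0 \<and> chain nx (nx c) l"

lemma chain_cong: "(\<And>a. a \<in> set l \<Longrightarrow> nx' a = nx a) \<Longrightarrow> chain nx' a l = chain nx a l"
  by (induction l arbitrary: a) auto

lemma edge_list_card:
  assumes "edge_list E es"
  shows "card E = length es"
proof -
  have "card (set (map (\<lambda>(u, v). {u, v}) es)) = length es"
    using assms by (subst distinct_card) (simp_all add: edge_list_def)
  then show ?thesis using assms by (simp add: edge_list_def)
qed

locale input_graph = sourced_graph +
  fixes es :: "(nat \<times> nat) list" and b :: nat
  assumes edges: "edge_list E es" and size: "(n + length es + 2) ^ 4 \<le> 2 ^ b"
begin

abbreviation m :: nat where "m \<equiv> length es"

text \<open>The number of binary digits of \<open>n\<close>: enough for jumps to span every depth,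
  and small enough for the logarithmic time bound.\<close>

definition levels :: nat where
  "levels = (LEAST k. n < 2 ^ k)"

lemma n_less_levels: "n < 2 ^ levels"
  unfolding levels_def by (rule LeastI[of _ n]) simp

lemma n_pos: "0 < n"
  using source by simp

lemma less_levels: "k < levels \<Longrightarrow> 2 ^ k \<le> n"
  unfolding levels_def using not_less_Least not_less by blast

lemma levels_pos: "0 < levels"
  using n_less_levels n_pos by (cases levels) auto

lemma levels_le: "2 ^ (levels - 1) \<le> n" "levels \<le> Suc n"
proof -
  show le: "2 ^ (levels - 1) \<le> n" using less_levels levels_pos by simp
  have "levels - 1 < 2 ^ (levels - 1)" by simp
  then show "levels \<le> Suc n" using le by linarith
qed

text \<open>The crude estimate \<open>levels \<le> Suc n\<close> makes the jump tables quadratic in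
  size; a quadratic bound with factor 9 fits under the fourth power because the base is at least
  3.\<close>

lemma cap_bounds: "Suc (Suc levels) * Suc n < cap b" "4 * n + 4 < cap b" "2 * m + 4 < cap b" "n < cap b" "3 < cap b"
proof -
  let ?k = "n + m + 2"
  have 3: "3 \<le> ?k" using n_pos by simp
  have "9 * k ^ 2 \<le> k ^ 4" if "3 \<le> k" for k :: nat
    using mult_le_mono1[OF power_mono[OF that, of 2], of "k ^ 2"] by (simp flip: power_add)
  from this[OF 3] have "9 * ?k ^ 2 \<le> ?k ^ 4" .
  then have c: "9 * ?k ^ 2 \<le> cap b" using size by (simp add: cap_def)
  have "Suc (Suc levels) * Suc n \<le> (n + 3) * (n + 1)"
    by (rule mult_le_mono) (use levels_le in auto)
  also have "\<dots> < 9 * ?k ^ 2" by (simp add: power2_eq_square algebra_simps)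
  finally show "Suc (Suc levels) * Suc n < cap b" using c by simp
  have "9 * ?k \<le> 9 * ?k ^ 2" by (simp add: power2_eq_square)
  then have "9 * ?k \<le> cap b" using c by simp
  then show "4 * n + 4 < cap b" "2 * m + 4 < cap b" "n < cap b" "3 < cap b" by auto
qed

text \<open>Edge \<open>i\<close> of the list yields the arcs \<open>2 * i + 2\<close> and \<open>2 * i + 3\<close>, so that \<open>0\<close> can end a list of arcs.\<close>

primrec arcs :: "nat \<Rightarrow> nat \<Rightarrow> nat list" where
  "arcs 0 x = []"
| "arcs (Suc i) x = (if x = snd (es ! i) then [2 * i + 3] else []) @
     (if x = fst (es ! i) then [2 * i + 2] else []) @ arcs i x"

definition target :: "nat \<Rightarrow> nat" where
  "target a = (if even a then snd (es ! (a div 2 - 1)) else fst (es ! (a div 2 - 1)))"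

lemma target_simps: "target (2 * i + 2) = snd (es ! i)" "target (2 * i + 3) = fst (es ! i)"
proof -
  have "(2 * i + 2) div 2 - 1 = i" "(2 * i + 3) div 2 - 1 = i" by linarith+
  moreover have "even (2 * i + 2)" "odd (2 * i + 3)" by simp_all
  ultimately show "target (2 * i + 2) = snd (es ! i)" "target (2 * i + 3) = fst (es ! i)"
    unfolding target_def by (simp_all only: if_True if_False)
qed

lemma set_arcs: "a \<in> set (arcs i x) \<longleftrightarrow>
    (\<exists>e<i. a = 2 * e + 2 \<and> x = fst (es ! e) \<or> a = 2 * e + 3 \<and> x = snd (es ! e))"
proof (induction i)
  case (Suc i)
  have single: "a \<in> set (if P then [c] else []) \<longleftrightarrow> P \<and> a = c" for P and c :: nat by auto
  have "a \<in> set (arcs (Suc i) x) \<longleftrightarrow> a = 2 * i + 3 \<and> x = snd (es ! i) \<or> a = 2 * i + 2 \<and> x = fst (es ! i) \<or> a \<in> set (arcs i x)"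
    unfolding arcs.simps set_append Un_iff
    unfolding single by blast
  then show ?case unfolding Suc.IH less_Suc_eq by blast
qed simp

lemma edge_nth: "e < m \<Longrightarrow> {fst (es ! e), snd (es ! e)} \<in> E"
  using edges unfolding edge_list_def by (force simp: case_prod_unfold)

text \<open>\<open>a div 2 - 1\<close> undoes the numbering for both arcs of an edge, so the program
  finds the weight without a second table.\<close>

lemma arcsD:
  assumes "a \<in> set (arcs m x)"
  shows "{x, target a} \<in> E" "{fst (es ! (a div 2 - 1)), snd (es ! (a div 2 - 1))} = {x, target a}"
    "2 \<le> a" "a < 2 * m + 2" "a div 2 - 1 < m"
proof -
  obtain e where e: "e < m" "a = 2 * e + 2 \<and> x = fst (es ! e) \<or> a = 2 * e + 3 \<and> x = snd (es ! e)"
    using assms unfolding set_arcs by blast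
  have idx: "a div 2 - 1 = e" using e by auto
  show "{fst (es ! (a div 2 - 1)), snd (es ! (a div 2 - 1))} = {x, target a}"
    unfolding idx using e(2) target_simps[of e] by (auto simp: insert_commute)
  then show "{x, target a} \<in> E" using edge_nth[OF e(1)] idx by simp
  show "2 \<le> a" "a < 2 * m + 2" "a div 2 - 1 < m" using e idx by auto
qed

lemma arcs_complete:
  assumes "{x, y} \<in> E"
  obtains a where "a \<in> set (arcs m x)" "target a = y"
proof -
  obtain e where e: "e < m" "{fst (es ! e), snd (es ! e)} = {x, y}"
    using assms edges unfolding edge_list_def by (force simp: case_prod_unfold in_set_conv_nth)
  then have "fst (es ! e) = x \<and> snd (es ! e) = y \<or> fst (es ! e) = y \<and> snd (es ! e) = x"
    by (auto simp: doubleton_eq_iff)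
  then show ?thesis
  proof
    assume "fst (es ! e) = x \<and> snd (es ! e) = y"
    then show ?thesis using that[of "2 * e + 2"] e(1) target_simps(1)[of e] set_arcs by blast
  next
    assume "fst (es ! e) = y \<and> snd (es ! e) = x"
    then show ?thesis using that[of "2 * e + 3"] e(1) target_simps(2)[of e] set_arcs by blast
  qed
qed

lemma edge_ends: "e < m \<Longrightarrow> fst (es ! e) \<in> V \<and> snd (es ! e) \<in> V \<and> fst (es ! e) \<noteq> snd (es ! e)"
  using edgeD[OF edge_nth] by simp

text \<open>Handshake counting: the two ends of an edge differ, and each receives one arc.\<close>

lemma sum_length_arcs: "i \<le> m \<Longrightarrow> (\<Sum>x\<in>V. length (arcs i x)) = 2 * i"
proof (induction i)
  case (Suc i)
  have "length (arcs (Suc i) x) = length (arcs i x) + ((if x = fst (es ! i) then 1 else 0) + (if x = snd (es ! i) then 1 else 0))" for x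
    by simp
  then show ?case using Suc edge_ends[of i] by (simp add: sum.distrib del: arcs.simps)
qed simp

section \<open>The invariant linking memory to the state of the search\<close>

definition static :: "store \<Rightarrow> bool" where
  "static \<sigma> \<longleftrightarrow> words \<sigma> ''N'' 0 = Suc n \<and> words \<sigma> ''K'' 0 = levels \<and> words \<sigma> ''s'' 0 = s \<and>
     (\<forall>x\<in>V. chain (words \<sigma> ''next'') (words \<sigma> ''head'' x) (arcs m x)) \<and>
     (\<forall>a. 2 \<le> a \<longrightarrow> a < 2 * m + 2 \<longrightarrow> words \<sigma> ''to'' a = target a) \<and>
     (\<forall>e<m. reals \<sigma> ''w'' e = w {fst (es ! e), snd (es ! e)})"

abbreviation dist_of :: "store \<Rightarrow> nat \<Rightarrow> real" where "dist_of \<sigma> \<equiv> \<lambda>v. reals \<sigma> ''td'' (Suc n + v)"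
abbreviation hops :: "store \<Rightarrow> nat \<Rightarrow> nat" where "hops \<sigma> \<equiv> \<lambda>v. words \<sigma> ''th'' (Suc n + v)"
abbreviation active :: "store \<Rightarrow> nat \<Rightarrow> nat" where "active \<sigma> \<equiv> \<lambda>v. words \<sigma> ''tv'' (Suc n + v)"
abbreviation parent :: "store \<Rightarrow> nat \<Rightarrow> nat" where "parent \<sigma> \<equiv> words \<sigma> ''parent''"

text \<open>Vertex \<open>v\<close> owns leaf \<open>Suc n + v\<close>. The first leaf belongs to
  the index 0, which is no vertex, and is kept empty so that an active leaf always belongs to a
  vertex.\<close>

definition core :: "nat set \<Rightarrow> (nat \<times> nat) set \<Rightarrow> store \<Rightarrow> bool" where
  "core F A \<sigma> \<longleftrightarrow> static \<sigma> \<and> search F A (dist_of \<sigma>) (hops \<sigma>) (parent \<sigma>) (active \<sigma>) \<and>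
     active \<sigma> 0 = 0 \<and> tournament (Suc n) (entry \<sigma>) \<and>
     (\<forall>v\<in>V. words \<sigma> ''fin'' v \<noteq> 0 \<longleftrightarrow> v \<in> F) \<and>
     jumps levels F (words \<sigma> ''up'') (words \<sigma> ''mn'')"

definition static_words :: "string set" where
  "static_words = {''N'', ''K'', ''s'', ''next'', ''head'', ''to''}"

definition core_words :: "string set" where
  "core_words = static_words \<union> {''tv'', ''th'', ''parent'', ''fin'', ''up'', ''mn''}"

lemma static_cong:
  assumes "static \<sigma>" "\<forall>a\<in>static_words. words \<sigma>' a = words \<sigma> a" "reals \<sigma>' ''w'' = reals \<sigma> ''w''"
  shows "static \<sigma>'"
  using assms unfolding static_def static_words_def by simp

lemma core_cong:
  assumes "core F A \<sigma>" "\<forall>a\<in>core_words. words \<sigma>' a = words \<sigma> a"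
    "reals \<sigma>' ''w'' = reals \<sigma> ''w''" "reals \<sigma>' ''td'' = reals \<sigma> ''td''"
  shows "core F A \<sigma>'"
proof -
  have eqs: "words \<sigma>' ''tv'' = words \<sigma> ''tv''" "words \<sigma>' ''th'' = words \<sigma> ''th''" "parent \<sigma>' = parent \<sigma>"
    "words \<sigma>' ''fin'' = words \<sigma> ''fin''" "words \<sigma>' ''up'' = words \<sigma> ''up''" "words \<sigma>' ''mn'' = words \<sigma> ''mn''"
    using assms(2) by (simp_all add: core_words_def)
  have "entry \<sigma>' = entry \<sigma>" using eqs assms(4) by (simp add: entry_def fun_eq_iff)
  moreover have "static \<sigma>'"
    by (rule static_cong[of \<sigma>]) (use assms in \<open>simp_all add: core_def core_words_def\<close>)
  ultimately show ?thesis using assms(1,4) eqs unfolding core_def by simp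
qed

text \<open>A leaf occurs in the condition of one inner node only, its parent.\<close>

lemma entry_update:
  assumes "tournament (Suc n) (entry \<sigma>)"
    and "\<And>i. i \<noteq> Suc n + v \<Longrightarrow> words \<sigma>' ''tv'' i = words \<sigma> ''tv'' i \<and>
      reals \<sigma>' ''td'' i = reals \<sigma> ''td'' i \<and> words \<sigma>' ''th'' i = words \<sigma> ''th'' i"
  shows "\<forall>i\<in>{1..<Suc n}. i \<noteq> (Suc n + v) div 2 \<longrightarrow> winner (entry \<sigma>') i"
proof (intro ballI impI)
  fix i assume i: "i \<in> {1..<Suc n}" "i \<noteq> (Suc n + v) div 2"
  have "i \<noteq> Suc n + v" "2 * i \<noteq> Suc n + v" "2 * i + 1 \<noteq> Suc n + v" using i by auto
  then have "entry \<sigma>' j = entry \<sigma> j" if "j \<in> {i, 2 * i, 2 * i + 1}" for j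
    using assms(2)[of j] that by (auto simp: entry_def)
  then show "winner (entry \<sigma>') i" using assms(1) i by (simp add: tournament_def winner_def)
qed

lemma repair_leaf:
  assumes "tournament (Suc n) (entry \<sigma>)" "v \<in> V" "words \<sigma>' ''c'' 0 = (Suc n + v) div 2"
    and "\<And>i. i \<noteq> Suc n + v \<Longrightarrow> words \<sigma>' ''tv'' i = words \<sigma> ''tv'' i \<and>
      reals \<sigma>' ''td'' i = reals \<sigma> ''td'' i \<and> words \<sigma>' ''th'' i = words \<sigma> ''th'' i"
  shows "runs b repair \<sigma>' (repair_cost levels) (\<lambda>\<tau>. (tournament (Suc n) (entry \<tau>) \<and> same_above (Suc n) \<sigma>' \<tau>) \<and> frame repair \<sigma>' \<tau>)"
proof (rule runs_frame, rule repair)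
  show lt: "words \<sigma>' ''c'' 0 < Suc n" using assms by (auto simp: V_def)
  show "words \<sigma>' ''c'' 0 < 2 ^ levels" using lt n_less_levels by linarith
  show "2 * Suc n \<le> cap b" using cap_bounds by simp
  show "\<forall>i\<in>{1..<Suc n}. i \<noteq> words \<sigma>' ''c'' 0 \<longrightarrow> winner (entry \<sigma>') i"
    unfolding assms(3) using entry_update[OF assms(1,4)] by blast
qed

end

section \<open>Relaxation of one arc\<close>

definition relax_start :: com where
  "relax_start =
     ''y'' ::= Cell ''to'' (var ''a'') ;;
     RStore ''nd'' (Const 0) (RPlus (RCell ''td'' (Plus (var ''N'') (var ''x'')))
       (RCell ''w'' (Minus (Div (var ''a'') (Const 2)) (Const 1)))) ;;
     ''nh'' ::= Plus (Cell ''th'' (Plus (var ''N'') (var ''x''))) (Const 1)"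

abbreviation leaf_y :: wexp where "leaf_y \<equiv> Plus (var ''N'') (var ''y'')"

definition relax_set :: com where
  "relax_set =
     Store ''tv'' leaf_y (var ''y'') ;;
     RStore ''td'' leaf_y (RCell ''nd'' (Const 0)) ;;
     Store ''th'' leaf_y (var ''nh'') ;;
     Store ''parent'' (var ''y'') (var ''x'') ;;
     ''c'' ::= Div leaf_y (Const 2)"

definition relax_closer :: test where
  "relax_closer = TOr (TNot (WLess (Const 0) (Cell ''tv'' leaf_y)))
     (TOr (RLess (RCell ''nd'' (Const 0)) (RCell ''td'' leaf_y))
       (TAnd (TNot (RLess (RCell ''td'' leaf_y) (RCell ''nd'' (Const 0))))
         (WLess (var ''nh'') (Cell ''th'' leaf_y))))"

text \<open>Evaluated only after \<open>relax_closer\<close> has failed, when excluding a worse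
  weight and a worse edge count leaves equality in both.\<close>

definition relax_tied :: test where
  "relax_tied = TAnd (TNot (RLess (RCell ''td'' leaf_y) (RCell ''nd'' (Const 0))))
     (TNot (WLess (Cell ''th'' leaf_y) (var ''nh'')))"

definition relax_tie_start :: com where
  "relax_tie_start = ''p'' ::= var ''x'' ;; ''q'' ::= Cell ''parent'' (var ''y'')"

definition relax_tie_finish :: com where
  "relax_tie_finish = Cond (WLess (var ''e'') (var ''f'')) (Store ''parent'' (var ''y'') (var ''x'')) Skip"

definition relax_offer :: com where
  "relax_offer =
     Cond (WLess (Const 0) (Cell ''fin'' (var ''y''))) Skip
       (Cond relax_closer (relax_set ;; repair)
         (Cond relax_tied (relax_tie_start ;; query ;; relax_tie_finish) Skip))"

definition relax :: com where
  "relax = relax_start ;; relax_offer ;; ''a'' ::= Cell ''next'' (var ''a'')"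

definition relax_cost :: "nat \<Rightarrow> nat" where
  "relax_cost K = ccost relax_start + tcost relax_closer + tcost relax_tied + ccost relax_set + ccost relax_tie_start +
     ccost relax_tie_finish + repair_cost K + query_cost K + 30"

context input_graph
begin

text \<open>The tournament depends on keys alone, so only a first offer or one with a strictly
  smaller key needs a repair. A tie costs a query and changes at most the parent; a worse key
  changes nothing.\<close>

lemma relax_offer:
  assumes core: "core F A \<sigma>" and x: "words \<sigma> ''x'' 0 = x" "x \<in> F" and xy: "{x, y} \<in> E"
    and vars: "words \<sigma> ''y'' 0 = y" "reals \<sigma> ''nd'' 0 = dist_of \<sigma> x + w {x, y}" "words \<sigma> ''nh'' 0 = Suc (hops \<sigma> x)"
  shows "runs b relax_offer \<sigma> (relax_cost levels - ccost relax_start - 10) (core F (insert (x, y) A))"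
proof -
  \<comment> \<open>\<open>?T\<close> bounds every branch, since the rule for conditionals expects
    the same time for both arms.\<close>
  let ?N = "Suc n" and ?T = "ccost relax_set + ccost relax_tie_start + ccost relax_tie_finish + repair_cost levels + query_cost levels + 1"
  have st: "static \<sigma>" and inv: "search F A (dist_of \<sigma>) (hops \<sigma>) (parent \<sigma>) (active \<sigma>)"
    and tour: "tournament ?N (entry \<sigma>)" and act0: "active \<sigma> 0 = 0"
    and fin: "\<forall>v\<in>V. words \<sigma> ''fin'' v \<noteq> 0 \<longleftrightarrow> v \<in> F" and jumps: "jumps levels F (words \<sigma> ''up'') (words \<sigma> ''mn'')"
    using core by (auto simp: core_def)
  have NK: "words \<sigma> ''N'' 0 = ?N" "words \<sigma> ''K'' 0 = levels" using st by (simp_all add: static_def)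
  have yV: "y \<in> V" using edgeD xy by blast
  then have y: "0 < y" "y \<le> n" by (auto simp: V_def)
  have leaf: "wval b leaf_y \<sigma> = ?N + y" using cap_bounds y NK vars by simp
  have F: "F \<subseteq> R" "\<forall>x\<in>F. set (sp x) \<subseteq> F" using inv by (auto simp: search_def)
  have skip: "runs b Skip \<tau> ?T Q" if "Q \<tau>" for \<tau> Q
    by (rule runs_weaken[OF runs_wp]) (use that in auto)
  have finT: "tval b (WLess (Const 0) (Cell ''fin'' (var ''y''))) \<sigma> \<longleftrightarrow> y \<in> F"
    using fin yV vars by auto
  have closerT: "tval b relax_closer \<sigma> \<longleftrightarrow> active \<sigma> y = 0 \<or> dist_of \<sigma> x + w {x, y} < dist_of \<sigma> y \<or>
    dist_of \<sigma> x + w {x, y} = dist_of \<sigma> y \<and> Suc (hops \<sigma> x) < hops \<sigma> y"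
    using leaf vars unfolding relax_closer_def by auto
  have tiedT: "tval b relax_tied \<sigma> \<longleftrightarrow> \<not> dist_of \<sigma> y < dist_of \<sigma> x + w {x, y} \<and> \<not> hops \<sigma> y < Suc (hops \<sigma> x)"
    using leaf vars unfolding relax_tied_def by auto
  have settled_y: "core F (insert (x, y) A) \<sigma>" if "y \<in> F"
    using core search_offer_settled[OF inv x(2) xy that] by (simp add: core_def)
  have closer: "runs b (relax_set ;; repair) \<sigma> (ccost relax_set + repair_cost levels) (core F (insert (x, y) A))"
    if yF: "y \<notin> F" and closer: "tval b relax_closer \<sigma>"
  proof -
    have "lex_shorter w (offer x y) (offer (parent \<sigma> y) y)" if "active \<sigma> y \<noteq> 0"
      unfolding offer_lex_shorter_iff[OF inv x(2) xy yF that] using closer that unfolding closerT by auto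
    note better = search_offer_better[OF inv x(2) xy yF this]
    let ?S = "\<lambda>\<sigma>'. words \<sigma>' ''tv'' = (words \<sigma> ''tv'')(?N + y := y) \<and>
      reals \<sigma>' ''td'' = (reals \<sigma> ''td'')(?N + y := dist_of \<sigma> x + w {x, y}) \<and>
      words \<sigma>' ''th'' = (words \<sigma> ''th'')(?N + y := Suc (hops \<sigma> x)) \<and>
      words \<sigma>' ''parent'' = (words \<sigma> ''parent'')(y := x) \<and> words \<sigma>' ''c'' 0 = (?N + y) div 2"
    have set: "wp b relax_set ?S \<sigma>"
      using cap_bounds y NK vars x unfolding relax_set_def by simp
    show ?thesis
    proof (rule runs_Seq[OF runs_frame[OF runs_wp[OF set]]])
      fix \<sigma>1 assume *: "?S \<sigma>1 \<and> frame relax_set \<sigma> \<sigma>1"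
      then have S: "?S \<sigma>1" by blast
      note frame1 = frame_words[OF conjunct2[OF *]] frame_reals[OF conjunct2[OF *]]
      show "runs b repair \<sigma>1 (repair_cost levels) (core F (insert (x, y) A))"
      proof (rule runs_weaken[OF repair_leaf[OF tour yV]])
        show "words \<sigma>1 ''c'' 0 = (?N + y) div 2" using S by blast
        show "words \<sigma>1 ''tv'' i = words \<sigma> ''tv'' i \<and> reals \<sigma>1 ''td'' i = reals \<sigma> ''td'' i \<and>
          words \<sigma>1 ''th'' i = words \<sigma> ''th'' i" if "i \<noteq> ?N + y" for i using S that by simp
        fix \<tau> assume t: "(tournament ?N (entry \<tau>) \<and> same_above ?N \<sigma>1 \<tau>) \<and> frame repair \<sigma>1 \<tau>"
        note frame2 = frame_words[OF conjunct2[OF t]] frame_reals[OF conjunct2[OF t]]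
        note frames = frame1 frame2 relax_set_def repair_def repair_step_def
        have same: "\<forall>a\<in>static_words. words \<tau> a = words \<sigma> a" "words \<tau> ''fin'' = words \<sigma> ''fin''"
          "words \<tau> ''up'' = words \<sigma> ''up''" "words \<tau> ''mn'' = words \<sigma> ''mn''"
          by (simp_all add: static_words_def frames)
        have "reals \<tau> ''w'' = reals \<sigma> ''w''"
          by (simp add: frames)
        then have "static \<tau>" by (rule static_cong[OF st same(1)])
        have "parent \<tau> = parent \<sigma>1" by (simp add: frame2 repair_def repair_step_def)
        moreover have "dist_of \<tau> v = dist_of \<sigma>1 v" "hops \<tau> v = hops \<sigma>1 v" "active \<tau> v = active \<sigma>1 v" for v
          using t by (simp_all add: same_above_def)
        ultimately have upd: "dist_of \<tau> = (dist_of \<sigma>)(y := dist_of \<sigma> x + w {x, y})" "hops \<tau> = (hops \<sigma>)(y := Suc (hops \<sigma> x))"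
          "active \<tau> = (active \<sigma>)(y := y)" "parent \<tau> = (parent \<sigma>)(y := x)"
          using S by (auto simp: fun_eq_iff)
        have "active \<tau> 0 = 0" using fun_cong[OF upd(3), of 0] y act0 by simp
        moreover have "search F (insert (x, y) A) (dist_of \<tau>) (hops \<tau>) (parent \<tau>) (active \<tau>)"
          unfolding upd by (rule better)
        ultimately show "core F (insert (x, y) A) \<tau>"
          unfolding core_def using \<open>static \<tau>\<close> t fin jumps same by simp
      qed simp
    qed
  qed
  have tie: "runs b (relax_tie_start ;; query ;; relax_tie_finish) \<sigma>
      (ccost relax_tie_start + (query_cost levels + ccost relax_tie_finish)) (core F (insert (x, y) A))"
    if yF: "y \<notin> F" and "\<not> tval b relax_closer \<sigma>" "tval b relax_tied \<sigma>"
  proof -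
    have act: "active \<sigma> y \<noteq> 0" and eq: "dist_of \<sigma> x + w {x, y} = dist_of \<sigma> y" "Suc (hops \<sigma> x) = hops \<sigma> y"
      using that unfolding closerT tiedT by auto
    have yVF: "y \<in> V - F" using yV yF by blast
    note a = search_active[OF inv yVF act]
    let ?q = "parent \<sigma> y"
    \<comment> \<open>Equal edge counts of the two offers force equal depth of the settled vertices
      that made them, as the query requires.\<close>
    have "depth x = hops \<sigma> x" using inv x by (simp add: search_def settled_def)
    moreover have "hops \<sigma> y = Suc (depth ?q)" using a F offer_num_edges by auto
    ultimately have depth: "depth x = depth ?q" using eq by simp
    have cond: "lex_shorter w (offer x y) (offer ?q y) \<longleftrightarrow>
      set (sp x) - set (sp ?q) \<noteq> {} \<and> set (sp ?q) - set (sp x) \<noteq> {} \<and>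
      Min (set (sp x) - set (sp ?q)) < Min (set (sp ?q) - set (sp x))"
      unfolding offer_lex_shorter_iff[OF inv x(2) xy yF act] using eq by simp
    let ?S = "\<lambda>\<sigma>'. words \<sigma>' ''p'' 0 = x \<and> words \<sigma>' ''q'' 0 = ?q"
    have start: "wp b relax_tie_start ?S \<sigma>"
      using x vars unfolding relax_tie_start_def by simp
    show ?thesis
    proof (rule runs_Seq[OF runs_frame[OF runs_wp[OF start]]])
      fix \<sigma>1 assume *: "?S \<sigma>1 \<and> frame relax_tie_start \<sigma> \<sigma>1"
      note frame1 = frame_words[OF conjunct2[OF *]] frame_reals[OF conjunct2[OF *]]
      have q: "runs b query \<sigma>1 (query_cost levels) (\<lambda>\<sigma>'. words \<sigma>' ''e'' 0 < words \<sigma>' ''f'' 0 \<longleftrightarrow>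
        lex_shorter w (offer x y) (offer ?q y))"
        unfolding cond using * NK jumps
        by (intro query[OF F x(2) a(2) depth])
          (simp_all add: frame1 relax_tie_start_def cap_bounds n_less_levels del: mult_Suc mult_Suc_right)
      show "runs b (query ;; relax_tie_finish) \<sigma>1 (query_cost levels + ccost relax_tie_finish) (core F (insert (x, y) A))"
      proof (rule runs_Seq[OF runs_frame[OF q]])
        fix \<sigma>2 assume **: "(words \<sigma>2 ''e'' 0 < words \<sigma>2 ''f'' 0 \<longleftrightarrow> lex_shorter w (offer x y) (offer ?q y)) \<and> frame query \<sigma>1 \<sigma>2"
        note frame2 = frame_words[OF conjunct2[OF **]] frame_reals[OF conjunct2[OF **]]
        note frames = frame1 frame2 relax_tie_start_def query_def query_start_def query_step_def query_move_def query_finish_def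
        have same: "\<forall>a\<in>core_words. words \<sigma>2 a = words \<sigma> a" "words \<sigma>2 ''x'' = words \<sigma> ''x''" "words \<sigma>2 ''y'' = words \<sigma> ''y''"
          by (simp_all add: core_words_def static_words_def frames)
        have samer: "reals \<sigma>2 = reals \<sigma>" by (rule ext) (simp add: frames)
        have core2: "core F A \<sigma>2" by (rule core_cong[OF core same(1)]) (simp_all add: samer)
        have samew: "words \<sigma>2 ''tv'' = words \<sigma> ''tv''" "words \<sigma>2 ''th'' = words \<sigma> ''th''" "parent \<sigma>2 = parent \<sigma>"
          using same(1) by (simp_all add: core_words_def)
        show "runs b relax_tie_finish \<sigma>2 (ccost relax_tie_finish) (core F (insert (x, y) A))"
        proof (rule runs_wp, cases "lex_shorter w (offer x y) (offer ?q y)")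
          case True
          let ?\<tau> = "set_word ''parent'' y x \<sigma>2"
          \<comment> \<open>In a tie the general update of the search state is the identity except
            on the parent.\<close>
          have triv: "(dist_of \<sigma>)(y := dist_of \<sigma> x + w {x, y}) = dist_of \<sigma>" "(hops \<sigma>)(y := Suc (hops \<sigma> x)) = hops \<sigma>"
            "(active \<sigma>)(y := y) = active \<sigma>"
            by (intro fun_upd_idem; use eq a(1) in simp)+
          have "search F (insert (x, y) A) (dist_of \<sigma>) (hops \<sigma>) ((parent \<sigma>)(y := x)) (active \<sigma>)"
            using search_offer_better[OF inv x(2) xy yF True] unfolding triv .
          moreover have "entry ?\<tau> = entry \<sigma>2" by (simp add: entry_def fun_eq_iff)
          moreover have "static ?\<tau>"
            by (rule static_cong[of \<sigma>2]) (use core2 in \<open>simp_all add: core_def static_words_def\<close>)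
          ultimately have "core F (insert (x, y) A) ?\<tau>"
            using core2 samew samer by (simp add: core_def)
          then show "wp b relax_tie_finish (core F (insert (x, y) A)) \<sigma>2"
            using True ** same x vars by (simp add: relax_tie_finish_def)
        next
          case False
          then have "core F (insert (x, y) A) \<sigma>2"
            using core2 search_offer_worse[OF inv x(2) xy yF act False] samew samer by (simp add: core_def)
          then show "wp b relax_tie_finish (core F (insert (x, y) A)) \<sigma>2"
            using False ** by (simp add: relax_tie_finish_def)
        qed
      qed
    qed
  qed
  have worse: "core F (insert (x, y) A) \<sigma>" if "y \<notin> F" "\<not> tval b relax_closer \<sigma>" "\<not> tval b relax_tied \<sigma>"
  proof -
    have act: "active \<sigma> y \<noteq> 0" using that unfolding closerT by auto
    have "\<not> lex_shorter w (offer x y) (offer (parent \<sigma> y) y)"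
      unfolding offer_lex_shorter_iff[OF inv x(2) xy that(1) act] using that unfolding closerT tiedT by auto
    then show ?thesis using core search_offer_worse[OF inv x(2) xy that(1) act] by (simp add: core_def)
  qed
  have "runs b relax_offer \<sigma> (1 + tcost (WLess (Const 0) (Cell ''fin'' (var ''y''))) +
      (1 + tcost relax_closer + (1 + tcost relax_tied + ?T))) (core F (insert (x, y) A))"
    unfolding relax_offer_def
  proof (rule runs_Cond)
    assume "tval b (WLess (Const 0) (Cell ''fin'' (var ''y''))) \<sigma>"
    then have "runs b Skip \<sigma> ?T (core F (insert (x, y) A))" unfolding finT by (intro skip settled_y)
    then show "runs b Skip \<sigma> (1 + tcost relax_closer + (1 + tcost relax_tied + ?T)) (core F (insert (x, y) A))"
      by (rule runs_weaken) simp_all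
  next
    assume "\<not> tval b (WLess (Const 0) (Cell ''fin'' (var ''y''))) \<sigma>"
    then have yF: "y \<notin> F" unfolding finT .
    show "runs b (Cond relax_closer (relax_set ;; repair)
        (Cond relax_tied (relax_tie_start ;; query ;; relax_tie_finish) Skip)) \<sigma>
      (1 + tcost relax_closer + (1 + tcost relax_tied + ?T)) (core F (insert (x, y) A))"
    proof (rule runs_Cond)
      assume "tval b relax_closer \<sigma>"
      from closer[OF yF this]
      show "runs b (relax_set ;; repair) \<sigma> (1 + tcost relax_tied + ?T) (core F (insert (x, y) A))"
        by (rule runs_weaken) simp_all
    next
      assume nc: "\<not> tval b relax_closer \<sigma>"
      show "runs b (Cond relax_tied (relax_tie_start ;; query ;; relax_tie_finish) Skip) \<sigma>
        (1 + tcost relax_tied + ?T) (core F (insert (x, y) A))"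
      proof (rule runs_Cond)
        assume "tval b relax_tied \<sigma>"
        from tie[OF yF nc this]
        show "runs b (relax_tie_start ;; query ;; relax_tie_finish) \<sigma> ?T (core F (insert (x, y) A))"
          by (rule runs_weaken) simp_all
      next
        assume "\<not> tval b relax_tied \<sigma>"
        then show "runs b Skip \<sigma> ?T (core F (insert (x, y) A))" using worse[OF yF nc] by (intro skip)
      qed
    qed
  qed
  then show ?thesis by (rule runs_weaken) (simp_all add: relax_cost_def)
qed

end

section \<open>The search loop\<close>

definition settle_start :: com where
  "settle_start =
     Store ''fin'' (var ''x'') (Const 1) ;;
     Store ''tv'' (Plus (var ''N'') (var ''x'')) (Const 0) ;;
     ''c'' ::= Div (Plus (var ''N'') (var ''x'')) (Const 2)"

definition settle :: com where
  "settle = settle_start ;; repair ;; jump_build ;; ''a'' ::= Cell ''head'' (var ''x'')"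

definition settle_cost :: "nat \<Rightarrow> nat" where
  "settle_cost K = ccost settle_start + (repair_cost K + (jump_cost K + 5))"

definition explore :: com where
  "explore = While (WLess (Const 0) (var ''a'')) relax"

definition search_step :: com where
  "search_step = settle ;; explore ;; ''x'' ::= Cell ''tv'' (Const 1)"

definition search_loop :: com where
  "search_loop = While (WLess (Const 0) (var ''x'')) search_step"

context input_graph
begin

lemma relax:
  assumes core: "core F A \<sigma>" and x: "words \<sigma> ''x'' 0 = x" "x \<in> F"
    and a: "words \<sigma> ''a'' 0 = a" "a \<in> set (arcs m x)"
  shows "runs b relax \<sigma> (relax_cost levels) (\<lambda>\<sigma>'. core F (insert (x, target a) A) \<sigma>' \<and>
    words \<sigma>' ''a'' 0 = words \<sigma> ''next'' a \<and> words \<sigma>' ''x'' 0 = x \<and> words \<sigma>' ''next'' = words \<sigma> ''next'')"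
proof -
  let ?y = "target a"
  have st: "static \<sigma>" and inv: "search F A (dist_of \<sigma>) (hops \<sigma>) (parent \<sigma>) (active \<sigma>)"
    using core by (auto simp: core_def)
  note arc = arcsD[OF a(2)]
  have xR: "x \<in> R" and hx: "hops \<sigma> x = depth x" using inv x by (auto simp: search_def settled_def)
  have xn: "x \<le> n" using reachable_subset xR by (auto simp: V_def)
  have hb: "Suc (words \<sigma> ''th'' (Suc (n + x))) < cap b" using hx depth_less[OF xR] cap_bounds by simp
  have data: "words \<sigma> ''N'' 0 = Suc n" "words \<sigma> ''to'' a = ?y" "reals \<sigma> ''w'' (a div 2 - 1) = w {x, ?y}"
    using st arc by (simp_all add: static_def)
  have start: "wp b relax_start (\<lambda>\<sigma>'. words \<sigma>' ''y'' 0 = ?y \<and> reals \<sigma>' ''nd'' 0 = dist_of \<sigma> x + w {x, ?y} \<and>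
      words \<sigma>' ''nh'' 0 = Suc (hops \<sigma> x)) \<sigma>"
    using data x(1) a(1) xn hb cap_bounds unfolding relax_start_def by simp
  have "runs b relax \<sigma> (ccost relax_start + ((relax_cost levels - ccost relax_start - 10) + ccost (''a'' ::= Cell ''next'' (var ''a''))))
    (\<lambda>\<sigma>'. core F (insert (x, target a) A) \<sigma>' \<and>
      words \<sigma>' ''a'' 0 = words \<sigma> ''next'' a \<and> words \<sigma>' ''x'' 0 = x \<and> words \<sigma>' ''next'' = words \<sigma> ''next'')"
    unfolding relax_def
  proof (rule runs_Seq[OF runs_frame[OF runs_wp[OF start]]])
    fix \<sigma>1
    assume *: "(words \<sigma>1 ''y'' 0 = ?y \<and> reals \<sigma>1 ''nd'' 0 = dist_of \<sigma> x + w {x, ?y} \<and>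
      words \<sigma>1 ''nh'' 0 = Suc (hops \<sigma> x)) \<and> frame relax_start \<sigma> \<sigma>1"
    note frame1 = frame_words[OF conjunct2[OF *]] frame_reals[OF conjunct2[OF *]]
    have same: "\<forall>a\<in>core_words. words \<sigma>1 a = words \<sigma> a" "reals \<sigma>1 ''w'' = reals \<sigma> ''w''" "reals \<sigma>1 ''td'' = reals \<sigma> ''td''"
      "words \<sigma>1 ''x'' = words \<sigma> ''x''" "words \<sigma>1 ''a'' = words \<sigma> ''a''" "words \<sigma>1 ''next'' = words \<sigma> ''next''"
      "words \<sigma>1 ''th'' = words \<sigma> ''th''"
      by (simp_all add: core_words_def static_words_def frame1 relax_start_def)
    have core1: "core F A \<sigma>1" by (rule core_cong[OF core same(1-3)])
    have offer: "runs b relax_offer \<sigma>1 (relax_cost levels - ccost relax_start - 10) (core F (insert (x, ?y) A))"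
      by (rule relax_offer[OF core1]) (use * same x arc(1) in simp_all)
    show "runs b (relax_offer ;; ''a'' ::= Cell ''next'' (var ''a'')) \<sigma>1
      (relax_cost levels - ccost relax_start - 10 + ccost (''a'' ::= Cell ''next'' (var ''a'')))
      (\<lambda>\<sigma>'. core F (insert (x, target a) A) \<sigma>' \<and>
        words \<sigma>' ''a'' 0 = words \<sigma> ''next'' a \<and> words \<sigma>' ''x'' 0 = x \<and> words \<sigma>' ''next'' = words \<sigma> ''next'')"
    proof (rule runs_Seq[OF runs_frame[OF offer]])
      fix \<sigma>2 assume **: "core F (insert (x, ?y) A) \<sigma>2 \<and> frame relax_offer \<sigma>1 \<sigma>2"
      have same2: "words \<sigma>2 ''x'' = words \<sigma>1 ''x''" "words \<sigma>2 ''a'' = words \<sigma>1 ''a''" "words \<sigma>2 ''next'' = words \<sigma>1 ''next''"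
        by (simp_all add: frame_words[OF conjunct2[OF **]] relax_offer_def relax_set_def relax_tie_start_def relax_tie_finish_def
            repair_def repair_step_def query_def query_start_def query_step_def query_move_def query_finish_def)
      let ?\<tau> = "set_word ''a'' 0 (words \<sigma> ''next'' a) \<sigma>2"
      have "core F (insert (x, ?y) A) ?\<tau>"
        by (rule core_cong[of _ _ \<sigma>2]) (use ** in \<open>simp_all add: core_words_def static_words_def\<close>)
      then show "runs b (''a'' ::= Cell ''next'' (var ''a'')) \<sigma>2 (ccost (''a'' ::= Cell ''next'' (var ''a'')))
        (\<lambda>\<sigma>'. core F (insert (x, target a) A) \<sigma>' \<and>
        words \<sigma>' ''a'' 0 = words \<sigma> ''next'' a \<and> words \<sigma>' ''x'' 0 = x \<and> words \<sigma>' ''next'' = words \<sigma> ''next'')"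
        using same same2 x a by (intro runs_wp) simp
    qed
  qed
  then show ?thesis by (rule runs_weaken) (simp_all add: relax_cost_def)
qed

text \<open>\<open>l\<close> is the unread rest of the arc list. Its offers together with
  \<open>A\<close> cover \<open>edges_from F\<close>, so reaching the end of the list makes
  \<open>A\<close> complete.\<close>

lemma explore:
  assumes core: "core F A \<sigma>" and x: "words \<sigma> ''x'' 0 = x" "x \<in> F"
    and l: "chain (words \<sigma> ''next'') (words \<sigma> ''a'' 0) l" "set l \<subseteq> set (arcs m x)"
    and A: "edges_from F \<subseteq> A \<union> (\<lambda>a. (x, target a)) ` set l"
  shows "runs b explore \<sigma> (length l * (relax_cost levels + 5) + 5) (core F (edges_from F))"
proof -
  define I where "I k \<tau> \<longleftrightarrow> (\<exists>A l. length l = k \<and> core F A \<tau> \<and> words \<tau> ''x'' 0 = x \<and>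
    chain (words \<tau> ''next'') (words \<tau> ''a'' 0) l \<and> set l \<subseteq> set (arcs m x) \<and>
    edges_from F \<subseteq> A \<union> (\<lambda>a. (x, target a)) ` set l)" for k and \<tau> :: store
  let ?g = "WLess (Const 0) (var ''a'')"
  have "I (length l) \<sigma>" using assms unfolding I_def by blast
  then have "runs b explore \<sigma> (length l * (relax_cost levels + 1 + tcost ?g) + 1 + tcost ?g)
    (\<lambda>\<sigma>'. (\<exists>k'. I k' \<sigma>') \<and> \<not> tval b ?g \<sigma>')"
    unfolding explore_def
  proof (rule runs_While_count)
    fix k \<tau> assume I: "I k \<tau>" and g: "tval b ?g \<tau>"
    obtain A l where l: "length l = k" "core F A \<tau>" "words \<tau> ''x'' 0 = x"
      "chain (words \<tau> ''next'') (words \<tau> ''a'' 0) l" "set l \<subseteq> set (arcs m x)"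
      "edges_from F \<subseteq> A \<union> (\<lambda>a. (x, target a)) ` set l"
      using I unfolding I_def by blast
    have "words \<tau> ''a'' 0 \<noteq> 0" using g by simp
    then obtain a l' where l': "l = a # l'" using l(4) by (cases l) auto
    have a: "words \<tau> ''a'' 0 = a" "a \<in> set (arcs m x)" using l l' by auto
    have "runs b relax \<tau> (relax_cost levels) (I (k - 1))"
    proof (rule runs_weaken[OF relax[OF l(2,3) x(2) a] order_refl])
      fix \<sigma>' assume *: "core F (insert (x, target a) A) \<sigma>' \<and>
        words \<sigma>' ''a'' 0 = words \<tau> ''next'' a \<and> words \<sigma>' ''x'' 0 = x \<and> words \<sigma>' ''next'' = words \<tau> ''next''"
      show "I (k - 1) \<sigma>'"
        unfolding I_def using * l l'
        by (intro exI[of _ "insert (x, target a) A"] exI[of _ l']) auto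
    qed
    then show "0 < k \<and> runs b relax \<tau> (relax_cost levels) (I (k - 1))" using l(1) l' by auto
  qed
  then show ?thesis
  proof (rule runs_weaken)
    fix \<sigma>' assume *: "(\<exists>k'. I k' \<sigma>') \<and> \<not> tval b ?g \<sigma>'"
    then obtain A l where l: "core F A \<sigma>'" "chain (words \<sigma>' ''next'') (words \<sigma>' ''a'' 0) l"
      "edges_from F \<subseteq> A \<union> (\<lambda>a. (x, target a)) ` set l"
      unfolding I_def by blast
    have "l = []" using * l(2) by (cases l) auto
    moreover have "A \<subseteq> edges_from F" using l(1) by (auto simp: core_def search_def edges_from_def)
    ultimately have "A = edges_from F" using l(3) by auto
    then show "core F (edges_from F) \<sigma>'" using l(1) by simp
  qed (simp_all add: algebra_simps)
qed

text \<open>The jump table of \<open>x\<close> is finished before its arcs are read, because ties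
  involving offers from \<open>x\<close> query it.\<close>

lemma settle:
  assumes core: "core F (edges_from F) \<sigma>" and x: "words \<sigma> ''x'' 0 = x" "x \<in> V - F"
    and settled: "settled x (dist_of \<sigma>) (hops \<sigma>) (parent \<sigma>)" "x \<noteq> s \<Longrightarrow> parent \<sigma> x \<in> F"
  shows "runs b settle \<sigma> (settle_cost levels) (\<lambda>\<sigma>'. core (insert x F) (edges_from F) \<sigma>' \<and>
    words \<sigma>' ''x'' 0 = x \<and> chain (words \<sigma>' ''next'') (words \<sigma>' ''a'' 0) (arcs m x))"
    (is "runs _ _ _ _ ?P")
proof -
  let ?N = "Suc n"
  have st: "static \<sigma>" and inv: "search F (edges_from F) (dist_of \<sigma>) (hops \<sigma>) (parent \<sigma>) (active \<sigma>)"
    and tour: "tournament ?N (entry \<sigma>)" and act0: "active \<sigma> 0 = 0"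
    and fin: "\<forall>v\<in>V. words \<sigma> ''fin'' v \<noteq> 0 \<longleftrightarrow> v \<in> F" and jumps: "jumps levels F (words \<sigma> ''up'') (words \<sigma> ''mn'')"
    using core by (auto simp: core_def)
  have NK: "words \<sigma> ''N'' 0 = ?N" "words \<sigma> ''K'' 0 = levels" using st by (simp_all add: static_def)
  have xV: "x \<in> V" "x \<notin> F" "0 < x" "x \<le> n" using x by (auto simp: V_def)
  note ins = search_insert[OF inv settled(1) x(2) settled(2)]
  have xR: "x \<in> R" using settled by (simp add: settled_def)
  let ?S = "\<lambda>\<sigma>'. words \<sigma>' ''tv'' = (words \<sigma> ''tv'')(?N + x := 0) \<and>
    words \<sigma>' ''fin'' = (words \<sigma> ''fin'')(x := 1) \<and> words \<sigma>' ''c'' 0 = (?N + x) div 2"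
  have start: "wp b settle_start ?S \<sigma>"
    using cap_bounds xV NK x unfolding settle_start_def by simp
  show ?thesis
    unfolding settle_def settle_cost_def
  proof (rule runs_Seq[OF runs_frame[OF runs_wp[OF start]]])
    fix \<sigma>1 assume *: "?S \<sigma>1 \<and> frame settle_start \<sigma> \<sigma>1"
    then have S: "?S \<sigma>1" by blast
    note frame1 = frame_words[OF conjunct2[OF *]] frame_reals[OF conjunct2[OF *]]
    have rep: "runs b repair \<sigma>1 (repair_cost levels) (\<lambda>\<tau>. (tournament ?N (entry \<tau>) \<and> same_above ?N \<sigma>1 \<tau>) \<and> frame repair \<sigma>1 \<tau>)"
    proof (rule repair_leaf[OF tour xV(1)])
      show "words \<sigma>1 ''c'' 0 = (?N + x) div 2" using S by blast
      show "words \<sigma>1 ''tv'' i = words \<sigma> ''tv'' i \<and> reals \<sigma>1 ''td'' i = reals \<sigma> ''td'' i \<and>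
        words \<sigma>1 ''th'' i = words \<sigma> ''th'' i" if "i \<noteq> ?N + x" for i
        using S that by (simp add: frame1 settle_start_def)
    qed
    show "runs b (repair ;; jump_build ;; ''a'' ::= Cell ''head'' (var ''x'')) \<sigma>1 (repair_cost levels + (jump_cost levels + 5)) ?P"
    proof (rule runs_Seq[OF rep])
      fix \<sigma>2 assume **: "(tournament ?N (entry \<sigma>2) \<and> same_above ?N \<sigma>1 \<sigma>2) \<and> frame repair \<sigma>1 \<sigma>2"
      note frame2 = frame_words[OF conjunct2[OF **]] frame_reals[OF conjunct2[OF **]]
      note frames = frame1 frame2 settle_start_def repair_def repair_step_def
      have same: "\<forall>a\<in>static_words. words \<sigma>2 a = words \<sigma> a" "parent \<sigma>2 = parent \<sigma>"
        "words \<sigma>2 ''up'' = words \<sigma> ''up''" "words \<sigma>2 ''mn'' = words \<sigma> ''mn''" "words \<sigma>2 ''x'' = words \<sigma> ''x''"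
        "words \<sigma>2 ''fin'' = words \<sigma>1 ''fin''" "reals \<sigma>2 ''w'' = reals \<sigma> ''w''"
        by (simp_all add: static_words_def frames)
      have "words \<sigma>1 ''th'' = words \<sigma> ''th''" "reals \<sigma>1 ''td'' = reals \<sigma> ''td''"
        by (simp_all add: frames)
      then have upd: "dist_of \<sigma>2 = dist_of \<sigma>" "hops \<sigma>2 = hops \<sigma>" "active \<sigma>2 = (active \<sigma>)(x := 0)"
        using S ** by (auto simp: fun_eq_iff same_above_def)
      have inv2: "search (insert x F) (edges_from F) (dist_of \<sigma>2) (hops \<sigma>2) (parent \<sigma>2) (active \<sigma>2)"
        unfolding upd same(2) by (rule ins)
      have act2: "active \<sigma>2 0 = 0" using fun_cong[OF upd(3), of 0] act0 by simp
      have fin2: "\<forall>v\<in>V. words \<sigma>2 ''fin'' v \<noteq> 0 \<longleftrightarrow> v \<in> insert x F" using fin S same(6) by simp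
      have st2: "static \<sigma>2" by (rule static_cong[OF st same(1,7)])
      have jb: "runs b jump_build \<sigma>2 (jump_cost levels) (\<lambda>\<sigma>'. jumps levels (insert x F) (words \<sigma>' ''up'') (words \<sigma>' ''mn''))"
      proof (rule jump_build)
        show "F \<subseteq> R" using inv by (simp add: search_def)
        show "set (sp x) \<subseteq> insert x F" using inv2 by (simp add: search_def)
        show "words \<sigma>2 ''parent'' x = (if x = s then s else pred x)" using settled same(2) by (simp add: settled_def)
        show "jumps levels F (words \<sigma>2 ''up'') (words \<sigma>2 ''mn'')" using jumps same by simp
        show "words \<sigma>2 ''N'' 0 = Suc n" "words \<sigma>2 ''K'' 0 = levels" using st2 by (simp_all add: static_def)
      qed (use xR xV x same cap_bounds in simp_all)
      show "runs b (jump_build ;; ''a'' ::= Cell ''head'' (var ''x'')) \<sigma>2 (jump_cost levels + 5) ?P"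
      proof (rule runs_Seq[OF runs_frame[OF jb]])
        fix \<sigma>3 assume ***: "jumps levels (insert x F) (words \<sigma>3 ''up'') (words \<sigma>3 ''mn'') \<and> frame jump_build \<sigma>2 \<sigma>3"
        note frame3 = frame_words[OF conjunct2[OF ***]] frame_reals[OF conjunct2[OF ***]] jump_build_def jump_start_def jump_step_def
        have same3: "\<forall>a\<in>static_words. words \<sigma>3 a = words \<sigma>2 a" "parent \<sigma>3 = parent \<sigma>2" "words \<sigma>3 ''tv'' = words \<sigma>2 ''tv''"
          "words \<sigma>3 ''th'' = words \<sigma>2 ''th''" "words \<sigma>3 ''x'' = words \<sigma>2 ''x''" "words \<sigma>3 ''fin'' = words \<sigma>2 ''fin''"
          by (simp_all add: static_words_def frame3)
        have samer3: "reals \<sigma>3 = reals \<sigma>2" by (rule ext) (simp add: frame3)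
        have st3: "static \<sigma>3" by (rule static_cong[OF st2 same3(1)]) (simp add: samer3)
        have "entry \<sigma>3 = entry \<sigma>2" by (simp add: entry_def fun_eq_iff same3 samer3)
        then have core3: "core (insert x F) (edges_from F) \<sigma>3"
          unfolding core_def using st3 inv2 act2 ** fin2 *** by (simp add: same3 samer3)
        let ?\<tau> = "set_word ''a'' 0 (words \<sigma>3 ''head'' x) \<sigma>3"
        have "core (insert x F) (edges_from F) ?\<tau>"
          by (rule core_cong[OF core3]) (simp_all add: core_words_def static_words_def)
        moreover have "chain (words \<sigma>3 ''next'') (words \<sigma>3 ''head'' x) (arcs m x)"
          using st3 xV by (simp add: static_def)
        ultimately have "wp b (''a'' ::= Cell ''head'' (var ''x'')) ?P \<sigma>3"
          using x same same3 by simp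
        then show "runs b (''a'' ::= Cell ''head'' (var ''x'')) \<sigma>3 5 ?P"
          by (rule runs_weaken[OF runs_wp]) simp_all
      qed
    qed
  qed
qed

text \<open>The root repeats the entry of a leaf, and an active leaf holds its own vertex number, so
  node 1 names that vertex. No leaf beats it, which is the minimality needed for settling; an empty
  root leaves no active vertex at all.\<close>

lemma next_vertex:
  assumes core: "core F (edges_from F) \<sigma>" and s: "s \<in> F"
  defines "v \<equiv> words \<sigma> ''tv'' 1"
  shows "v = 0 \<Longrightarrow> F = R"
    and "v \<noteq> 0 \<Longrightarrow> v \<in> V - F \<and> settled v (dist_of \<sigma>) (hops \<sigma>) (parent \<sigma>) \<and> parent \<sigma> v \<in> F"
proof -
  let ?N = "Suc n"
  have inv: "search F (edges_from F) (dist_of \<sigma>) (hops \<sigma>) (parent \<sigma>) (active \<sigma>)"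
    and tour: "tournament ?N (entry \<sigma>)" and act0: "active \<sigma> 0 = 0"
    using core by (auto simp: core_def)
  have best: "\<not> beats (entry \<sigma> (?N + y)) (entry \<sigma> 1)" if "y \<in> V" for y
    by (rule tournament_root_best[OF tour]) (use that in \<open>auto simp: V_def\<close>)
  show "F = R" if "v = 0"
  proof (rule search_complete[OF inv s], intro ballI)
    fix y assume "y \<in> V - F"
    then have "\<not> beats (entry \<sigma> (?N + y)) None" using best[of y] that by (simp add: entry_def v_def)
    then show "active \<sigma> y = 0" by (simp add: entry_def split: if_splits)
  qed
  show "v \<in> V - F \<and> settled v (dist_of \<sigma>) (hops \<sigma>) (parent \<sigma>) \<and> parent \<sigma> v \<in> F" if v: "v \<noteq> 0"
  proof -
    obtain l where l: "l \<in> {?N..<2 * ?N}" "entry \<sigma> l = entry \<sigma> 1"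
      using tournament_leaf[OF tour, of 1] by auto
    define y where "y = l - ?N"
    have y: "l = ?N + y" "y \<le> n" using l by (auto simp: y_def)
    have eq: "entry \<sigma> (?N + y) = entry \<sigma> 1" using l y by simp
    then have act: "active \<sigma> y = v" using v by (auto simp: entry_def v_def split: if_splits)
    then have "y \<noteq> 0" using act0 v by (cases "y = 0") auto
    then have yV: "y \<in> V" using y by (simp add: V_def)
    moreover have "y \<notin> F" using inv act v by (auto simp: search_def)
    ultimately have yVF: "y \<in> V - F" by blast
    have act_y: "active \<sigma> y \<noteq> 0" using act v by simp
    have "v = y" using search_active(1)[OF inv yVF act_y] act by simp
    have min: "dist_of \<sigma> y < dist_of \<sigma> z \<or> dist_of \<sigma> y = dist_of \<sigma> z \<and> hops \<sigma> y \<le> hops \<sigma> z"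
      if "z \<in> V - F" "active \<sigma> z \<noteq> 0" for z
    proof -
      have "\<not> beats (entry \<sigma> (?N + z)) (entry \<sigma> (?N + y))" unfolding eq using best that by blast
      then show ?thesis using that act_y by (auto simp: entry_def)
    qed
    show ?thesis unfolding \<open>v = y\<close> using search_settle[OF inv s yVF act_y min] yVF by blast
  qed
qed

text \<open>The cost of a round apart from its arcs: settling, 5 for the failing test that ends the
  arc loop, 4 for reading the root, and \<open>1 + 4\<close> for the test of the search
  loop.\<close>

definition step_cost :: nat where
  "step_cost = settle_cost levels + 5 + 4 + 1 + 4"

text \<open>The potential \<open>k\<close> charges each unsettled vertex for its own round,
  including its arcs, so high degrees are paid for only once. The alternative \<open>x = s\<close>
  covers the first round, in which the source is settled without having been in the queue.\<close>

definition search_inv :: "nat \<Rightarrow> store \<Rightarrow> bool" where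
  "search_inv k \<sigma> \<longleftrightarrow> (\<exists>F x. words \<sigma> ''x'' 0 = x \<and> core F (edges_from F) \<sigma> \<and> (s \<in> F \<or> x = s) \<and>
     (if x = 0 then F = R
      else x \<in> V - F \<and> settled x (dist_of \<sigma>) (hops \<sigma>) (parent \<sigma>) \<and> (x \<noteq> s \<longrightarrow> parent \<sigma> x \<in> F)) \<and>
     k = (\<Sum>y\<in>V - F. step_cost + length (arcs m y) * (relax_cost levels + 5)))"

lemma search_step:
  assumes inv: "search_inv k \<sigma>" and x: "words \<sigma> ''x'' 0 \<noteq> 0"
  shows "\<exists>T. runs b search_step \<sigma> T (\<lambda>\<sigma>'. \<exists>k'. search_inv k' \<sigma>' \<and> k' + T + 1 + tcost (WLess (Const 0) (var ''x'')) \<le> k)"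
proof -
  let ?x = "words \<sigma> ''x'' 0"
  obtain F where F: "core F (edges_from F) \<sigma>" "s \<in> F \<or> ?x = s"
    "?x \<in> V - F" "settled ?x (dist_of \<sigma>) (hops \<sigma>) (parent \<sigma>)" "?x \<noteq> s \<longrightarrow> parent \<sigma> ?x \<in> F"
    and k: "k = (\<Sum>y\<in>V - F. step_cost + length (arcs m y) * (relax_cost levels + 5))"
    using inv x unfolding search_inv_def by auto
  let ?F = "insert ?x F"
  define k' where "k' = (\<Sum>y\<in>V - ?F. step_cost + length (arcs m y) * (relax_cost levels + 5))"
  have VF: "V - F = insert ?x (V - ?F)" using F by auto
  then have kk: "k = step_cost + length (arcs m ?x) * (relax_cost levels + 5) + k'"
    unfolding k k'_def VF by (subst sum.insert) simp_all
  let ?T = "settle_cost levels + (length (arcs m ?x) * (relax_cost levels + 5) + 5 + 4)"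
  have "runs b search_step \<sigma> ?T (search_inv k')"
    unfolding search_step_def
  proof (rule runs_Seq[OF settle[OF F(1) refl F(3,4)]])
    show "parent \<sigma> ?x \<in> F" if "?x \<noteq> s" using F that by blast
    fix \<sigma>1 assume 1: "core ?F (edges_from F) \<sigma>1 \<and> words \<sigma>1 ''x'' 0 = ?x \<and>
      chain (words \<sigma>1 ''next'') (words \<sigma>1 ''a'' 0) (arcs m ?x)"
    show "runs b (explore ;; ''x'' ::= Cell ''tv'' (Const 1)) \<sigma>1 (length (arcs m ?x) * (relax_cost levels + 5) + 5 + 4) (search_inv k')"
    proof (rule runs_Seq[OF explore])
      show "edges_from ?F \<subseteq> edges_from F \<union> (\<lambda>a. (?x, target a)) ` set (arcs m ?x)"
        by (auto simp: edges_from_def elim: arcs_complete)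
      fix \<sigma>2 assume 2: "core ?F (edges_from ?F) \<sigma>2"
      have sF: "s \<in> ?F" using F by auto
      note nv = next_vertex[OF 2 sF]
      let ?v = "words \<sigma>2 ''tv'' 1"
      let ?\<tau> = "set_word ''x'' 0 ?v \<sigma>2"
      have "core ?F (edges_from ?F) ?\<tau>"
        by (rule core_cong[OF 2]) (simp_all add: core_words_def static_words_def)
      then have "search_inv k' ?\<tau>"
        unfolding search_inv_def using sF nv k'_def by (intro exI[of _ ?F]) auto
      then have "wp b (''x'' ::= Cell ''tv'' (Const 1)) (search_inv k') \<sigma>2"
        using cap_bounds by simp
      then show "runs b (''x'' ::= Cell ''tv'' (Const 1)) \<sigma>2 4 (search_inv k')"
        by (rule runs_weaken[OF runs_wp]) simp_all
    qed (use 1 in auto)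
  qed
  moreover have "k' + ?T + 1 + tcost (WLess (Const 0) (var ''x'')) \<le> k" unfolding kk by (simp add: step_cost_def)
  ultimately have "runs b search_step \<sigma> ?T (\<lambda>\<sigma>'. \<exists>k'. search_inv k' \<sigma>' \<and> k' + ?T + 1 + tcost (WLess (Const 0) (var ''x'')) \<le> k)"
    by (blast intro: runs_weaken[OF _ order_refl])
  then show ?thesis by (rule exI[where x = ?T])
qed

lemma search_loop:
  assumes "search_inv k \<sigma>"
  shows "runs b search_loop \<sigma> (k + 5) (core R (edges_from R))"
proof -
  let ?g = "WLess (Const 0) (var ''x'')"
  have "runs b search_loop \<sigma> (k + 1 + tcost ?g) (\<lambda>\<sigma>'. (\<exists>k'. search_inv k' \<sigma>') \<and> \<not> tval b ?g \<sigma>')"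
    unfolding search_loop_def by (rule runs_While[where I = search_inv, OF assms]) (rule search_step; simp)
  then show ?thesis
  proof (rule runs_weaken)
    fix \<sigma>' assume "(\<exists>k'. search_inv k' \<sigma>') \<and> \<not> tval b ?g \<sigma>'"
    then show "core R (edges_from R) \<sigma>'" by (auto simp: search_inv_def)
  qed simp
qed

text \<open>A vertex with a reachable neighbour is reachable; so an unreachable vertex never gets an
  offer and keeps parent 0.\<close>

lemma final_parent:
  assumes "core R (edges_from R) \<sigma>" "v \<in> V" "v \<noteq> s"
  shows "parent \<sigma> v = (if v \<in> R then pred v else 0)"
proof (cases "v \<in> R")
  case True
  then show ?thesis using assms by (simp add: core_def search_def settled_def)
next
  case False
  have "(x, v) \<notin> edges_from R" for x
  proof
    assume "(x, v) \<in> edges_from R"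
    then have "x \<in> R" "{x, v} \<in> E" by (auto simp: edges_from_def)
    have "\<exists>p. path v p"
    proof (cases "v \<in> set (sp x)")
      case True
      then obtain i where "i < length (sp x)" "sp x ! i = v" by (auto simp: in_set_conv_nth)
      then show ?thesis using path_between_take[OF sp_path[OF \<open>x \<in> R\<close>]] by blast
    next
      case False
      then show ?thesis using path_between_snoc[OF sp_path[OF \<open>x \<in> R\<close>] \<open>{x, v} \<in> E\<close> assms(2)] by blast
    qed
    then show False using False by (simp add: reachable_def)
  qed
  then have "parent \<sigma> v = 0"
    using assms False by (auto simp: core_def search_def offered_def)
  then show ?thesis using False by simp
qed

end

section \<open>Initialisation and the complete program\<close>

definition init_start :: com where
  "init_start = ''N'' ::= Plus (var ''n'') (Const 1) ;; ''K'' ::= Const 0 ;; ''l'' ::= Const 1"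

definition levels_step :: com where
  "levels_step = ''l'' ::= Times (Const 2) (var ''l'') ;; ''K'' ::= Plus (var ''K'') (Const 1)"

definition build_start :: com where
  "build_start = ''i'' ::= Const 0"

definition build_step :: com where
  "build_step =
     ''a'' ::= Plus (Times (Const 2) (var ''i'')) (Const 2) ;;
     Store ''to'' (var ''a'') (Cell ''v'' (var ''i'')) ;;
     Store ''next'' (var ''a'') (Cell ''head'' (Cell ''u'' (var ''i''))) ;;
     Store ''head'' (Cell ''u'' (var ''i'')) (var ''a'') ;;
     ''a'' ::= Plus (var ''a'') (Const 1) ;;
     Store ''to'' (var ''a'') (Cell ''u'' (var ''i'')) ;;
     Store ''next'' (var ''a'') (Cell ''head'' (Cell ''v'' (var ''i''))) ;;
     Store ''head'' (Cell ''v'' (var ''i'')) (var ''a'') ;;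
     ''i'' ::= Plus (var ''i'') (Const 1)"

text \<open>The source is its own parent during the search, as row 0 of the jump table requires; the
  required output value 0 is written only at the end.\<close>

definition search_start :: com where
  "search_start = ''x'' ::= var ''s'' ;; Store ''parent'' (var ''x'') (var ''x'')"

definition finish :: com where
  "finish = Store ''parent'' (var ''s'') (Const 0)"

definition program :: com where
  "program =
     init_start ;; While (WLess (var ''l'') (var ''N'')) levels_step ;;
     build_start ;; While (WLess (var ''i'') (var ''m'')) build_step ;;
     search_start ;; search_loop ;; finish"

section \<open>The whole program and its running time\<close>

context input_graph
begin

lemma levels_loop:
  assumes "words \<sigma> ''N'' 0 = Suc n" "words \<sigma> ''K'' 0 = 0" "words \<sigma> ''l'' 0 = 1"
  shows "runs b (While (WLess (var ''l'') (var ''N'')) levels_step) \<sigma> (levels * (ccost levels_step + 6) + 6)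
    (\<lambda>\<sigma>'. words \<sigma>' ''K'' 0 = levels)"
proof -
  define I where "I k \<tau> \<longleftrightarrow> (\<exists>j\<le>levels. k = levels - j \<and> words \<tau> ''K'' 0 = j \<and> words \<tau> ''l'' 0 = 2 ^ j \<and>
    words \<tau> ''N'' 0 = Suc n)" for k and \<tau> :: store
  let ?g = "WLess (var ''l'') (var ''N'')"
  have "I levels \<sigma>" using assms unfolding I_def by auto
  then have "runs b (While ?g levels_step) \<sigma> (levels * (ccost levels_step + 1 + tcost ?g) + 1 + tcost ?g)
    (\<lambda>\<sigma>'. (\<exists>k'. I k' \<sigma>') \<and> \<not> tval b ?g \<sigma>')"
  proof (rule runs_While_count)
    fix k \<tau> assume "I k \<tau>" and g: "tval b ?g \<tau>"
    then obtain j where j: "j \<le> levels" "k = levels - j" "words \<tau> ''K'' 0 = j" "words \<tau> ''l'' 0 = 2 ^ j"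
      "words \<tau> ''N'' 0 = Suc n" unfolding I_def by blast
    have le: "2 ^ j \<le> n" using g j by simp
    then have "j \<noteq> levels" using n_less_levels by auto
    then have lt: "j < levels" using j by simp
    \<comment> \<open>The loop test still bounds \<open>2 ^ j\<close> by \<open>n\<close>, so
      doubling does not overflow.\<close>
    have c: "2 * 2 ^ j < cap b" "Suc j < cap b" "2 < cap b" "1 < cap b"
      using le cap_bounds levels_le lt by simp_all
    have "wp b levels_step (I (levels - Suc j)) \<tau>"
      using j c lt unfolding levels_step_def I_def by simp
    then show "0 < k \<and> runs b levels_step \<tau> (ccost levels_step) (I (k - 1))"
      using runs_wp j lt by simp
  qed
  then show ?thesis
  proof (rule runs_weaken)
    fix \<sigma>' assume "(\<exists>k'. I k' \<sigma>') \<and> \<not> tval b ?g \<sigma>'"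
    then obtain j where j: "j \<le> levels" "words \<sigma>' ''K'' 0 = j" "n < 2 ^ j" unfolding I_def by auto
    have "levels \<le> j" unfolding levels_def using j(3) by (rule Least_le)
    then show "words \<sigma>' ''K'' 0 = levels" using j by simp
  qed (simp add: algebra_simps)
qed

lemma build_step_wp:
  assumes "words \<sigma> ''i'' 0 = i" "i < m" "words \<sigma> ''u'' i = fst (es ! i)" "words \<sigma> ''v'' i = snd (es ! i)"
  shows "wp b build_step (\<lambda>\<sigma>'. words \<sigma>' ''i'' 0 = Suc i \<and>
    words \<sigma>' ''to'' = (words \<sigma> ''to'')(2 * i + 2 := snd (es ! i), 2 * i + 3 := fst (es ! i)) \<and>
    words \<sigma>' ''next'' = (words \<sigma> ''next'')(2 * i + 2 := words \<sigma> ''head'' (fst (es ! i)), 2 * i + 3 := words \<sigma> ''head'' (snd (es ! i))) \<and>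
    words \<sigma>' ''head'' = (words \<sigma> ''head'')(fst (es ! i) := 2 * i + 2, snd (es ! i) := 2 * i + 3)) \<sigma>"
proof -
  have "2 * i + 4 < cap b" using assms(2) cap_bounds by simp
  then show ?thesis using assms edge_ends[OF assms(2)] unfolding build_step_def
    by (simp add: numeral_3_eq_3)
qed

text \<open>New arcs are put in front and have larger numbers than all earlier ones, so older links
  are untouched. The ends of an edge differ, so no list receives both of its arcs.\<close>

lemma arcs_Suc_chain:
  assumes "i < m" and nx: "chain nx (head x) (arcs i x)"
    and nx': "nx' = nx(2 * i + 2 := head (fst (es ! i)), 2 * i + 3 := head (snd (es ! i)))"
    and head': "head' = head(fst (es ! i) := 2 * i + 2, snd (es ! i) := 2 * i + 3)"
  shows "chain nx' (head' x) (arcs (Suc i) x)"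
proof -
  have ne: "fst (es ! i) \<noteq> snd (es ! i)" using edge_ends[OF assms(1)] by blast
  have "chain nx' (head x) (arcs i x)"
  proof (subst chain_cong)
    fix a assume "a \<in> set (arcs i x)"
    then obtain e where "e < i" "a = 2 * e + 2 \<or> a = 2 * e + 3" unfolding set_arcs by blast
    then have "a < 2 * i + 2" by linarith
    then show "nx' a = nx a" by (simp add: nx')
  qed (rule nx)
  then show ?thesis using ne
    by (cases "x = fst (es ! i)"; cases "x = snd (es ! i)") (simp_all add: nx' head')
qed

lemma build_loop:
  assumes "words \<sigma> ''i'' 0 = 0" "words \<sigma> ''m'' 0 = m" "\<forall>i<m. words \<sigma> ''u'' i = fst (es ! i)" "\<forall>i<m. words \<sigma> ''v'' i = snd (es ! i)"
    and "\<forall>x. words \<sigma> ''head'' x = 0"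
  shows "runs b (While (WLess (var ''i'') (var ''m'')) build_step) \<sigma> (m * (ccost build_step + 6) + 6)
    (\<lambda>\<sigma>'. (\<forall>x. chain (words \<sigma>' ''next'') (words \<sigma>' ''head'' x) (arcs m x)) \<and>
      (\<forall>a. 2 \<le> a \<longrightarrow> a < 2 * m + 2 \<longrightarrow> words \<sigma>' ''to'' a = target a))"
proof -
  define I where "I k \<tau> \<longleftrightarrow> (\<exists>i\<le>m. k = m - i \<and> words \<tau> ''i'' 0 = i \<and> words \<tau> ''m'' = words \<sigma> ''m'' \<and>
    words \<tau> ''u'' = words \<sigma> ''u'' \<and> words \<tau> ''v'' = words \<sigma> ''v'' \<and>
    (\<forall>x. chain (words \<tau> ''next'') (words \<tau> ''head'' x) (arcs i x)) \<and>
    (\<forall>a. 2 \<le> a \<longrightarrow> a < 2 * i + 2 \<longrightarrow> words \<tau> ''to'' a = target a))" for k and \<tau> :: store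
  let ?g = "WLess (var ''i'') (var ''m'')"
  have "I m \<sigma>" using assms unfolding I_def by auto
  then have "runs b (While ?g build_step) \<sigma> (m * (ccost build_step + 1 + tcost ?g) + 1 + tcost ?g)
    (\<lambda>\<sigma>'. (\<exists>k'. I k' \<sigma>') \<and> \<not> tval b ?g \<sigma>')"
  proof (rule runs_While_count)
    fix k \<tau> assume "I k \<tau>" and g: "tval b ?g \<tau>"
    then obtain i where i: "i \<le> m" "k = m - i" "words \<tau> ''i'' 0 = i" "words \<tau> ''m'' = words \<sigma> ''m''"
      "words \<tau> ''u'' = words \<sigma> ''u''" "words \<tau> ''v'' = words \<sigma> ''v''"
      and chains: "\<forall>x. chain (words \<tau> ''next'') (words \<tau> ''head'' x) (arcs i x)"
      and to: "\<forall>a. 2 \<le> a \<longrightarrow> a < 2 * i + 2 \<longrightarrow> words \<tau> ''to'' a = target a" unfolding I_def by blast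
    have lt: "i < m" using g i assms by simp
    have "runs b build_step \<tau> (ccost build_step) (I (m - Suc i))"
    proof (rule runs_weaken[OF runs_frame[OF runs_wp[OF build_step_wp[of \<tau> i]]] order_refl])
      show "words \<tau> ''i'' 0 = i" "i < m" "words \<tau> ''u'' i = fst (es ! i)" "words \<tau> ''v'' i = snd (es ! i)"
        using i lt assms by simp_all
      fix \<sigma>'
      assume *: "(words \<sigma>' ''i'' 0 = Suc i \<and>
        words \<sigma>' ''to'' = (words \<tau> ''to'')(2 * i + 2 := snd (es ! i), 2 * i + 3 := fst (es ! i)) \<and>
        words \<sigma>' ''next'' = (words \<tau> ''next'')(2 * i + 2 := words \<tau> ''head'' (fst (es ! i)), 2 * i + 3 := words \<tau> ''head'' (snd (es ! i))) \<and>
        words \<sigma>' ''head'' = (words \<tau> ''head'')(fst (es ! i) := 2 * i + 2, snd (es ! i) := 2 * i + 3)) \<and> frame build_step \<tau> \<sigma>'"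
      have same: "words \<sigma>' ''m'' = words \<tau> ''m''" "words \<sigma>' ''u'' = words \<tau> ''u''" "words \<sigma>' ''v'' = words \<tau> ''v''"
        by (simp_all add: frame_words[OF conjunct2[OF *]] build_step_def)
      have "chain (words \<sigma>' ''next'') (words \<sigma>' ''head'' x) (arcs (Suc i) x)" for x
        by (rule arcs_Suc_chain[OF lt spec[OF chains]]) (use * in blast)+
      moreover have "words \<sigma>' ''to'' a = target a" if "2 \<le> a" "a < 2 * Suc i + 2" for a
      proof -
        have "a < 2 * i + 2 \<or> a = 2 * i + 2 \<or> a = 2 * i + 3" using that by arith
        then consider "a < 2 * i + 2" | "a = 2 * i + 2" | "a = 2 * i + 3" by blast
        then show ?thesis
        proof cases
          case 1
          then show ?thesis using * to that(1) by simp
        next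
          case 2
          have "words \<sigma>' ''to'' (2 * i + 2) = snd (es ! i)" using * by simp
          then show ?thesis unfolding 2 target_simps .
        next
          case 3
          have "words \<sigma>' ''to'' (2 * i + 3) = fst (es ! i)" using * by simp
          then show ?thesis unfolding 3 target_simps .
        qed
      qed
      ultimately show "I (m - Suc i) \<sigma>'"
        unfolding I_def using * same i lt by (intro exI[of _ "Suc i"]) simp
    qed
    then show "0 < k \<and> runs b build_step \<tau> (ccost build_step) (I (k - 1))" using i lt by simp
  qed
  then show ?thesis
  proof (rule runs_weaken)
    fix \<sigma>' assume "(\<exists>k'. I k' \<sigma>') \<and> \<not> tval b ?g \<sigma>'"
    then obtain i where "i \<le> m" "\<not> i < m" "\<forall>x. chain (words \<sigma>' ''next'') (words \<sigma>' ''head'' x) (arcs i x)"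
      "\<forall>a. 2 \<le> a \<longrightarrow> a < 2 * i + 2 \<longrightarrow> words \<sigma>' ''to'' a = target a"
      unfolding I_def using assms by auto
    moreover from this have "i = m" by simp
    ultimately show "(\<forall>x. chain (words \<sigma>' ''next'') (words \<sigma>' ''head'' x) (arcs m x)) \<and>
      (\<forall>a. 2 \<le> a \<longrightarrow> a < 2 * m + 2 \<longrightarrow> words \<sigma>' ''to'' a = target a)" by simp
  qed (simp add: algebra_simps)
qed

definition search_cost :: nat where
  "search_cost = n * step_cost + 2 * m * (relax_cost levels + 5)"

text \<open>Zeroed arrays represent an empty tournament; the source enters through the variable
  \<open>x\<close>. Handshake counting evaluates the initial potential.\<close>

lemma search_inv_start:
  assumes st: "static \<sigma>" and x: "words \<sigma> ''x'' 0 = s"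
    and zero: "\<forall>i. words \<sigma> ''tv'' i = 0" "\<forall>i. words \<sigma> ''th'' i = 0" "\<forall>i. words \<sigma> ''fin'' i = 0"
      "\<forall>i. reals \<sigma> ''td'' i = 0" "\<forall>v. parent \<sigma> v = (if v = s then s else 0)"
  shows "search_inv search_cost \<sigma>"
proof -
  have "search {} (edges_from {}) (dist_of \<sigma>) (hops \<sigma>) (parent \<sigma>) (active \<sigma>)"
    using zero by (simp add: search_def offered_def edges_from_def)
  moreover have "tournament (Suc n) (entry \<sigma>)"
    using zero by (simp add: tournament_def winner_def entry_def)
  ultimately have core: "core {} (edges_from {}) \<sigma>"
    using st zero by (simp add: core_def jumps_def)
  have "settled s (dist_of \<sigma>) (hops \<sigma>) (parent \<sigma>)"
    using zero sp_source by (simp add: settled_def path_weight_single)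
  moreover have "search_cost = (\<Sum>y\<in>V - {}. step_cost + length (arcs m y) * (relax_cost levels + 5))"
    using sum_length_arcs[of m] by (simp add: search_cost_def sum.distrib flip: sum_distrib_right)
  moreover have "s \<noteq> 0" using source by simp
  ultimately show ?thesis
    unfolding search_inv_def using core x source_V by (intro exI[of _ "{}"] exI[of _ s]) simp
qed

definition program_cost :: nat where
  "program_cost = ccost init_start + ((levels * (ccost levels_step + 6) + 6) + (ccost build_start +
     ((m * (ccost build_step + 6) + 6) + (ccost search_start + ((search_cost + 5) + ccost finish)))))"

lemma program:
  "runs b program (input_store n s es w) program_cost (\<lambda>\<sigma>. \<forall>v\<in>V. parent \<sigma> v = (if v \<in> R - {s} then pred v else 0))"
proof -
  let ?\<sigma> = "input_store n s es w"
  define zero where "zero = {''head'', ''tv'', ''th'', ''fin'', ''parent'', ''up'', ''mn''}"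
  define inputs where "inputs = {''m'', ''s'', ''u'', ''v''}"
  have in_zero: "\<forall>a\<in>zero. words ?\<sigma> a = (\<lambda>_. 0)" and in_td: "reals ?\<sigma> ''td'' = (\<lambda>_. 0)"
    by (auto simp: zero_def input_store_def)
  have in_w: "\<forall>e<m. reals ?\<sigma> ''w'' e = w {fst (es ! e), snd (es ! e)}" by (simp add: input_store_def)
  have in_words: "words ?\<sigma> ''m'' 0 = m" "words ?\<sigma> ''s'' 0 = s" "\<forall>i<m. words ?\<sigma> ''u'' i = fst (es ! i)"
    "\<forall>i<m. words ?\<sigma> ''v'' i = snd (es ! i)" "words ?\<sigma> ''n'' 0 = n" by (simp_all add: input_store_def)
  have init: "wp b init_start (\<lambda>\<sigma>'. words \<sigma>' ''N'' 0 = Suc n \<and> words \<sigma>' ''K'' 0 = 0 \<and> words \<sigma>' ''l'' 0 = 1) ?\<sigma>"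
    using cap_bounds in_words unfolding init_start_def by simp
  show ?thesis
    unfolding program_def program_cost_def
  proof (rule runs_Seq[OF runs_frame[OF runs_wp[OF init]]], rule runs_Seq[OF runs_frame[OF levels_loop]])
    fix \<sigma>1
    assume 1: "(words \<sigma>1 ''N'' 0 = Suc n \<and> words \<sigma>1 ''K'' 0 = 0 \<and> words \<sigma>1 ''l'' 0 = 1) \<and> frame init_start ?\<sigma> \<sigma>1"
    then show "words \<sigma>1 ''N'' 0 = Suc n" "words \<sigma>1 ''K'' 0 = 0" "words \<sigma>1 ''l'' 0 = 1" by blast+
    fix \<sigma>2 assume 2: "words \<sigma>2 ''K'' 0 = levels \<and> frame (While (WLess (var ''l'') (var ''N'')) levels_step) \<sigma>1 \<sigma>2"
    note frames12 = frame_words[OF conjunct2[OF 2]] frame_reals[OF conjunct2[OF 2]]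
      frame_words[OF conjunct2[OF 1]] frame_reals[OF conjunct2[OF 1]] init_start_def levels_step_def
    have words2: "words \<sigma>2 a = words ?\<sigma> a" if "a \<in> zero \<union> inputs" for a
    proof -
      have "\<forall>a\<in>zero \<union> inputs. words \<sigma>2 a = words ?\<sigma> a" by (simp add: zero_def inputs_def frames12)
      then show ?thesis using that by blast
    qed
    have reals2: "reals \<sigma>2 = reals ?\<sigma>" by (rule ext) (simp add: frames12)
    have N2: "words \<sigma>2 ''N'' 0 = Suc n" "words \<sigma>2 ''K'' 0 = levels" using 1 2 by (simp_all add: frames12)
    have start: "wp b build_start (\<lambda>\<sigma>'. words \<sigma>' ''i'' 0 = 0) \<sigma>2" by (simp add: build_start_def)
    show "runs b (build_start ;; While (WLess (var ''i'') (var ''m'')) build_step ;; search_start ;; search_loop ;; finish) \<sigma>2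
      (ccost build_start + ((m * (ccost build_step + 6) + 6) + (ccost search_start + ((search_cost + 5) + ccost finish))))
      (\<lambda>\<sigma>. \<forall>v\<in>V. parent \<sigma> v = (if v \<in> R - {s} then pred v else 0))"
    proof (rule runs_Seq[OF runs_frame[OF runs_wp[OF start]]], rule runs_Seq[OF runs_frame[OF build_loop]])
      fix \<sigma>3 assume 3: "words \<sigma>3 ''i'' 0 = 0 \<and> frame build_start \<sigma>2 \<sigma>3"
      note frame3 = frame_words[OF conjunct2[OF 3]] frame_reals[OF conjunct2[OF 3]] build_start_def
      have same3: "\<forall>a\<in>zero \<union> inputs. words \<sigma>3 a = words \<sigma>2 a" by (simp add: zero_def inputs_def frame3)
      then have words3: "words \<sigma>3 a = words ?\<sigma> a" if "a \<in> zero \<union> inputs" for a using words2 that by simp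
      show "words \<sigma>3 ''i'' 0 = 0" using 3 by blast
      show "words \<sigma>3 ''m'' 0 = m" "\<forall>i<m. words \<sigma>3 ''u'' i = fst (es ! i)" "\<forall>i<m. words \<sigma>3 ''v'' i = snd (es ! i)"
        using in_words by (simp_all add: words3 inputs_def)
      show "\<forall>x. words \<sigma>3 ''head'' x = 0"
        using words3[of "''head''"] in_zero by (simp add: zero_def)
      fix \<sigma>4
      assume 4: "((\<forall>x. chain (words \<sigma>4 ''next'') (words \<sigma>4 ''head'' x) (arcs m x)) \<and>
        (\<forall>a. 2 \<le> a \<longrightarrow> a < 2 * m + 2 \<longrightarrow> words \<sigma>4 ''to'' a = target a)) \<and>
        frame (While (WLess (var ''i'') (var ''m'')) build_step) \<sigma>3 \<sigma>4"
      note frame4 = frame_words[OF conjunct2[OF 4]] frame_reals[OF conjunct2[OF 4]] build_step_def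
      have words4: "words \<sigma>4 a = words ?\<sigma> a" if "a \<in> (zero - {''head''}) \<union> inputs" for a
      proof -
        have "\<forall>a\<in>(zero - {''head''}) \<union> inputs. words \<sigma>4 a = words \<sigma>3 a" by (simp add: zero_def inputs_def frame4)
        then show ?thesis using that words3 by auto
      qed
      have reals4: "reals \<sigma>4 = reals ?\<sigma>" using reals2 by (intro ext) (simp add: frame4 frame3)
      have "words \<sigma>4 ''N'' 0 = Suc n" "words \<sigma>4 ''K'' 0 = levels" using N2 by (simp_all add: frame4 frame3)
      moreover have s4: "words \<sigma>4 ''s'' 0 = s" using in_words words4[of "''s''"] by (simp add: inputs_def)
      ultimately have st4: "static \<sigma>4" using 4 in_w unfolding static_def reals4 by simp
      have zero4: "words \<sigma>4 a i = 0" if "a \<in> zero - {''head''}" for a i using words4[of a] in_zero that by simp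
      have sstart: "wp b search_start (search_inv search_cost) \<sigma>4"
      proof -
        let ?\<tau> = "set_word ''parent'' s s (set_word ''x'' 0 s \<sigma>4)"
        have "static ?\<tau>" by (rule static_cong[OF st4]) (simp_all add: static_words_def)
        then have "search_inv search_cost ?\<tau>"
          by (rule search_inv_start) (simp_all add: zero4 zero_def reals4 in_td)
        then show ?thesis using s4 by (simp add: search_start_def)
      qed
      show "runs b (search_start ;; search_loop ;; finish) \<sigma>4 (ccost search_start + ((search_cost + 5) + ccost finish))
        (\<lambda>\<sigma>. \<forall>v\<in>V. parent \<sigma> v = (if v \<in> R - {s} then pred v else 0))"
      proof (rule runs_Seq[OF runs_wp[OF sstart]], rule runs_Seq[OF search_loop])
        fix \<sigma>6 assume 6: "core R (edges_from R) \<sigma>6"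
        then have "words \<sigma>6 ''s'' 0 = s" by (simp add: core_def static_def)
        then have "wp b finish (\<lambda>\<sigma>. \<forall>v\<in>V. parent \<sigma> v = (if v \<in> R - {s} then pred v else 0)) \<sigma>6"
          using final_parent[OF 6] by (simp add: finish_def)
        then show "runs b finish \<sigma>6 (ccost finish) (\<lambda>\<sigma>. \<forall>v\<in>V. parent \<sigma> v = (if v \<in> R - {s} then pred v else 0))"
          by (rule runs_wp)
      qed
    qed
  qed
qed

end

section \<open>The running time bound\<close>

definition unit_cost :: nat where
  "unit_cost = ccost init_start + ccost levels_step + ccost build_start + ccost build_step + ccost search_start + ccost finish +
     ccost settle_start + ccost repair_step + ccost jump_start + ccost jump_step + ccost relax_start + tcost relax_closer +
     tcost relax_tied + ccost relax_set + ccost relax_tie_start + ccost relax_tie_finish + ccost query_start + ccost query_step +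
     ccost query_finish + 100"

lemma repair_cost_le: "repair_cost K \<le> unit_cost * Suc K"
proof -
  have "Suc K * (ccost repair_step + 10) \<le> Suc K * unit_cost"
    by (rule mult_le_mono2) (simp add: unit_cost_def)
  then show ?thesis by (simp only: repair_cost_def mult.commute)
qed

lemma affine_le: "c \<le> u \<Longrightarrow> a \<le> u \<Longrightarrow> a + K * c \<le> u * Suc (K::nat)"
  by (simp add: add_mono mult.commute)

lemma jump_cost_le: "jump_cost K \<le> unit_cost * Suc K"
proof -
  have "(ccost jump_start + 6) + K * (ccost jump_step + 6) \<le> unit_cost * Suc K"
    by (rule affine_le) (simp_all add: unit_cost_def)
  then show ?thesis by (simp add: jump_cost_def)
qed

lemma query_cost_le: "query_cost K \<le> unit_cost * Suc K"
proof -
  have "(ccost query_start + 5 + ccost query_finish) + K * (ccost query_step + 5) \<le> unit_cost * Suc K"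
    by (rule affine_le) (simp_all add: unit_cost_def)
  then show ?thesis by (simp add: query_cost_def)
qed

context input_graph
begin

text \<open>\<open>unit_cost\<close> majorises the constants of all program pieces, so the phases
  add up to \<open>2 + m + 4 * n + 8 * m\<close> units of \<open>unit_cost * Suc levels\<close>. The
  additive 2 is absorbed because \<open>n\<close> is positive.\<close>

lemma program_cost_le: "program_cost \<le> 20 * unit_cost * (m + n) * Suc levels"
proof -
  let ?U = "unit_cost * Suc levels"
  have U: "unit_cost \<le> ?U" by simp
  have "step_cost \<le> 4 * ?U"
    using repair_cost_le[of levels] jump_cost_le[of levels] U
    by (simp add: step_cost_def settle_cost_def unit_cost_def)
  then have step: "n * step_cost \<le> n * (4 * ?U)" by (rule mult_le_mono2)
  have "relax_cost levels + 5 \<le> 4 * ?U"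
    using repair_cost_le[of levels] query_cost_le[of levels] U
    unfolding relax_cost_def unit_cost_def by linarith
  then have relax: "2 * m * (relax_cost levels + 5) \<le> 2 * m * (4 * ?U)" by (rule mult_le_mono2)
  have lev: "levels * (ccost levels_step + 6) + 6 \<le> ?U"
    using affine_le[of "ccost levels_step + 6" unit_cost 6 levels] by (simp add: unit_cost_def add.commute)
  have "ccost build_step + 6 \<le> ?U" using U unfolding unit_cost_def by linarith
  then have build: "m * (ccost build_step + 6) \<le> m * ?U" by (rule mult_le_mono2)
  have rest: "ccost init_start + ccost build_start + 6 + ccost search_start + 5 + ccost finish \<le> ?U"
    using U unfolding unit_cost_def by linarith
  have "program_cost \<le> (2 + m + 4 * n + 8 * m) * ?U"
    using step relax lev build rest unfolding program_cost_def search_cost_def by (simp only: distrib_right; linarith)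
  also have "\<dots> \<le> (20 * (m + n)) * ?U"
  proof (rule mult_le_mono1)
    show "2 + m + 4 * n + 8 * m \<le> 20 * (m + n)" using n_pos by simp
  qed
  finally show ?thesis by (simp only: mult_ac)
qed

text \<open>\<open>levels - 1\<close> is at most the logarithm, and the remaining 2 is at most twice
  the logarithm, which the maximum with 2 keeps at least 1.\<close>

lemma Suc_levels_le: "real (Suc levels) \<le> 3 * log 2 (real (max 2 n))"
proof -
  have L: "1 \<le> log 2 (real (max 2 n))" by (simp add: le_log_iff)
  have "2 powr real (levels - 1) \<le> real (max 2 n)"
    using levels_le(1) by (simp add: powr_realpow le_max_iff_disj)
  then have "real (levels - 1) \<le> log 2 (real (max 2 n))" by (simp add: le_log_iff)
  moreover have "real (Suc levels) = real (levels - 1) + 2" using levels_pos by simp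
  ultimately show ?thesis using L by linarith
qed

end

theorem theorem3:
  "\<exists>(prog :: com) (C :: real) (k :: nat).
     \<forall>(n :: nat) (E :: nat set set) (w :: nat set \<Rightarrow> real) (s :: nat) (es :: (nat \<times> nat) list) (b :: nat).
       weighted_graph n E w \<longrightarrow> s \<in> {1..n} \<longrightarrow> edge_list E es \<longrightarrow>
       (n + card E + 2) ^ k \<le> 2 ^ b \<longrightarrow>
       (\<exists>t \<sigma> T. exec b prog (input_store n s es w) t \<sigma> \<and>
          real t \<le> C * real (card E + n) * log 2 (real (max 2 n)) \<and>
          lex_shortest_path_tree {1..n} E w s T \<and>
          parent_array n (reachable {1..n} E s) T s (words \<sigma> ''parent''))"
proof (rule exI[of _ program], rule exI[of _ "60 * real unit_cost"], rule exI[of _ 4], intro allI impI)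
  fix n :: nat and E :: "nat set set" and w :: "nat set \<Rightarrow> real" and s :: nat and es :: "(nat \<times> nat) list" and b :: nat
  assume "weighted_graph n E w" "s \<in> {1..n}" "edge_list E es" "(n + card E + 2) ^ 4 \<le> 2 ^ b"
  then interpret input_graph n E w s es b
    by unfold_locales (simp_all add: edge_list_card)
  have card: "card E = m" using edges by (rule edge_list_card)
  obtain t \<sigma> where run: "exec b program (input_store n s es w) t \<sigma>" "t \<le> program_cost"
    and par: "\<forall>v\<in>V. parent \<sigma> v = (if v \<in> R - {s} then pred v else 0)"
    using program unfolding runs_def by blast
  have "real t \<le> real (20 * unit_cost * (m + n) * Suc levels)"
    using run(2) program_cost_le by (simp only: of_nat_le_iff)
  also have "\<dots> = 20 * real unit_cost * real (m + n) * real (Suc levels)" by (simp only: of_nat_mult of_nat_numeral)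
  \<comment> \<open>The factor 20 for the program and the factor 3 for the levels give the constant
    60.\<close>
  also have "\<dots> \<le> 20 * real unit_cost * real (m + n) * (3 * log 2 (real (max 2 n)))"
    by (rule mult_left_mono[OF Suc_levels_le]) simp
  also have "\<dots> = 60 * real unit_cost * real (m + n) * log 2 (real (max 2 n))" by simp
  finally have time: "real t \<le> 60 * real unit_cost * real (card E + n) * log 2 (real (max 2 n))"
    unfolding card .
  have "parent_array n R sp_tree s (words \<sigma> ''parent'')"
    by (rule parent_array_sp_tree) (use par in simp)
  then show "\<exists>t \<sigma> T. exec b program (input_store n s es w) t \<sigma> \<and>
      real t \<le> 60 * real unit_cost * real (card E + n) * log 2 (real (max 2 n)) \<and>
      lex_shortest_path_tree {1..n} E w s T \<and>
      parent_array n (reachable {1..n} E s) T s (words \<sigma> ''parent'')"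
    using run(1) time sp_tree_lex_shortest_path_tree unfolding V_def by blast
qed

end
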